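(* Let $a>0$. The scattering matrix $S_a(\lambda)$ for the pair of operators $H_1$, $H_a$ is given by $$S_a(\lambda)=\frac{1+(1-a^2)\bigl(2\lambda^2-1+2i\lambda\sqrt{1-\lambda^2}\bigr)}{1+(1-a^2)\bigl(2\lambda^2-1-2i\lambda\sqrt{1-\lambda^2}\bigr)},\qquad\lambda\in(-1,1).$$ In particular, $S_a(-\lambda)=\overline{S_a(\lambda)}$ and $S_a(0)=1$. Moreover, $S_a(\lambda)\to1$ as $\lambda\to\pm1$ unless $a=\sqrt2$.
   Context: $\mathbb{Z}_+=\{0,1,2,\dots\}$ and $(e_n)_{n\ge0}$ is the canonical orthonormal basis of $\ell^2(\mathbb{Z}_+)$. For $a>0$, $H_a$ is the bounded self-adjoint operator on $\ell^2(\mathbb{Z}_+)$ given by $$H_ae_0=\tfrac a2e_1,\qquad H_ae_1=\tfrac12(ae_0+e_2),\qquad H_ae_n=\tfrac12(e_{n-1}+e_{n+1})\ \ (n\ge2).$$ The wave operators are the strong limits $W_\pm(H_a,H_1)=\operatorname{s-lim}_{t\to\pm\infty}e^{iH_at}e^{-iH_1t}$ (they exist and are complete since $H_a-H_1$ has finite rank). The scattering operator is $\mathbf{S}_a=W_+(H_a,H_1)^*W_-(H_a,H_1)$; it is unitary and commutes with $H_1$. The operator $H_1$ is diagonalized by the unitary operator $F_1:\ell^2(\mathbb{Z}_+)\to L^2(-1,1)$, $(F_1e_n)(\lambda)=\sqrt{2/\pi}\,\sqrt[4]{1-\lambda^2}\,\mathsf{U}_n(\lambda)$, where $\mathsf{U}_n$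 are the Chebyshev polynomials of the second kind ($\mathsf U_0=1$, $\mathsf U_1(\lambda)=2\lambda$, $\mathsf U_{n-1}(\lambda)+\mathsf U_{n+1}(\lambda)=2\lambda\mathsf U_n(\lambda)$ for $n\ge 1$), so that $F_1H_1F_1^*$ is multiplication by $\lambda$. The scattering matrix $S_a(\lambda)\in\mathbb{C}$, $|S_a(\lambda)|=1$, is the function defined by $(F_1\mathbf{S}_af)(\lambda)=S_a(\lambda)(F_1f)(\lambda)$, $\lambda\in(-1,1)$, for all $f\in\ell^2(\mathbb{Z}_+)$ (as an identity for almost every $\lambda$; the continuous representative is meant). *)

theory Defs
  imports "HOL-Analysis.Analysis"
begin

section \<open>The complex Hilbert space of square-summable sequences\<close>

definition square_summable :: "(nat \<Rightarrow> complex) \<Rightarrow> bool" where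
  "square_summable x \<longleftrightarrow> summable (\<lambda>n. (cmod (x n))\<^sup>2)"

lemma square_summable_zero: "square_summable (\<lambda>_. 0)"
  by (simp add: square_summable_def)

lemma square_summable_add:
  assumes "square_summable x" "square_summable y"
  shows "square_summable (\<lambda>n. x n + y n)"
proof -
  have "(cmod (x n + y n))\<^sup>2 \<le> 2 * (cmod (x n))\<^sup>2 + 2 * (cmod (y n))\<^sup>2" for n
  proof -
    have "(cmod (x n + y n))\<^sup>2 \<le> (cmod (x n) + cmod (y n))\<^sup>2"
      by (intro power_mono norm_triangle_ineq) auto
    also have "\<dots> \<le> 2 * (cmod (x n))\<^sup>2 + 2 * (cmod (y n))\<^sup>2"
      using sum_squares_bound[of "cmod (x n)" "cmod (y n)"] by (simp add: power2_sum)
    finally show ?thesis .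
  qed
  moreover have "summable (\<lambda>n. 2 * (cmod (x n))\<^sup>2 + 2 * (cmod (y n))\<^sup>2)"
    using assms unfolding square_summable_def by (intro summable_add summable_mult)
  ultimately show ?thesis
    unfolding square_summable_def
    using summable_comparison_test'[of "\<lambda>n. 2 * (cmod (x n))\<^sup>2 + 2 * (cmod (y n))\<^sup>2" 0
        "\<lambda>n. (cmod (x n + y n))\<^sup>2"] by simp
qed

lemma square_summable_scale:
  "square_summable x \<Longrightarrow> square_summable (\<lambda>n. c * x n)"
  by (simp add: square_summable_def norm_mult power_mult_distrib summable_mult)

lemma square_summable_shift_iff:
  "square_summable (\<lambda>n. x (n + k)) \<longleftrightarrow> square_summable x"
  unfolding square_summable_def by (rule summable_iff_shift)

lemma summable_mult_cnj:
  assumes "square_summable x" "square_summable y"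
  shows "summable (\<lambda>n. x n * cnj (y n))"
proof (rule summable_comparison_test'[where N = 0])
  show "summable (\<lambda>n. (cmod (x n))\<^sup>2 + (cmod (y n))\<^sup>2)"
    using assms unfolding square_summable_def by (rule summable_add)
  show "norm (x n * cnj (y n)) \<le> (cmod (x n))\<^sup>2 + (cmod (y n))\<^sup>2" for n
  proof -
    have "0 \<le> cmod (x n) * cmod (y n)"
      by simp
    then show ?thesis
      using sum_squares_bound[of "cmod (x n)" "cmod (y n)"]
      unfolding norm_mult complex_mod_cnj mult.assoc by linarith
  qed
qed

typedef ell2 = "{x. square_summable x}"
  morphisms coord Abs_ell2
  using square_summable_zero by blast

setup_lifting type_definition_ell2

lemma square_summable_coord: "square_summable (coord x)"
  using coord by simp

lift_definition scaleC :: "complex \<Rightarrow> ell2 \<Rightarrow> ell2"  (infixr \<open>*\<^sub>C\<close> 75)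
  is "\<lambda>c x n. c * x n"
  by (rule square_summable_scale)

definition cinner :: "ell2 \<Rightarrow> ell2 \<Rightarrow> complex" where
  "cinner x y = (\<Sum>n. coord x n * cnj (coord y n))"

text \<open>
  The norm, the metric and the topology are those of the complex inner product;
  its real part is the inner product of the underlying real Hilbert space.
\<close>

instantiation ell2 :: real_inner
begin

lift_definition zero_ell2 :: ell2 is "\<lambda>_. 0"
  by (rule square_summable_zero)

lift_definition plus_ell2 :: "ell2 \<Rightarrow> ell2 \<Rightarrow> ell2" is "\<lambda>x y n. x n + y n"
  by (rule square_summable_add)

lift_definition uminus_ell2 :: "ell2 \<Rightarrow> ell2" is "\<lambda>x n. - x n"
  by (simp add: square_summable_def)

lift_definition minus_ell2 :: "ell2 \<Rightarrow> ell2 \<Rightarrow> ell2" is "\<lambda>x y n. x n - y n"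
proof -
  fix x y :: "nat \<Rightarrow> complex"
  assume "square_summable x" "square_summable y"
  then show "square_summable (\<lambda>n. x n - y n)"
    using square_summable_add[of x "\<lambda>n. - 1 * y n"] square_summable_scale[of y "- 1"] by simp
qed

lift_definition scaleR_ell2 :: "real \<Rightarrow> ell2 \<Rightarrow> ell2" is "\<lambda>r x n. complex_of_real r * x n"
  by (rule square_summable_scale)

definition inner_ell2 :: "ell2 \<Rightarrow> ell2 \<Rightarrow> real" where
  "inner_ell2 x y = Re (cinner x y)"

definition norm_ell2 :: "ell2 \<Rightarrow> real" where
  "norm_ell2 x = sqrt (inner x x)"

definition dist_ell2 :: "ell2 \<Rightarrow> ell2 \<Rightarrow> real" where
  "dist_ell2 x y = norm (x - y)"

definition sgn_ell2 :: "ell2 \<Rightarrow> ell2" where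
  "sgn_ell2 x = inverse (norm x) *\<^sub>R x"

definition uniformity_ell2 :: "(ell2 \<times> ell2) filter" where
  "uniformity_ell2 = (INF e\<in>{0<..}. principal {(x, y). dist x y < e})"

definition open_ell2 :: "ell2 set \<Rightarrow> bool" where
  "open_ell2 U \<longleftrightarrow> (\<forall>x\<in>U. eventually (\<lambda>(x', y). x' = x \<longrightarrow> y \<in> U) uniformity)"

instance
proof
  fix x y z :: ell2 and r s :: real
  show "x + y + z = x + (y + z)" "x + y = y + x" "0 + x = x" "- x + x = 0" "x - y = x + - y"
    by (transfer; simp add: algebra_simps)+
  show "r *\<^sub>R (x + y) = r *\<^sub>R x + r *\<^sub>R y" "(r + s) *\<^sub>R x = r *\<^sub>R x + s *\<^sub>R x"
    "r *\<^sub>R s *\<^sub>R x = (r * s) *\<^sub>R x" "1 *\<^sub>R x = x"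
    by (transfer; simp add: algebra_simps)+
  have sm: "summable (\<lambda>n. coord x n * cnj (coord y n))" for x y
    by (intro summable_mult_cnj square_summable_coord)
  have sR: "summable (\<lambda>n. Re (coord x n * cnj (coord y n)))" for x y
    using sm by (rule summable_Re)
  have inner_eq: "inner x y = (\<Sum>n. Re (coord x n * cnj (coord y n)))" for x y :: ell2
    unfolding inner_ell2_def cinner_def by (rule Re_suminf[OF sm])
  have sq: "Re (coord x n * cnj (coord x n)) = (cmod (coord x n))\<^sup>2" for x n
    by (simp add: complex_mult_cnj cmod_power2)
  show "inner x y = inner y x"
    unfolding inner_eq by (rule suminf_cong) (simp add: mult.commute)
  show "inner (x + y) z = inner x z + inner y z"
    unfolding inner_eq suminf_add[OF sR sR]
    by (rule suminf_cong) (simp add: plus_ell2.rep_eq algebra_simps)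
  show "inner (r *\<^sub>R x) y = r * inner x y"
    unfolding inner_eq suminf_mult[OF sR, symmetric]
    by (rule suminf_cong) (simp add: scaleR_ell2.rep_eq algebra_simps)
  show "0 \<le> inner x x"
    unfolding inner_eq using sR by (rule suminf_nonneg) (simp add: sq)
  show "inner x x = 0 \<longleftrightarrow> x = 0"
  proof -
    have "inner x x = 0 \<longleftrightarrow> (\<forall>n. Re (coord x n * cnj (coord x n)) = 0)"
      unfolding inner_eq using sR by (rule suminf_eq_zero_iff) (simp add: sq)
    also have "\<dots> \<longleftrightarrow> (\<forall>n. coord x n = 0)"
      by (simp add: sq del: complex_cnj_mult times_complex.simps)
    also have "\<dots> \<longleftrightarrow> x = 0"
      by (simp add: coord_inject[symmetric] zero_ell2.rep_eq fun_eq_iff)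
    finally show ?thesis .
  qed
qed (rule norm_ell2_def dist_ell2_def sgn_ell2_def uniformity_ell2_def open_ell2_def)+

end

lift_definition basis_vec :: "nat \<Rightarrow> ell2" is "\<lambda>k n. of_bool (n = k)"
  proof -
  fix k :: nat
  show "square_summable (\<lambda>n. of_bool (n = k))"
    unfolding square_summable_def by (rule summable_finite[of "{k}"]) auto
qed


section \<open>The operators\<close>

text \<open>The matrix of the operator is tridiagonal; its columns are given in the lemma below.\<close>

lift_definition jacobi :: "real \<Rightarrow> ell2 \<Rightarrow> ell2" is
  "\<lambda>a x n. if n = 0 then complex_of_real a / 2 * x 1
           else if n = 1 then (complex_of_real a * x 0 + x 2) / 2
           else (x (n - 1) + x (n + 1)) / 2"
proof -
  fix a :: real and x :: "nat \<Rightarrow> complex"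
  let ?y = "\<lambda>n. if n = 0 then complex_of_real a / 2 * x 1
           else if n = 1 then (complex_of_real a * x 0 + x 2) / 2
           else (x (n - 1) + x (n + 1)) / 2"
  assume "square_summable x"
  then have "square_summable (\<lambda>n. x (n + 1))" "square_summable (\<lambda>n. x (n + 3))"
    by (simp_all only: square_summable_shift_iff)
  then have "square_summable (\<lambda>n. 1 / 2 * (x (n + 1) + x (n + 3)))"
    by (intro square_summable_scale square_summable_add)
  also have "(\<lambda>n. 1 / 2 * (x (n + 1) + x (n + 3))) = (\<lambda>n. ?y (n + 2))"
    by (simp add: fun_eq_iff numeral_eq_Suc)
  finally show "square_summable ?y"
    using square_summable_shift_iff[of ?y 2] by blast
qed

lemma jacobi_basis_vec:
  "jacobi a (basis_vec 0) = complex_of_real (a / 2) *\<^sub>C basis_vec 1"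
  "jacobi a (basis_vec 1) =
     (1 / 2) *\<^sub>C (complex_of_real a *\<^sub>C basis_vec 0 + basis_vec 2)"
  "n \<ge> 2 \<Longrightarrow>
     jacobi a (basis_vec n) = (1 / 2) *\<^sub>C (basis_vec (n - 1) + basis_vec (n + 1))"
  by (auto simp: coord_inject[symmetric] fun_eq_iff jacobi.rep_eq scaleC.rep_eq
      plus_ell2.rep_eq basis_vec.rep_eq of_bool_def)

text \<open>\<open>op_exp z A\<close> is the exponential of \<open>z A\<close>, for a bounded operator \<open>A\<close>.\<close>

definition op_exp :: "complex \<Rightarrow> (ell2 \<Rightarrow> ell2) \<Rightarrow> ell2 \<Rightarrow> ell2" where
  "op_exp z A x = (\<Sum>n. (z ^ n / fact n) *\<^sub>C (A ^^ n) x)"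

definition cadjoint :: "(ell2 \<Rightarrow> ell2) \<Rightarrow> ell2 \<Rightarrow> ell2" where
  "cadjoint A = (THE B. \<forall>x y. cinner (A x) y = cinner x (B y))"

text \<open>The filter \<open>F\<close> is \<open>at_top\<close> for \<open>W\<^sub>+\<close> and \<open>at_bot\<close> for \<open>W\<^sub>-\<close>.\<close>

definition wave_operator ::
  "real filter \<Rightarrow> (ell2 \<Rightarrow> ell2) \<Rightarrow> (ell2 \<Rightarrow> ell2) \<Rightarrow> ell2 \<Rightarrow> ell2" where
  "wave_operator F A B x =
     Lim F (\<lambda>t. op_exp (\<i> * complex_of_real t) A (op_exp (- \<i> * complex_of_real t) B x))"

definition scattering_operator :: "real \<Rightarrow> ell2 \<Rightarrow> ell2" where
  "scattering_operator a =
     cadjoint (wave_operator at_top (jacobi a) (jacobi 1)) \<circ>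
     wave_operator at_bot (jacobi a) (jacobi 1)"


section \<open>Diagonalization of the free operator and the scattering matrix\<close>

fun cheb_U :: "nat \<Rightarrow> real \<Rightarrow> real" where
  "cheb_U 0 l = 1"
| "cheb_U (Suc 0) l = 2 * l"
| "cheb_U (Suc (Suc n)) l = 2 * l * cheb_U (Suc n) l - cheb_U n l"

definition F1_basis :: "nat \<Rightarrow> real \<Rightarrow> complex" where
  "F1_basis n l = complex_of_real (sqrt (2 / pi) * root 4 (1 - l\<^sup>2) * cheb_U n l)"

text \<open>
  \<open>F1\<close> is the continuous linear extension of \<open>basis_vec n \<mapsto> F1_basis n\<close>: the image of
  \<open>f\<close> is the sum in \<open>L\<^sup>2(-1,1)\<close> of the series of the \<open>coord f n * F1_basis n\<close>. The value
  \<open>F1 f\<close> is a representative of this element of \<open>L\<^sup>2(-1,1)\<close>, so it is only meaningful up to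
  equality almost everywhere. (Membership in \<open>L\<^sup>2(-1,1)\<close> follows from the convergence, as the
  partial sums are bounded on \<open>(-1,1)\<close>.)
\<close>

definition F1 :: "ell2 \<Rightarrow> real \<Rightarrow> complex" where
  "F1 f = (SOME g. g \<in> borel_measurable (lebesgue_on {-1<..<1}) \<and>
     (\<lambda>N. \<integral>\<^sup>+ l. ennreal ((cmod (g l - (\<Sum>n<N. coord f n * F1_basis n l)))\<^sup>2)
            \<partial>lebesgue_on {-1<..<1}) \<longlonglongrightarrow> 0)"

text \<open>
  The continuous representative on \<open>(-1,1)\<close>; being \<open>extensional\<close> only fixes the irrelevant
  values outside this interval.
\<close>

definition scattering_matrix :: "real \<Rightarrow> real \<Rightarrow> complex" where
  "scattering_matrix a = (THE S. S \<in> extensional {-1<..<1} \<and> continuous_on {-1<..<1} S \<and>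
     (\<forall>f. AE l in lebesgue_on {-1<..<1}. F1 (scattering_operator a f) l = S l * F1 f l))"

end

theory Submission
  imports Defs
begin

text \<open>
  Write \<open>H = H\<^sub>1\<close>, \<open>S\<close> for the right shift, \<open>c = 1 - a\<^sup>2\<close> and
  \<open>\<zeta> = \<lambda> + \<i> sqrt (1 - \<lambda>\<^sup>2)\<close>. The banded operator
  \<open>K f = f + c S\<^sup>2 f + (a - 1) f\<^sub>0 e\<^sub>0\<close> satisfies \<open>H\<^sub>a K = K H\<close>, so everything reduces to the
  behaviour of \<open>S\<close> along the free evolution. The commutator of \<open>H\<close> and \<open>S\<close> is half the
  projection onto \<open>e\<^sub>0\<close>; hence \<open>Im \<langle>S(t) f, f\<rangle>\<close> with \<open>S(t) = exp (\<i> t H) S exp (- \<i> t H)\<close> is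
  monotone and bounded, and it dominates the increments of \<open>S(t) f\<close>. So \<open>S(t)\<close> has a strong limit
  \<open>D\<close> as \<open>t \<longlonglongrightarrow> \<infinity>\<close>. It commutes with \<open>H\<close> and inherits \<open>D\<^sup>2 - 2 H D + 1 = 0\<close> from \<open>S\<close>, so it is
  multiplication by \<open>\<zeta>\<close> or its conjugate at each point of the spectrum; monotonicity singles
  out \<open>\<zeta>\<close>. Consequently \<open>W\<^sub>+ (1 + c D\<^sup>2) = K = W\<^sub>- (1 + c D\<^sup>*\<^sup>2)\<close>. The range of \<open>1 + c D\<^sup>2\<close> is dense, which
  gives the existence of the wave operators, and the scattering operator is multiplication by
  the quotient of \<open>1 + c \<zeta>\<^sup>2\<close> and its conjugate.
\<close>

section \<open>Sequences and their inner product\<close>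

text \<open>At late times the free evolution carries every vector away from the origin in outgoing
  waves. On such waves a step to the right is multiplication by a phase, which is why the shift
  turns into a function of H. The operators H_a and H differ only in the coupling of the first two
  sites, so a comparison operator K needs only a boundary correction, and that correction dies out
  as the vector leaves. Three points shape the rest. The limit D comes without a formula: its
  quadratic equation leaves two candidates at each \<lambda>, and the choice between them needs the
  sign of a quadratic form. The operator 1 + c D^2 has no bounded inverse for a = sqrt 2, where its
  symbol vanishes at \<lambda> = 1 and \<lambda> = -1, so only density of its range can be expected,
  and the borderline c = -1 must be included in that argument. Negative times are reduced to
  positive ones by conjugating coordinates, which commutes with the real matrices of H and H_a and
  turns i into -i.\<close>

lemma ell2_eqI: "(\<And>n. coord x n = coord y n) \<Longrightarrow> x = y"
  by (simp add: coord_inject[symmetric] fun_eq_iff)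

lemmas coord_simps [simp] = zero_ell2.rep_eq plus_ell2.rep_eq minus_ell2.rep_eq
  uminus_ell2.rep_eq scaleR_ell2.rep_eq scaleC.rep_eq basis_vec.rep_eq

lemma coord_sum [simp]: "coord (sum f A) n = (\<Sum>i\<in>A. coord (f i) n)"
  by (induction A rule: infinite_finite_induct) auto

lemma summable_cinner: "summable (\<lambda>n. coord x n * cnj (coord y n))"
  by (intro summable_mult_cnj square_summable_coord)

lemma inner_eq_suminf: "inner x y = (\<Sum>n. Re (coord x n * cnj (coord y n)))" for x y :: ell2
  unfolding inner_ell2_def cinner_def by (rule Re_suminf[OF summable_cinner])

lemma norm_ell2_sums: "(\<lambda>n. (cmod (coord x n))\<^sup>2) sums (norm x)\<^sup>2"
proof -
  have "Re (coord x n * cnj (coord x n)) = (cmod (coord x n))\<^sup>2" for n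
    by (simp add: complex_mult_cnj cmod_power2)
  then show ?thesis
    using square_summable_coord[of x, unfolded square_summable_def]
    unfolding power2_norm_eq_inner inner_eq_suminf by (simp only: summable_sums)
qed

text \<open>Bounds on finite partial sums survive coordinatewise limits, which is how completeness
  is obtained.\<close>

lemma norm_ell2_le_iff: "norm x \<le> B \<longleftrightarrow> (\<forall>N. (\<Sum>n<N. (cmod (coord x n))\<^sup>2) \<le> B\<^sup>2)" if "B \<ge> 0"
proof -
  have "norm x \<le> B \<longleftrightarrow> (norm x)\<^sup>2 \<le> B\<^sup>2"
    using that by (simp add: abs_le_square_iff[symmetric])
  also have "\<dots> \<longleftrightarrow> (\<forall>N. (\<Sum>n<N. (cmod (coord x n))\<^sup>2) \<le> B\<^sup>2)"
    using norm_ell2_sums[of x] sum_le_suminf[of "\<lambda>n. (cmod (coord x n))\<^sup>2"]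
      suminf_le_const[of "\<lambda>n. (cmod (coord x n))\<^sup>2" "B\<^sup>2"]
    by (auto simp: sums_iff intro: order_trans)
  finally show ?thesis .
qed

lemma norm_coord_le: "cmod (coord x n) \<le> norm x"
proof -
  have "(cmod (coord x n))\<^sup>2 \<le> (\<Sum>k<Suc n. (cmod (coord x k))\<^sup>2)"
    by (simp add: sum_nonneg)
  also have "\<dots> \<le> (norm x)\<^sup>2"
    using norm_ell2_le_iff[of "norm x" x] norm_ge_zero by blast
  finally show ?thesis
    by (rule power2_le_imp_le) simp
qed

lemma bounded_linear_coord: "bounded_linear (\<lambda>x. coord x n)"
  by (rule bounded_linear_intro[of _ 1])
    (simp_all add: norm_coord_le scaleR_conv_of_real)

lemma norm_basis_vec [simp]: "norm (basis_vec k) = 1"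
proof -
  have "(\<lambda>n. (cmod (coord (basis_vec k) n))\<^sup>2) sums (\<Sum>n\<in>{k}. (cmod (coord (basis_vec k) n))\<^sup>2)"
    by (rule sums_finite) auto
  then have "(norm (basis_vec k))\<^sup>2 = 1"
    using norm_ell2_sums[of "basis_vec k"] sums_unique2 by fastforce
  then show ?thesis
    by (simp add: power2_eq_1_iff norm_ge_zero less_le_trans)
      (smt (verit) norm_ge_zero)
qed

lemma norm_sum_basis_vec:
  "(norm (\<Sum>n<N. \<alpha> n *\<^sub>C basis_vec n))\<^sup>2 = (\<Sum>n<N. (cmod (\<alpha> n))\<^sup>2)"
proof -
  let ?x = "\<Sum>n<N. \<alpha> n *\<^sub>C basis_vec n"
  have c: "coord ?x m = (if m < N then \<alpha> m else 0)" for m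
    by (simp add: of_bool_def if_distrib cong: if_cong)
  have "(\<lambda>n. (cmod (coord ?x n))\<^sup>2) sums (\<Sum>n<N. (cmod (coord ?x n))\<^sup>2)"
    by (rule sums_finite) (auto simp: c)
  then show ?thesis
    using norm_ell2_sums[of ?x] sums_unique2 unfolding c by fastforce
qed

definition trunc :: "nat \<Rightarrow> ell2 \<Rightarrow> ell2" where
  "trunc N x = (\<Sum>n<N. coord x n *\<^sub>C basis_vec n)"

lemma coord_trunc [simp]: "coord (trunc N x) m = (if m < N then coord x m else 0)"
  by (simp add: trunc_def of_bool_def if_distrib cong: if_cong)

lemma trunc_tendsto: "(\<lambda>N. trunc N x) \<longlonglongrightarrow> x"
proof -
  let ?s = "\<lambda>N. \<Sum>n<N. (cmod (coord x n))\<^sup>2"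
  have eq: "(norm (x - trunc N x))\<^sup>2 = (norm x)\<^sup>2 - ?s N" for N
  proof (rule sums_unique2)
    show "(\<lambda>n. (cmod (coord (x - trunc N x) n))\<^sup>2) sums (norm (x - trunc N x))\<^sup>2"
      by (rule norm_ell2_sums)
    have "(\<lambda>n. (cmod (coord (trunc N x) n))\<^sup>2) sums (\<Sum>n<N. (cmod (coord (trunc N x) n))\<^sup>2)"
      by (rule sums_finite) auto
    from sums_diff[OF norm_ell2_sums[of x] this]
    have "(\<lambda>n. (cmod (coord x n))\<^sup>2 - (cmod (coord (trunc N x) n))\<^sup>2) sums ((norm x)\<^sup>2 - ?s N)"
      by simp
    also have "(\<lambda>n. (cmod (coord x n))\<^sup>2 - (cmod (coord (trunc N x) n))\<^sup>2) =
        (\<lambda>n. (cmod (coord (x - trunc N x) n))\<^sup>2)"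
      by auto
    finally show "(\<lambda>n. (cmod (coord (x - trunc N x) n))\<^sup>2) sums ((norm x)\<^sup>2 - ?s N)" .
  qed
  have "?s \<longlonglongrightarrow> (norm x)\<^sup>2"
    using norm_ell2_sums[of x] by (simp add: sums_def)
  then have "(\<lambda>N. (norm x)\<^sup>2 - ?s N) \<longlonglongrightarrow> (norm x)\<^sup>2 - (norm x)\<^sup>2"
    by (intro tendsto_intros)
  then have "(\<lambda>N. sqrt ((norm (x - trunc N x))\<^sup>2)) \<longlonglongrightarrow> sqrt 0"
    unfolding eq by (intro tendsto_real_sqrt) simp
  then have "(\<lambda>N. norm (trunc N x - x)) \<longlonglongrightarrow> 0"
    by (simp add: norm_minus_commute)
  then show ?thesis
    using Lim_null tendsto_norm_zero_iff by blast
qed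

text \<open>The limit is found coordinate by coordinate. The Cauchy bound on a partial sum passes to
  the limit in the second index, uniformly in the number of terms; this gives both square
  summability of the limit and convergence in norm.\<close>

instance ell2 :: banach
proof
  fix X :: "nat \<Rightarrow> ell2"
  assume X: "Cauchy X"
  have "Cauchy (\<lambda>k. coord (X k) n)" for n
    using bounded_linear.Cauchy[OF bounded_linear_coord X] .
  then have "\<exists>y. (\<lambda>k. coord (X k) n) \<longlonglongrightarrow> y" for n
    by (simp add: Cauchy_convergent_iff convergent_def)
  then obtain y where y: "\<And>n. (\<lambda>k. coord (X k) n) \<longlonglongrightarrow> y n"
    by metis
  have fin: "\<exists>M. \<forall>m\<ge>M. \<forall>N. (\<Sum>n<N. (cmod (coord (X m) n - y n))\<^sup>2) \<le> e\<^sup>2" if "e > 0" for e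
  proof -
    obtain M where M: "\<And>m k. m \<ge> M \<Longrightarrow> k \<ge> M \<Longrightarrow> norm (X m - X k) < e"
      using X \<open>e > 0\<close> unfolding Cauchy_iff by blast
    have "(\<Sum>n<N. (cmod (coord (X m) n - y n))\<^sup>2) \<le> e\<^sup>2" if "m \<ge> M" for m N
    proof (rule LIMSEQ_le_const2)
      show "(\<lambda>k. \<Sum>n<N. (cmod (coord (X m) n - coord (X k) n))\<^sup>2)
          \<longlonglongrightarrow> (\<Sum>n<N. (cmod (coord (X m) n - y n))\<^sup>2)"
        by (intro tendsto_intros y)
      have "(\<Sum>n<N. (cmod (coord (X m - X k) n))\<^sup>2) \<le> e\<^sup>2" if "k \<ge> M" for k
        using norm_ell2_le_iff[of e "X m - X k"] \<open>e > 0\<close> M[OF \<open>m \<ge> M\<close> that] by auto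
      then show "\<exists>M. \<forall>k\<ge>M. (\<Sum>n<N. (cmod (coord (X m) n - coord (X k) n))\<^sup>2) \<le> e\<^sup>2"
        by auto
    qed
    then show ?thesis
      by blast
  qed
  obtain M where M: "\<And>N. (\<Sum>n<N. (cmod (coord (X M) n - y n))\<^sup>2) \<le> 1"
    using fin[of 1] by auto
  have "square_summable (\<lambda>n. coord (X M) n - y n)"
    unfolding square_summable_def
    by (rule bounded_imp_summable[of _ 1]) (use M[of "Suc _"] in \<open>auto simp: lessThan_Suc_atMost\<close>)
  then have "square_summable (\<lambda>n. coord (X M) n + (- 1) * (coord (X M) n - y n))"
    by (intro square_summable_add square_summable_scale square_summable_coord)
  then have "square_summable y"
    by simp
  then obtain x where x: "y = coord x"
    using coord_cases by (metis mem_Collect_eq)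
  have "X \<longlonglongrightarrow> x"
  proof (rule LIMSEQ_I)
    fix r :: real
    assume "r > 0"
    then obtain M where M: "\<And>m N. m \<ge> M \<Longrightarrow> (\<Sum>n<N. (cmod (coord (X m) n - y n))\<^sup>2) \<le> (r / 2)\<^sup>2"
      using fin[of "r / 2"] by auto
    have "norm (X m - x) \<le> r / 2" if "m \<ge> M" for m
      using norm_ell2_le_iff[of "r / 2" "X m - x"] \<open>r > 0\<close> M[OF that] by (simp add: x)
    then show "\<exists>M. \<forall>m\<ge>M. norm (X m - x) < r"
      using \<open>r > 0\<close> by (metis field_sum_of_halves less_add_same_cancel1 half_gt_zero order_le_less_trans)
  qed
  then show "convergent X"
    by (auto simp: convergent_def)
qed

section \<open>The complex structure over the real inner product\<close>

abbreviation iscale :: "ell2 \<Rightarrow> ell2" where "iscale \<equiv> scaleC \<i>"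

lemma scaleC_conv: "c *\<^sub>C x = Re c *\<^sub>R x + Im c *\<^sub>R iscale x"
  by (rule ell2_eqI) (simp add: complex_eq_iff)

lemma scaleC_simps [simp]: "(1::complex) *\<^sub>C x = x" "0 *\<^sub>C x = 0" "a *\<^sub>C b *\<^sub>C x = (a * b) *\<^sub>C x"
  by (rule ell2_eqI; simp)+

lemma scaleC_of_real [simp]: "complex_of_real r *\<^sub>C x = r *\<^sub>R x"
  by (rule ell2_eqI) simp

lemma norm_scaleC [simp]: "norm (c *\<^sub>C x) = cmod c * norm x"
proof -
  have "(norm (c *\<^sub>C x))\<^sup>2 = (cmod c * norm x)\<^sup>2"
    using norm_ell2_sums[of "c *\<^sub>C x"] sums_mult[OF norm_ell2_sums[of x], of "(cmod c)\<^sup>2"]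
    by (simp add: norm_mult power_mult_distrib sums_unique2)
  then show ?thesis
    by (simp add: power2_eq_iff_nonneg)
qed

lemma bounded_linear_scaleC: "bounded_linear (scaleC c)"
  by (rule bounded_linear_intro[of _ "cmod c"]; (rule ell2_eqI)?)
    (simp_all add: algebra_simps)

text \<open>Polarization. It serves for multiplication by \<open>\<i>\<close>, the evolution, the
  wave operators and complex conjugation.\<close>

lemma norm_eq_inner_eq:
  fixes f :: "'a::real_inner \<Rightarrow> 'b::real_inner"
  assumes "linear f" "\<And>x. norm (f x) = norm x"
  shows "inner (f x) (f y) = inner x y"
proof -
  have "norm (f x + f y) = norm (x + y)"
    using assms by (metis linear_add)
  then show ?thesis
    using assms(2) by (simp add: dot_norm)
qed

lemma inner_iscale [simp]: "inner (iscale x) (iscale y) = inner x y"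
  using norm_eq_inner_eq[of iscale] bounded_linear.linear[OF bounded_linear_scaleC] by simp

lemma inner_iscale_swap: "inner (iscale x) y = - inner x (iscale y)"
  using inner_iscale[of "iscale x" y]  scaleC_of_real[of "-1" x] by simp

lemma inner_iscale_self [simp]: "inner (iscale x) x = 0" "inner x (iscale x) = 0"
  using inner_iscale_swap[of x x] by (simp_all add: inner_commute)

text \<open>The real inner product together with \<open>iscale\<close> recovers the complex one, so
  adjoints can be handled over the reals.\<close>

lemma cinner_eq_inner: "cinner x y = Complex (inner x y) (inner x (iscale y))"
proof -
  have "cinner x (iscale y) = (\<Sum>n. (-\<i>) * (coord x n * cnj (coord y n)))"
    unfolding cinner_def by (simp add: algebra_simps)
  also have "\<dots> = - \<i> * cinner x y"
    unfolding cinner_def by (rule suminf_mult[OF summable_cinner])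
  finally show ?thesis
    by (simp add: inner_ell2_def complex_eq_iff)
qed

lemma cinner_basis_vec [simp]: "cinner x (basis_vec k) = coord x k"
proof -
  have "(\<lambda>n. coord x n * cnj (coord (basis_vec k) n)) sums
      (\<Sum>n\<in>{k}. coord x n * cnj (coord (basis_vec k) n))"
    by (rule sums_finite) auto
  then show ?thesis
    by (simp add: cinner_def sums_iff)
qed

lemma scaleC_linear_simps [simp]:
  "c *\<^sub>C (x + y) = c *\<^sub>C x + c *\<^sub>C y" "c *\<^sub>C (x - y) = c *\<^sub>C x - c *\<^sub>C y"
  "c *\<^sub>C (- x) = - (c *\<^sub>C x)" "c *\<^sub>C (r *\<^sub>R x) = r *\<^sub>R c *\<^sub>C x" "c *\<^sub>C 0 = 0"
  by (rule ell2_eqI; simp add: algebra_simps)+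

lemma bounded_linear_scaleC_left: "bounded_linear (\<lambda>c. c *\<^sub>C x)"
  by (rule bounded_linear_intro[of _ "norm x"]; (rule ell2_eqI)?)
    (simp_all add: algebra_simps scaleR_conv_of_real)

lemma inner_scaleC_basis_vec: "inner (c *\<^sub>C basis_vec k) y = Re (c * cnj (coord y k))"
proof -
  have "(\<lambda>n. coord (c *\<^sub>C basis_vec k) n * cnj (coord y n)) sums
      (\<Sum>n\<in>{k}. coord (c *\<^sub>C basis_vec k) n * cnj (coord y n))"
    by (rule sums_finite) auto
  then show ?thesis
    by (simp add: inner_ell2_def cinner_def sums_iff)
qed

section \<open>Shifts\<close>

lift_definition rshift :: "ell2 \<Rightarrow> ell2" is "\<lambda>x n. case n of 0 \<Rightarrow> 0 | Suc m \<Rightarrow> x m"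
proof -
  fix x :: "nat \<Rightarrow> complex"
  assume "square_summable x"
  then show "square_summable (\<lambda>n. case n of 0 \<Rightarrow> 0 | Suc m \<Rightarrow> x m)"
    using square_summable_shift_iff[of "\<lambda>n. case n of 0 \<Rightarrow> 0 | Suc m \<Rightarrow> x m" 1] by simp
qed

lift_definition lshift :: "ell2 \<Rightarrow> ell2" is "\<lambda>x n. x (Suc n)"
  using square_summable_shift_iff[of _ 1] by simp

lemma coord_rshift [simp]: "coord (rshift x) 0 = 0" "coord (rshift x) (Suc n) = coord x n"
  and coord_lshift [simp]: "coord (lshift x) n = coord x (Suc n)"
  by (simp_all add: rshift.rep_eq lshift.rep_eq)

lemma lshift_rshift [simp]: "lshift (rshift x) = x"
  by (rule ell2_eqI) simp

text \<open>This defect of the unilateral shift is the source of the commutator with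
  \<open>jacobi 1\<close> and of the boundary term in \<open>evol_coord_0_tendsto\<close>.\<close>

lemma rshift_lshift: "rshift (lshift x) = x - coord x 0 *\<^sub>C basis_vec 0"
  by (rule ell2_eqI, case_tac n) simp_all

lemma rshift_linear_simps [simp]:
  "rshift (x + y) = rshift x + rshift y" "rshift (x - y) = rshift x - rshift y"
  "rshift (- x) = - rshift x" "rshift (r *\<^sub>R x) = r *\<^sub>R rshift x" "rshift (c *\<^sub>C x) = c *\<^sub>C rshift x"
  by (rule ell2_eqI, case_tac n; simp)+

lemma lshift_linear_simps [simp]:
  "lshift (x + y) = lshift x + lshift y" "lshift (x - y) = lshift x - lshift y"
  "lshift (- x) = - lshift x" "lshift (r *\<^sub>R x) = r *\<^sub>R lshift x" "lshift (c *\<^sub>C x) = c *\<^sub>C lshift x"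
  by (rule ell2_eqI; simp)+

lemma rshift_basis_vec [simp]: "rshift (basis_vec n) = basis_vec (Suc n)"
  by (rule ell2_eqI, case_tac na) simp_all

lemma lshift_basis_vec [simp]: "lshift (basis_vec (Suc n)) = basis_vec n"
  "lshift (basis_vec 0) = 0"
  by (rule ell2_eqI; simp)+

lemma norm_rshift [simp]: "norm (rshift x) = norm x"
proof -
  have "(\<lambda>n. (cmod (coord (rshift x) (Suc n)))\<^sup>2) sums
      ((norm (rshift x))\<^sup>2 - (cmod (coord (rshift x) 0))\<^sup>2)"
    using norm_ell2_sums[of "rshift x"] by (subst sums_Suc_iff) simp
  then have "(norm x)\<^sup>2 = (norm (rshift x))\<^sup>2"
    using norm_ell2_sums[of x] by (simp add: sums_unique2)
  then show ?thesis
    by (simp add: power2_eq_iff_nonneg)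
qed

lemma bounded_linear_rshift: "bounded_linear rshift"
  by (rule bounded_linear_intro[of _ 1]) simp_all

lemma inner_rshift: "inner (rshift x) y = inner x (lshift y)"
proof -
  have "(\<lambda>n. coord (rshift x) n * cnj (coord y n)) sums cinner (rshift x) y"
    unfolding cinner_def by (rule summable_sums[OF summable_cinner])
  then have "(\<lambda>n. coord x n * cnj (coord (lshift y) n)) sums cinner (rshift x) y"
    using sums_Suc_iff[of "\<lambda>n. coord (rshift x) n * cnj (coord y n)"] by simp
  then have "cinner (rshift x) y = cinner x (lshift y)"
    by (simp add: cinner_def sums_iff)
  then show ?thesis
    by (simp add: inner_ell2_def)
qed

lemma inner_lshift: "inner (lshift x) y = inner x (rshift y)"
  by (metis inner_commute inner_rshift)

lemma norm_lshift_le: "norm (lshift x) \<le> norm x"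
proof -
  have "(norm (lshift x))\<^sup>2 = inner x (rshift (lshift x))"
    by (simp add: power2_norm_eq_inner inner_lshift)
  also have "\<dots> \<le> norm x * norm (lshift x)"
    using norm_cauchy_schwarz[of x "rshift (lshift x)"] by simp
  finally have "norm (lshift x) * norm (lshift x) \<le> norm x * norm (lshift x)"
    by (simp add: power2_eq_square)
  then show ?thesis
    by (cases "norm (lshift x) = 0") (auto dest: mult_right_le_imp_le)
qed

lemma bounded_linear_lshift: "bounded_linear lshift"
  by (rule bounded_linear_intro[of _ 1]) (simp_all add: norm_lshift_le)

lemma bounded_linear_coord_scaleC: "bounded_linear (\<lambda>x. coord x k *\<^sub>C v)"
  by (rule bounded_linear_compose[OF bounded_linear_scaleC_left bounded_linear_coord])

text \<open>Half of \<open>S + S\<^sup>*\<close>, plus a perturbation of rank at most two on the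
  span of \<open>e\<^sub>0\<close> and \<open>e\<^sub>1\<close>.\<close>

lemma jacobi_conv: "jacobi a x = (1 / 2) *\<^sub>R (rshift x + lshift x) +
    ((a - 1) / 2) *\<^sub>R (coord x 1 *\<^sub>C basis_vec 0 + coord x 0 *\<^sub>C basis_vec 1)"
proof (rule ell2_eqI)
  fix n
  consider "n = 0" | "n = 1" | m where "n = Suc (Suc m)"
    using not0_implies_Suc by (metis One_nat_def)
  then show "coord (jacobi a x) n = coord ((1 / 2) *\<^sub>R (rshift x + lshift x) +
    ((a - 1) / 2) *\<^sub>R (coord x 1 *\<^sub>C basis_vec 0 + coord x 0 *\<^sub>C basis_vec 1)) n"
    by cases (simp_all add: jacobi.rep_eq field_simps numeral_2_eq_2)
qed

lemma jacobi_1_conv: "jacobi 1 x = (1 / 2) *\<^sub>R (rshift x + lshift x)"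
  by (simp add: jacobi_conv)

lemma bounded_linear_jacobi: "bounded_linear (jacobi a)"
proof -
  have "bounded_linear (\<lambda>x. (1 / 2) *\<^sub>R (rshift x + lshift x) +
    ((a - 1) / 2) *\<^sub>R (coord x 1 *\<^sub>C basis_vec 0 + coord x 0 *\<^sub>C basis_vec 1))"
    by (intro bounded_linear_add bounded_linear_rshift bounded_linear_lshift
        bounded_linear_compose[OF bounded_linear_scaleR_right]
        bounded_linear_coord_scaleC)
  then show ?thesis
    by (simp add: jacobi_conv[abs_def])
qed

lemma jacobi_linear_simps [simp]:
  "jacobi a (x + y) = jacobi a x + jacobi a y" "jacobi a (x - y) = jacobi a x - jacobi a y"
  "jacobi a (- x) = - jacobi a x" "jacobi a (r *\<^sub>R x) = r *\<^sub>R jacobi a x" "jacobi a 0 = 0"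
  using linear_simps[OF bounded_linear_jacobi[of a]] by blast+

lemma jacobi_scaleC [simp]: "jacobi a (c *\<^sub>C x) = c *\<^sub>C jacobi a x"
  by (rule ell2_eqI) (simp add: jacobi.rep_eq algebra_simps)

lemma inner_jacobi: "inner (jacobi a x) y = inner x (jacobi a y)"
proof -
  have "inner (coord x j *\<^sub>C basis_vec k) y = inner x (coord y k *\<^sub>C basis_vec j)" for j k
    unfolding inner_scaleC_basis_vec inner_commute[of x]
    by (simp add: algebra_simps)
  then show ?thesis
    unfolding jacobi_conv inner_add_left inner_add_right inner_scaleR_left inner_scaleR_right
      inner_rshift inner_lshift
    by (simp add: algebra_simps inner_rshift inner_lshift)
qed

text \<open>As H is half of \<open>S + S\<^sup>*\<close>, the commutator is half of
  \<open>S\<^sup>* S - S S\<^sup>*\<close>, that is, half of the defect in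
  \<open>rshift_lshift\<close>.\<close>

lemma jacobi_rshift_commutator:
  "jacobi 1 (rshift x) - rshift (jacobi 1 x) = (1 / 2) *\<^sub>R coord x 0 *\<^sub>C basis_vec 0"
  by (simp add: jacobi_1_conv rshift_lshift algebra_simps)

text \<open>With the recursion that follows, this makes \<open>basis_vec 0\<close> a cyclic vector
  of \<open>jacobi 1\<close>.\<close>

lemma jacobi_basis_vec_0: "basis_vec 1 = 2 *\<^sub>R jacobi 1 (basis_vec 0)"
  by (simp add: jacobi_1_conv)

lemma jacobi_basis_vec_Suc:
  "basis_vec (Suc (Suc n)) = 2 *\<^sub>R jacobi 1 (basis_vec (Suc n)) - basis_vec n"
  by (simp add: jacobi_1_conv)


section \<open>The unitary groups\<close>

text \<open>The exponential function of the library needs a Banach algebra type.\<close>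

typedef endo = "UNIV :: (ell2 \<Rightarrow>\<^sub>L ell2) set" morphisms blin Endo ..

setup_lifting type_definition_endo

lemma norm_id_ell2: "norm (id_blinfun :: ell2 \<Rightarrow>\<^sub>L ell2) = 1"
proof (rule antisym)
  show "norm (id_blinfun :: ell2 \<Rightarrow>\<^sub>L ell2) \<le> 1"
    by (rule norm_blinfun_bound) auto
  show "1 \<le> norm (id_blinfun :: ell2 \<Rightarrow>\<^sub>L ell2)"
    using norm_blinfun[of id_blinfun "basis_vec 0"] by simp
qed

instantiation endo :: real_normed_algebra_1
begin

lift_definition zero_endo :: endo is 0 .
lift_definition one_endo :: endo is id_blinfun .
lift_definition plus_endo :: "endo \<Rightarrow> endo \<Rightarrow> endo" is "(+)" .
lift_definition minus_endo :: "endo \<Rightarrow> endo \<Rightarrow> endo" is "(-)" .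
lift_definition uminus_endo :: "endo \<Rightarrow> endo" is uminus .
lift_definition times_endo :: "endo \<Rightarrow> endo \<Rightarrow> endo" is blinfun_compose .
lift_definition scaleR_endo :: "real \<Rightarrow> endo \<Rightarrow> endo" is scaleR .
lift_definition norm_endo :: "endo \<Rightarrow> real" is norm .

definition dist_endo :: "endo \<Rightarrow> endo \<Rightarrow> real" where
  "dist_endo x y = norm (x - y)"

definition sgn_endo :: "endo \<Rightarrow> endo" where
  "sgn_endo x = inverse (norm x) *\<^sub>R x"

definition uniformity_endo :: "(endo \<times> endo) filter" where
  "uniformity_endo = (INF e\<in>{0<..}. principal {(x, y). dist x y < e})"

definition open_endo :: "endo set \<Rightarrow> bool" where
  "open_endo U \<longleftrightarrow> (\<forall>x\<in>U. eventually (\<lambda>(x', y). x' = x \<longrightarrow> y \<in> U) uniformity)"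

instance
proof
  fix x y z :: endo and r s :: real
  show "x + y + z = x + (y + z)" "x + y = y + x" "0 + x = x" "- x + x = 0" "x - y = x + - y"
    by (transfer; simp)+
  show "r *\<^sub>R (x + y) = r *\<^sub>R x + r *\<^sub>R y" "(r + s) *\<^sub>R x = r *\<^sub>R x + s *\<^sub>R x"
    "r *\<^sub>R s *\<^sub>R x = (r * s) *\<^sub>R x" "1 *\<^sub>R x = x"
    by (transfer; simp add: algebra_simps)+
  show "x * y * z = x * (y * z)" "1 * x = x" "x * 1 = x"
    by (transfer; rule blinfun_eqI; simp)+
  show "(x + y) * z = x * z + y * z" "x * (y + z) = x * y + x * z"
    "r *\<^sub>R x * y = r *\<^sub>R (x * y)" "x * r *\<^sub>R y = r *\<^sub>R (x * y)"
    by (transfer; rule blinfun_eqI; simp add: blinfun.bilinear_simps)+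
  show "(0 :: endo) \<noteq> 1"
    by transfer (metis norm_id_ell2 norm_zero zero_neq_one)
  show "norm (1 :: endo) = 1"
    by transfer (rule norm_id_ell2)
  show "norm (x * y) \<le> norm x * norm y"
    by transfer (rule norm_blinfun_compose)
  show "norm (r *\<^sub>R x) = \<bar>r\<bar> * norm x" "norm x = 0 \<longleftrightarrow> x = 0" "norm (x + y) \<le> norm x + norm y"
    by (transfer; simp add: norm_triangle_ineq)+
qed (rule dist_endo_def sgn_endo_def uniformity_endo_def open_endo_def)+

end

instance endo :: banach
proof
  fix X :: "nat \<Rightarrow> endo"
  have blin_dist: "dist (blin A) (blin B) = dist A B" for A B
    by (simp add: dist_norm norm_endo.rep_eq minus_endo.rep_eq)
  assume "Cauchy X"
  then have "Cauchy (\<lambda>n. blin (X n))"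
    unfolding Cauchy_def blin_dist .
  then obtain L where "(\<lambda>n. blin (X n)) \<longlonglongrightarrow> blin (Endo L)"
    by (auto simp: Cauchy_convergent_iff convergent_def Endo_inverse)
  then show "convergent X"
    unfolding convergent_def lim_sequentially blin_dist by blast
qed

abbreviation app :: "endo \<Rightarrow> ell2 \<Rightarrow> ell2" where
  "app A \<equiv> blinfun_apply (blin A)"

lemma bounded_linear_blin: "bounded_linear (\<lambda>A. app A x)"
proof (rule bounded_linear_intro[of _ "norm x"])
  show "norm (app A x) \<le> norm A * norm x" for A
    by (simp add: norm_endo.rep_eq norm_blinfun)
qed (simp_all add: plus_endo.rep_eq scaleR_endo.rep_eq blinfun.bilinear_simps)

lemma blin_mult [simp]: "app (A * B) x = app A (app B x)"
  by (simp add: times_endo.rep_eq)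

lemma blin_power: "app (A ^ n) x = (app A ^^ n) x"
  by (induction n) (simp_all add: one_endo.rep_eq)

lemma blin_exp_sums: "(\<lambda>n. (1 / fact n) *\<^sub>R (app A ^^ n) x) sums app (exp A) x"
proof -
  have "(\<lambda>n. A ^ n /\<^sub>R fact n) sums exp A"
    by (rule exp_converges)
  from bounded_linear.sums[OF bounded_linear_blin this, of x] show ?thesis
    by (simp add: scaleR_endo.rep_eq blinfun.bilinear_simps blin_power inverse_eq_divide)
qed

text \<open>The intertwining holds term by term in the exponential series. Stated for real-linear
  \<open>T\<close>, it covers complex conjugation, which carries a generator into its
  negative.\<close>

lemma blin_exp_intertwine:
  assumes "bounded_linear T" "\<And>x. T (app A x) = app B (T x)"
  shows "T (app (exp A) x) = app (exp B) (T x)"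
proof (rule sums_unique2)
  have *: "T ((app A ^^ n) x) = (app B ^^ n) (T x)" for n
    by (induction n) (simp_all add: assms(2))
  show "(\<lambda>n. T ((1 / fact n) *\<^sub>R (app A ^^ n) x)) sums T (app (exp A) x)"
    by (rule bounded_linear.sums[OF assms(1) blin_exp_sums])
  show "(\<lambda>n. T ((1 / fact n) *\<^sub>R (app A ^^ n) x)) sums app (exp B) (T x)"
    using blin_exp_sums[of B "T x"] by (simp only: linear_simps(5)[OF assms(1)] *)
qed

text \<open>The imaginary unit sits inside the generator because \<open>endo\<close> has only real
  scalars; time then enters through \<open>*\<^sub>R\<close>.\<close>

definition gen :: "real \<Rightarrow> endo" where
  "gen a = Endo (Blinfun (\<lambda>x. iscale (jacobi a x)))"

lemma blin_gen [simp]: "app (gen a) x = iscale (jacobi a x)"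
  unfolding gen_def
  by (simp add: Endo_inverse bounded_linear_Blinfun_apply
      bounded_linear_compose[OF bounded_linear_scaleC bounded_linear_jacobi])

definition evol :: "real \<Rightarrow> real \<Rightarrow> ell2 \<Rightarrow> ell2" where
  "evol a t = app (exp (t *\<^sub>R gen a))"

lemma op_exp_evol: "op_exp (\<i> * complex_of_real t) (jacobi a) x = evol a t x"
proof -
  have *: "(app (t *\<^sub>R gen a) ^^ n) x = (\<i> * complex_of_real t) ^ n *\<^sub>C (jacobi a ^^ n) x" for n
    by (induction n) (simp_all add: scaleR_endo.rep_eq blinfun.bilinear_simps
        mult_ac flip: scaleC_of_real)
  have "(1 / fact n) *\<^sub>R (app (t *\<^sub>R gen a) ^^ n) x =
      ((\<i> * complex_of_real t) ^ n / fact n) *\<^sub>C (jacobi a ^^ n) x" for n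
    unfolding * by (simp add: mult_ac flip: scaleC_of_real)
  then show ?thesis
    using blin_exp_sums[of "t *\<^sub>R gen a" x] by (simp add: op_exp_def evol_def sums_iff)
qed

lemma op_exp_evol_minus: "op_exp (- \<i> * complex_of_real t) (jacobi a) x = evol a (- t) x"
  using op_exp_evol[of "- t" a x] by simp

lemma bounded_linear_evol: "bounded_linear (evol a t)"
  unfolding evol_def by (rule blinfun.bounded_linear_right)

lemma evol_linear_simps [simp]:
  "evol a t (x + y) = evol a t x + evol a t y" "evol a t (x - y) = evol a t x - evol a t y"
  "evol a t (- x) = - evol a t x" "evol a t (r *\<^sub>R x) = r *\<^sub>R evol a t x" "evol a t 0 = 0"
  using linear_simps[OF bounded_linear_evol[of a t]] by blast+

lemma evol_0 [simp]: "evol a 0 x = x"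
  by (simp add: evol_def one_endo.rep_eq)

lemma evol_add: "evol a (s + t) x = evol a s (evol a t x)"
proof -
  have "exp (s *\<^sub>R gen a + t *\<^sub>R gen a) = exp (s *\<^sub>R gen a) * exp (t *\<^sub>R gen a)"
    by (rule exp_add_commuting) simp
  then show ?thesis
    by (simp add: evol_def scaleR_add_left)
qed

lemma evol_inverse [simp]: "evol a t (evol a (- t) x) = x" "evol a (- t) (evol a t x) = x"
  by (simp_all flip: evol_add)

lemma evol_intertwine:
  assumes "bounded_linear T" "\<And>x. T (jacobi a x) = jacobi b (T x)" "\<And>x. T (iscale x) = iscale (T x)"
  shows "T (evol a t x) = evol b t (T x)"
  unfolding evol_def
  by (rule blin_exp_intertwine[OF assms(1)])
    (simp add: scaleR_endo.rep_eq blinfun.bilinear_simps linear_simps(5)[OF assms(1)] assms(2,3))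

lemma evol_scaleC [simp]: "evol a t (c *\<^sub>C x) = c *\<^sub>C evol a t x"
  by (rule evol_intertwine[symmetric]) (simp_all add: bounded_linear_scaleC mult.commute)

lemma evol_jacobi: "evol a t (jacobi a x) = jacobi a (evol a t x)"
  by (rule evol_intertwine[symmetric]) (simp_all add: bounded_linear_jacobi)

lemma evol_has_vector_derivative:
  "((\<lambda>t. evol a t x) has_vector_derivative iscale (jacobi a (evol a t x))) (at t)"
  using bounded_linear.has_vector_derivative[OF bounded_linear_blin[of x]
      exp_scaleR_has_vector_derivative_left[of "gen a" t]]
  by (simp add: evol_def)

lemma evol_minus_has_vector_derivative:
  "((\<lambda>t. evol a (- t) x) has_vector_derivative - iscale (jacobi a (evol a (- t) x))) (at t)"
proof -
  have "((\<lambda>t. evol a t x) \<circ> uminus has_vector_derivative (- 1) *\<^sub>R iscale (jacobi a (evol a (- t) x))) (at t)"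
    by (rule vector_diff_chain_at[OF _ evol_has_vector_derivative])
      (auto intro!: derivative_eq_intros simp: has_vector_derivative_def)
  then show ?thesis
    by (simp add: o_def)
qed

text \<open>As \<open>jacobi a\<close> is symmetric, its product with \<open>\<i>\<close> is skew
  for the real inner product, and the squared norm has derivative zero.\<close>

lemma norm_evol [simp]: "norm (evol a t x) = norm x"
proof -
  have "((\<lambda>t. inner (evol a t x) (evol a t x)) has_real_derivative 0) (at t)" for t
  proof -
    let ?y = "evol a t x"
    have "((\<lambda>t. inner (evol a t x) (evol a t x)) has_vector_derivative
        inner ?y (iscale (jacobi a ?y)) + inner (iscale (jacobi a ?y)) ?y) (at t)"
      by (rule bounded_bilinear.has_vector_derivative[OF bounded_bilinear_inner
            evol_has_vector_derivative evol_has_vector_derivative])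
    moreover have "inner (iscale (jacobi a ?y)) ?y = - inner ?y (iscale (jacobi a ?y))"
      by (metis inner_iscale_swap inner_jacobi jacobi_scaleC)
    ultimately show ?thesis
      by (simp add: has_real_derivative_iff_has_vector_derivative)
  qed
  then have "inner (evol a t x) (evol a t x) = inner (evol a 0 x) (evol a 0 x)"
    using DERIV_isconst_all[of "\<lambda>t. inner (evol a t x) (evol a t x)"] by blast
  then show ?thesis
    by (simp add: norm_eq_sqrt_inner)
qed

lemma inner_evol: "inner (evol a t x) y = inner x (evol a (- t) y)"
  using norm_eq_inner_eq[OF bounded_linear.linear[OF bounded_linear_evol], of a t x "evol a (- t) y"]
  by simp

text \<open>Sampling at integer times supplies the candidate limit; comparison with the single time
  \<open>t0\<close> extends convergence to all real times. It is used for both the shift and the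
  wave operators.\<close>

lemma Cauchy_at_top_convergent:
  fixes f :: "real \<Rightarrow> 'a::complete_space"
  assumes "\<And>e. e > 0 \<Longrightarrow> \<exists>t0. \<forall>t\<ge>t0. dist (f t) (f t0) < e"
  shows "\<exists>L. (f \<longlongrightarrow> L) at_top"
proof -
  have "Cauchy (\<lambda>n. f (real n))"
  proof (rule metric_CauchyI)
    fix e :: real
    assume "e > 0"
    then obtain t0 where t0: "\<And>t. t \<ge> t0 \<Longrightarrow> dist (f t) (f t0) < e / 2"
      using assms[of "e / 2"] by auto
    have "dist (f (real m)) (f (real n)) < e" if "m \<ge> nat \<lceil>t0\<rceil>" "n \<ge> nat \<lceil>t0\<rceil>" for m n
    proof -
      have "real m \<ge> t0" "real n \<ge> t0"
        using that by linarith+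
      then show ?thesis
        using t0 dist_triangle_half_l by (metis dist_commute)
    qed
    then show "\<exists>M. \<forall>m\<ge>M. \<forall>n\<ge>M. dist (f (real m)) (f (real n)) < e"
      by blast
  qed
  then obtain L where L: "(\<lambda>n. f (real n)) \<longlonglongrightarrow> L"
    by (auto simp: Cauchy_convergent_iff convergent_def)
  have "(f \<longlongrightarrow> L) at_top"
  proof (rule tendstoI)
    fix e :: real
    assume "e > 0"
    then obtain t0 where t0: "\<And>t. t \<ge> t0 \<Longrightarrow> dist (f t) (f t0) < e / 2"
      using assms[of "e / 2"] by auto
    have "dist L (f t0) \<le> e / 2"
    proof (rule LIMSEQ_le_const2[OF tendsto_dist[OF L tendsto_const]])
      have "dist (f (real n)) (f t0) \<le> e / 2" if "n \<ge> nat \<lceil>t0\<rceil>" for n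
        using t0[of "real n"] that by linarith
      then show "\<exists>N. \<forall>n\<ge>N. dist (f (real n)) (f t0) \<le> e / 2"
        by blast
    qed
    then have "dist (f t) L < e" if "t \<ge> t0" for t
      using t0[OF that] dist_triangle2[of "f t" L "f t0"] by linarith
    then show "eventually (\<lambda>t. dist (f t) L < e) at_top"
      by (auto simp: eventually_at_top_linorder)
  qed
  then show ?thesis ..
qed

section \<open>The asymptotic shift\<close>

definition shift_at :: "real \<Rightarrow> ell2 \<Rightarrow> ell2" where
  "shift_at t x = evol 1 t (rshift (evol 1 (- t) x))"

text \<open>The imaginary part of \<open>cinner (shift_at t x) x\<close>: in the real inner product
  it is extracted by pairing with \<open>iscale x\<close>.\<close>

definition phase :: "ell2 \<Rightarrow> real \<Rightarrow> real" where
  "phase x t = inner (rshift (evol 1 (- t) x)) (iscale (evol 1 (- t) x))"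

lemma inner_shift_at: "inner (shift_at t x) y = inner (rshift (evol 1 (- t) x)) (evol 1 (- t) y)"
  by (simp add: shift_at_def inner_evol)

lemma phase_shift_at: "phase x t = inner (shift_at t x) (iscale x)"
  by (simp add: inner_shift_at phase_def)

lemma norm_shift_at [simp]: "norm (shift_at t x) = norm x"
  by (simp add: shift_at_def)

lemma abs_phase_le: "\<bar>phase x t\<bar> \<le> (norm x)\<^sup>2"
  using Cauchy_Schwarz_ineq2[of "shift_at t x" "iscale x"]
  by (simp add: phase_shift_at power2_eq_square)

text \<open>Only the commutator of H with the shift contributes. It has rank one, so what remains is
  a product of two coordinates at 0.\<close>

lemma rshift_evol_derivative:
  "((\<lambda>t. inner (rshift (evol 1 (- t) x)) (evol 1 (- t) y)) has_real_derivative
     - Im (coord (evol 1 (- t) x) 0 * cnj (coord (evol 1 (- t) y) 0)) / 2) (at t)"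
proof -
  let ?g = "evol 1 (- t) x" and ?k = "evol 1 (- t) y"
  have "((\<lambda>t. inner (rshift (evol 1 (- t) x)) (evol 1 (- t) y)) has_vector_derivative
      inner (rshift ?g) (- iscale (jacobi 1 ?k)) + inner (rshift (- iscale (jacobi 1 ?g))) ?k) (at t)"
    by (rule bounded_bilinear.has_vector_derivative[OF bounded_bilinear_inner
          bounded_linear.has_vector_derivative[OF bounded_linear_rshift
            evol_minus_has_vector_derivative] evol_minus_has_vector_derivative])
  moreover have "inner (rshift ?g) (- iscale (jacobi 1 ?k)) = inner (iscale (jacobi 1 (rshift ?g))) ?k"
    by (metis inner_iscale_swap inner_jacobi inner_minus_right jacobi_scaleC minus_minus)
  then have "inner (rshift ?g) (- iscale (jacobi 1 ?k)) + inner (rshift (- iscale (jacobi 1 ?g))) ?k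
      = inner (iscale (jacobi 1 (rshift ?g) - rshift (jacobi 1 ?g))) ?k"
    by (simp add: inner_diff_left)
  moreover have "\<dots> = - Im (coord ?g 0 * cnj (coord ?k 0)) / 2"
    unfolding jacobi_rshift_commutator by (simp add: inner_scaleC_basis_vec)
  ultimately show ?thesis
    unfolding has_real_derivative_iff_has_vector_derivative by metis
qed

text \<open>Positivity of the commutator \<open>\<i>[H, S]\<close> makes this derivative nonnegative.\<close>

lemma phase_derivative:
  "(phase x has_real_derivative (cmod (coord (evol 1 (- t) x) 0))\<^sup>2 / 2) (at t)"
proof -
  have *: "phase x = (\<lambda>t. inner (rshift (evol 1 (- t) x)) (evol 1 (- t) (iscale x)))"
    by (simp add: phase_def fun_eq_iff)
  have "- Im (u * cnj (\<i> * u)) / 2 = (cmod u)\<^sup>2 / 2" for u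
    unfolding cmod_power2 by (simp add: power2_eq_square)
  then show ?thesis
    using rshift_evol_derivative[of x "iscale x" t]
    unfolding * evol_scaleC scaleC.rep_eq by (simp only:)
qed

lemma phase_mono: "s \<le> t \<Longrightarrow> phase x s \<le> phase x t"
  by (rule DERIV_nonneg_imp_nondecreasing[of s t], assumption, intro exI conjI, rule phase_derivative) simp

text \<open>The derivative of the pairing of \<open>shift_at t x\<close> with a fixed vector is at
  most the geometric mean of the derivatives of the two phases. The fixed vector is taken to be the
  increment \<open>h\<close> itself, and the arithmetic mean replaces the geometric one.\<close>

lemma norm_shift_at_diff:
  assumes "s \<le> t"
  shows "(norm (shift_at t x - shift_at s x))\<^sup>2 \<le> 2 * (phase x t - phase x s)"
proof -
  define h where "h = shift_at t x - shift_at s x"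
  \<comment> \<open>The phase of \<open>h\<close> varies by at most twice
    \<open>(norm h)\<^sup>2\<close>; with weight 1/4 it uses up only half of the
    \<open>(norm h)\<^sup>2\<close> on the other side.\<close>
  let ?\<phi> = "\<lambda>\<tau>. phase x \<tau> + phase h \<tau> / 4 - inner (shift_at \<tau> x) h"
  have "\<exists>y. (?\<phi> has_real_derivative y) (at \<tau>) \<and> 0 \<le> y" for \<tau>
  proof -
    define u v where "u = coord (evol 1 (- \<tau>) x) 0" and "v = coord (evol 1 (- \<tau>) h) 0"
    have deriv: "(?\<phi> has_real_derivative (cmod u)\<^sup>2 / 2 + (cmod v)\<^sup>2 / 2 / 4 - - Im (u * cnj v) / 2) (at \<tau>)"
      unfolding inner_shift_at u_def v_def
      by (intro DERIV_diff DERIV_add DERIV_cdivide phase_derivative rshift_evol_derivative)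
    have "\<bar>Im (u * cnj v)\<bar> \<le> cmod u * cmod v"
      using abs_Im_le_cmod[of "u * cnj v"] by (simp add: norm_mult)
    moreover have "0 \<le> (cmod u - cmod v / 2)\<^sup>2" and "(cmod u - cmod v / 2)\<^sup>2 = (cmod u)\<^sup>2 - cmod u * cmod v + (cmod v)\<^sup>2 / 4"
      by (rule zero_le_power2) (simp add: power2_eq_square algebra_simps)
    ultimately have "0 \<le> (cmod u)\<^sup>2 / 2 + (cmod v)\<^sup>2 / 2 / 4 - - Im (u * cnj v) / 2"
      by linarith
    with deriv show ?thesis
      by blast
  qed
  then have "?\<phi> s \<le> ?\<phi> t"
    by (rule DERIV_nonneg_imp_nondecreasing[OF assms])
  moreover have "(norm h)\<^sup>2 = inner (shift_at t x) h - inner (shift_at s x) h"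
    by (simp add: power2_norm_eq_inner h_def inner_diff_left)
  ultimately show ?thesis
    using abs_phase_le[of h t] abs_phase_le[of h s] by (fold h_def) argo
qed

lemma phase_convergent: "\<exists>M. (phase x \<longlongrightarrow> M) at_top \<and> (\<forall>t. phase x t \<le> M)"
proof -
  have "phase x t \<le> (norm x)\<^sup>2" for t
    using abs_phase_le[of x t] by simp
  then have bdd: "bdd_above (range (phase x))"
    by (rule bdd_aboveI2)
  define M where "M = (SUP t. phase x t)"
  have le: "phase x t \<le> M" for t
    unfolding M_def by (rule cSUP_upper[OF _ bdd]) simp
  have "(phase x \<longlongrightarrow> M) at_top"
  proof (rule increasing_tendsto)
    show "\<forall>\<^sub>F t in at_top. phase x t \<le> M"
      by (simp add: le)
    fix y
    assume "y < M"
    then obtain t0 where t0: "y < phase x t0"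
      unfolding M_def less_cSUP_iff[OF UNIV_not_empty bdd] by blast
    have "y < phase x t" if "t \<ge> t0" for t
      using t0 phase_mono[OF that, of x] by simp
    then show "\<forall>\<^sub>F t in at_top. y < phase x t"
      unfolding eventually_at_top_linorder by blast
  qed
  with le show ?thesis
    by blast
qed

section \<open>The strong limit and the relations that survive it\<close>

definition ashift :: "ell2 \<Rightarrow> ell2" where
  "ashift x = Lim at_top (\<lambda>t. shift_at t x)"

lemma shift_at_tendsto: "((\<lambda>t. shift_at t x) \<longlongrightarrow> ashift x) at_top"
proof -
  obtain M where M: "(phase x \<longlongrightarrow> M) at_top" "\<And>t. phase x t \<le> M"
    using phase_convergent by blast
  have "\<exists>L. ((\<lambda>t. shift_at t x) \<longlongrightarrow> L) at_top"
  proof (rule Cauchy_at_top_convergent)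
    fix e :: real
    assume "e > 0"
    then have "\<forall>\<^sub>F t in at_top. M - e\<^sup>2 / 4 < phase x t"
      using M(1) by (intro order_tendstoD) auto
    then obtain t0 where t0: "M - e\<^sup>2 / 4 < phase x t0"
      by (auto simp: eventually_at_top_linorder)
    have "dist (shift_at t x) (shift_at t0 x) < e" if "t \<ge> t0" for t
    proof (rule power2_less_imp_less)
      have "(dist (shift_at t x) (shift_at t0 x))\<^sup>2 \<le> 2 * (phase x t - phase x t0)"
        unfolding dist_norm by (rule norm_shift_at_diff[OF that])
      also have "2 * (phase x t - phase x t0) < e\<^sup>2"
      proof -
        have "0 < e\<^sup>2"
          using \<open>e > 0\<close> by simp
        then show ?thesis
          using M(2)[of t] t0 by argo
      qed
      finally show "(dist (shift_at t x) (shift_at t0 x))\<^sup>2 < e\<^sup>2" .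
    qed (use \<open>e > 0\<close> in auto)
    then show "\<exists>t0. \<forall>t\<ge>t0. dist (shift_at t x) (shift_at t0 x) < e"
      by blast
  qed
  then show ?thesis
    unfolding ashift_def using tendsto_Lim[OF trivial_limit_at_top_linorder] by blast
qed

lemma ashift_unique: "((\<lambda>t. shift_at t x) \<longlongrightarrow> y) at_top \<Longrightarrow> ashift x = y"
  by (rule tendsto_unique[OF trivial_limit_at_top_linorder shift_at_tendsto])

lemma shift_at_linear_simps [simp]:
  "shift_at t (x + y) = shift_at t x + shift_at t y" "shift_at t (x - y) = shift_at t x - shift_at t y"
  "shift_at t (c *\<^sub>C x) = c *\<^sub>C shift_at t x" "shift_at t (r *\<^sub>R x) = r *\<^sub>R shift_at t x"
  by (simp_all add: shift_at_def)

lemma norm_ashift [simp]: "norm (ashift x) = norm x"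
proof (rule tendsto_unique[OF trivial_limit_at_top_linorder])
  show "((\<lambda>t. norm (shift_at t x)) \<longlongrightarrow> norm (ashift x)) at_top"
    by (rule tendsto_norm[OF shift_at_tendsto])
qed simp

lemma ashift_linear_simps [simp]:
  "ashift (x + y) = ashift x + ashift y" "ashift (x - y) = ashift x - ashift y"
  "ashift (c *\<^sub>C x) = c *\<^sub>C ashift x" "ashift (r *\<^sub>R x) = r *\<^sub>R ashift x"
  using ashift_unique[of "x + y" "ashift x + ashift y"] ashift_unique[of "x - y" "ashift x - ashift y"]
    ashift_unique[of "c *\<^sub>C x" "c *\<^sub>C ashift x"] ashift_unique[of "r *\<^sub>R x" "r *\<^sub>R ashift x"]
    tendsto_add[OF shift_at_tendsto[of x] shift_at_tendsto[of y]]
    tendsto_diff[OF shift_at_tendsto[of x] shift_at_tendsto[of y]]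
    bounded_linear.tendsto[OF bounded_linear_scaleC shift_at_tendsto[of x]]
    bounded_linear.tendsto[OF bounded_linear_scaleR_right shift_at_tendsto[of x]]
  by simp_all

lemma bounded_linear_ashift: "bounded_linear ashift"
  by (rule bounded_linear_intro[of _ 1]) simp_all

text \<open>The evolution can be pulled through \<open>shift_at\<close> at the price of a shift in
  time, which the limit does not see.\<close>

lemma evol_ashift: "evol 1 \<tau> (ashift x) = ashift (evol 1 \<tau> x)"
proof (rule ashift_unique[symmetric])
  have "filterlim (\<lambda>t::real. - \<tau> + t) at_top at_top"
    by (rule filterlim_tendsto_add_at_top[OF tendsto_const filterlim_ident])
  then have "((\<lambda>t. shift_at (- \<tau> + t) x) \<longlongrightarrow> ashift x) at_top"
    by (rule filterlim_compose[OF shift_at_tendsto])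
  then have "((\<lambda>t. evol 1 \<tau> (shift_at (- \<tau> + t) x)) \<longlongrightarrow> evol 1 \<tau> (ashift x)) at_top"
    by (rule bounded_linear.tendsto[OF bounded_linear_evol])
  moreover have "evol 1 \<tau> (shift_at (- \<tau> + t) x) = shift_at t (evol 1 \<tau> x)" for t
    unfolding shift_at_def by (simp flip: evol_add)
  ultimately show "((\<lambda>t. shift_at t (evol 1 \<tau> x)) \<longlongrightarrow> evol 1 \<tau> (ashift x)) at_top"
    by simp
qed

text \<open>Both sides of the intertwining of the groups are differentiated at time 0; this is the
  converse of \<open>evol_intertwine\<close>.\<close>

lemma intertwine_generators:
  assumes "bounded_linear T" "\<And>\<tau> x. T (evol a \<tau> x) = evol b \<tau> (T x)" "\<And>x. T (iscale x) = iscale (T x)"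
  shows "T (jacobi a x) = jacobi b (T x)"
proof -
  have "((\<lambda>t. T (evol a t x)) has_vector_derivative T (iscale (jacobi a (evol a 0 x)))) (at 0)"
    by (rule bounded_linear.has_vector_derivative[OF assms(1) evol_has_vector_derivative])
  moreover have "((\<lambda>t. T (evol a t x)) has_vector_derivative iscale (jacobi b (evol b 0 (T x)))) (at 0)"
    unfolding assms(2) by (rule evol_has_vector_derivative)
  ultimately have "iscale (T (jacobi a x)) = iscale (jacobi b (T x))"
    by (simp add: vector_derivative_unique_at assms(3))
  then have "(- \<i>) *\<^sub>C iscale (T (jacobi a x)) = (- \<i>) *\<^sub>C iscale (jacobi b (T x))"
    by (rule arg_cong)
  then show ?thesis
    by simp
qed

lemma ashift_jacobi: "ashift (jacobi 1 x) = jacobi 1 (ashift x)"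
  by (rule intertwine_generators) (simp_all add: bounded_linear_ashift evol_ashift)

text \<open>The maps \<open>shift_at t\<close> are isometries, so the argument may move with t. This
  is what lets products of strongly convergent shifts converge.\<close>

lemma shift_at_tendsto_ashift:
  assumes "(f \<longlongrightarrow> x) at_top"
  shows "((\<lambda>t. shift_at t (f t)) \<longlongrightarrow> ashift x) at_top"
proof -
  have "((\<lambda>t. norm (f t - x)) \<longlongrightarrow> 0) at_top"
    using assms by (simp add: LIM_zero_iff tendsto_norm_zero_iff)
  then have "((\<lambda>t. norm (shift_at t (f t - x))) \<longlongrightarrow> 0) at_top"
    by (simp only: norm_shift_at)
  then have "((\<lambda>t. shift_at t (f t - x)) \<longlongrightarrow> 0) at_top"
    by (rule tendsto_norm_zero_cancel)
  from tendsto_add[OF this shift_at_tendsto[of x]] show ?thesis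
    by simp
qed

text \<open>The relation \<open>S\<^sup>* S = 1\<close> with \<open>S\<^sup>*\<close> written as
  \<open>2 H - S\<close>. In this form only H and the shift occur, and H commutes with the
  evolution, so the relation passes to the limit.\<close>

lemma rshift_quadratic: "rshift (rshift x) = 2 *\<^sub>R jacobi 1 (rshift x) - x"
  by (simp add: jacobi_1_conv)

lemma ashift_quadratic: "ashift (ashift x) = 2 *\<^sub>R jacobi 1 (ashift x) - x"
proof -
  have "((\<lambda>t. shift_at t (shift_at t x)) \<longlongrightarrow> ashift (ashift x)) at_top"
    by (rule shift_at_tendsto_ashift[OF shift_at_tendsto])
  moreover have "shift_at t (shift_at t x) = 2 *\<^sub>R jacobi 1 (shift_at t x) - x" for t
    by (simp add: shift_at_def rshift_quadratic evol_jacobi)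
  moreover have "((\<lambda>t. 2 *\<^sub>R jacobi 1 (shift_at t x) - x) \<longlongrightarrow> 2 *\<^sub>R jacobi 1 (ashift x) - x) at_top"
    by (intro tendsto_intros bounded_linear.tendsto[OF bounded_linear_jacobi] shift_at_tendsto)
  ultimately show ?thesis
    using tendsto_unique trivial_limit_at_top_linorder by fastforce
qed

text \<open>The second root of the quadratic equation: the roots have sum \<open>2 H\<close> and
  product 1.\<close>

definition ashift_inv :: "ell2 \<Rightarrow> ell2" where
  "ashift_inv x = 2 *\<^sub>R jacobi 1 x - ashift x"

lemma ashift_inverse [simp]: "ashift (ashift_inv x) = x" "ashift_inv (ashift x) = x"
  by (simp_all add: ashift_inv_def ashift_quadratic ashift_jacobi)

lemma ashift_inv_linear_simps [simp]:
  "ashift_inv (x + y) = ashift_inv x + ashift_inv y" "ashift_inv (x - y) = ashift_inv x - ashift_inv y"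
  "ashift_inv (c *\<^sub>C x) = c *\<^sub>C ashift_inv x" "ashift_inv (r *\<^sub>R x) = r *\<^sub>R ashift_inv x"
  by (simp_all add: ashift_inv_def scaleR_diff_right algebra_simps)

lemma norm_ashift_inv [simp]: "norm (ashift_inv x) = norm x"
  by (metis ashift_inverse(1) norm_ashift)

lemma bounded_linear_ashift_inv: "bounded_linear ashift_inv"
  by (rule bounded_linear_intro[of _ 1]) simp_all

text \<open>With the factors in the other order the quadratic relation of the shift has a defect:
  \<open>1 - 2 S H + S\<^sup>2\<close> is the projection onto \<open>e\<^sub>0\<close>. The limit D
  commutes with H, so for D this expression is zero and the defect disappears along the
  evolution.\<close>

lemma evol_coord_0_tendsto: "((\<lambda>t. coord (evol 1 (- t) x) 0) \<longlongrightarrow> 0) at_top"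
proof -
  have eq: "coord (evol 1 (- t) x) 0 *\<^sub>C evol 1 t (basis_vec 0) =
      x - 2 *\<^sub>R shift_at t (jacobi 1 x) + shift_at t (shift_at t x)" for t
  proof -
    define g where "g = evol 1 (- t) x"
    have "coord g 0 *\<^sub>C basis_vec 0 = g - 2 *\<^sub>R rshift (jacobi 1 g) + rshift (rshift g)"
      by (simp add: jacobi_1_conv rshift_lshift algebra_simps)
    then have "evol 1 t (coord g 0 *\<^sub>C basis_vec 0) =
        evol 1 t (g - 2 *\<^sub>R rshift (jacobi 1 g) + rshift (rshift g))"
      by simp
    then show ?thesis
      by (simp add: g_def shift_at_def evol_jacobi)
  qed
  have "((\<lambda>t. x - 2 *\<^sub>R shift_at t (jacobi 1 x) + shift_at t (shift_at t x)) \<longlongrightarrow>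
      x - 2 *\<^sub>R ashift (jacobi 1 x) + ashift (ashift x)) at_top"
    by (intro tendsto_intros shift_at_tendsto shift_at_tendsto_ashift)
  then have "((\<lambda>t. norm (coord (evol 1 (- t) x) 0 *\<^sub>C evol 1 t (basis_vec 0))) \<longlongrightarrow> norm (0::ell2)) at_top"
    unfolding eq by (intro tendsto_norm) (simp add: ashift_quadratic ashift_jacobi)
  then show ?thesis
    by (simp add: tendsto_norm_zero_iff)
qed

section \<open>Density of the range of the Jost operator\<close>

lemma inner_basis_vec: "inner (basis_vec m) (basis_vec n) = of_bool (m = n)"
  using inner_scaleC_basis_vec[of 1 m "basis_vec n"] by simp

text \<open>
  The powers \<open>E\<^sup>k e\<^sub>0\<close> differ by \<open>E'\<close>-images of an orthonormal sequence from an orthonormal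
  sequence, so that the Cesaro means of \<open>(r E\<^sup>2)\<^sup>k e\<^sub>0\<close> vanish even if \<open>\<bar>r\<bar> = 1\<close>.
\<close>

lemma basis_vec_0_in_closure_range:
  fixes E E' :: "ell2 \<Rightarrow> ell2" and r :: real
  assumes E: "linear E" and E': "linear E'" and norm: "\<And>x. norm (E' x) = norm x"
    and inv: "\<And>x. E (E' x) = x" and sum: "\<And>x. E x + E' x = 2 *\<^sub>R jacobi 1 x"
    and r: "\<bar>r\<bar> \<le> 1"
  shows "basis_vec 0 \<in> closure (range (\<lambda>x. x - r *\<^sub>R E (E x)))"
proof -
  define T where "T x = r *\<^sub>R E (E x)" for x
  let ?R = "range (\<lambda>x. x - T x)"
  have T: "linear T"
    unfolding T_def using linear_compose_scale_right linear_compose[OF E E] by (auto simp: o_def)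
  then have sub: "subspace ?R"
    by (intro linear_subspace_image linear_compose_sub linear_ident) auto
  \<comment> \<open>The operator \<open>1 - T\<^sup>k\<close> factors through
    \<open>1 - T\<close>.\<close>
  have telescope: "x - (T ^^ k) x \<in> ?R" for x k
  proof (induction k)
    case 0
    have "0 - T 0 \<in> ?R"
      by (rule rangeI)
    then show ?case
      using linear_0[OF T] by simp
  next
    case (Suc k)
    then obtain y where y: "x - (T ^^ k) x = y - T y"
      by auto
    have "T x - T ((T ^^ k) x) = T y - T (T y)"
      using arg_cong[OF y, of T] by (simp add: linear_diff[OF T])
    then have "x - (T ^^ Suc k) x = (x + T y) - T (x + T y)"
      by (simp add: linear_add[OF T] algebra_simps)
    then show ?case
      by blast
  qed
  \<comment> \<open>The basis obeys the three-term recursion with characteristic roots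
    \<open>E\<close> and \<open>E'\<close>; applying \<open>E\<close> cancels the \<open>E'\<close>
    of the previous step.\<close>
  have E_pow: "(E ^^ Suc k) (basis_vec 0) = basis_vec (Suc k) - E' (basis_vec k)" for k
  proof (induction k)
    case 0
    show ?case
      using sum[of "basis_vec 0"] jacobi_basis_vec_0 by (simp add: eq_diff_eq)
  next
    case (Suc k)
    have "(E ^^ Suc (Suc k)) (basis_vec 0) = E (basis_vec (Suc k) - E' (basis_vec k))"
      using Suc by simp
    also have "\<dots> = E (basis_vec (Suc k)) - basis_vec k"
      by (simp add: linear_diff[OF E] inv)
    also have "\<dots> = basis_vec (Suc (Suc k)) - E' (basis_vec (Suc k))"
      using sum[of "basis_vec (Suc k)"] jacobi_basis_vec_Suc[of k] by (simp add: algebra_simps)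
    finally show ?case .
  qed
  have T_pow: "(T ^^ k) x = r ^ k *\<^sub>R (E ^^ (2 * k)) x" for k x
    by (induction k) (simp_all add: T_def linear_scale[OF E])
  have T_pow_Suc: "(T ^^ Suc k) (basis_vec 0) =
      r ^ Suc k *\<^sub>R basis_vec (2 * k + 2) - E' (r ^ Suc k *\<^sub>R basis_vec (2 * k + 1))" for k
    unfolding T_pow using E_pow[of "Suc (2 * k)"]
    by (simp add: linear_scale[OF E'] linear_diff[OF E'] scaleR_diff_right del: funpow.simps)
  \<comment> \<open>Since \<open>T\<close> involves the square of \<open>E\<close>, the indices
    advance by two: the N vectors are orthogonal of norm at most 1, and their sum grows only like
    \<open>sqrt N\<close>.\<close>
  have orth: "norm (\<Sum>k<N. r ^ Suc k *\<^sub>R basis_vec (2 * k + j)) \<le> sqrt (real N)" for N j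
  proof -
    have "(norm (\<Sum>k<N. r ^ Suc k *\<^sub>R basis_vec (2 * k + j)))\<^sup>2 =
        (\<Sum>k<N. (norm (r ^ Suc k *\<^sub>R basis_vec (2 * k + j)))\<^sup>2)"
      by (rule norm_sum_Pythagorean)
        (auto simp: pairwise_def orthogonal_def inner_basis_vec)
    also have "\<dots> \<le> (\<Sum>k<N. 1)"
    proof (rule sum_mono)
      fix k
      have "\<bar>r\<bar> ^ Suc k \<le> 1"
        using r by (intro power_le_one) auto
      then show "(norm (r ^ Suc k *\<^sub>R basis_vec (2 * k + j)))\<^sup>2 \<le> 1"
        by (intro power_le_one) (simp_all add: power_abs abs_mult)
    qed
    finally show ?thesis
      by (simp add: real_le_rsqrt)
  qed
  define C where "C N = (1 / real N) *\<^sub>R (\<Sum>k<N. basis_vec 0 - (T ^^ Suc k) (basis_vec 0))" for N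
  have C_mem: "C N \<in> ?R" for N
    unfolding C_def by (intro subspace_scale[OF sub] subspace_sum[OF sub] telescope)
  \<comment> \<open>The error of the mean is 1/N times two sums of size at most
    \<open>sqrt N\<close>, one of them under the isometry \<open>E'\<close>.\<close>
  have "norm (C N - basis_vec 0) \<le> 2 / sqrt (real N)" if "N > 0" for N
  proof -
    have "C N - basis_vec 0 = - ((1 / real N) *\<^sub>R (\<Sum>k<N. (T ^^ Suc k) (basis_vec 0)))"
      using that unfolding C_def sum_subtractf
      by (simp add: scaleR_diff_right sum_constant_scaleR del: funpow.simps)
    also have "(\<Sum>k<N. (T ^^ Suc k) (basis_vec 0)) =
        (\<Sum>k<N. r ^ Suc k *\<^sub>R basis_vec (2 * k + 2)) - E' (\<Sum>k<N. r ^ Suc k *\<^sub>R basis_vec (2 * k + 1))"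
      unfolding T_pow_Suc by (simp only: sum_subtractf linear_sum[OF E'])
    also have "norm (- ((1 / real N) *\<^sub>R \<dots>)) \<le> (1 / real N) * (sqrt (real N) + sqrt (real N))"
    proof -
      have "norm (x - E' y) \<le> sqrt (real N) + sqrt (real N)"
        if "norm x \<le> sqrt (real N)" "norm y \<le> sqrt (real N)" for x y
        using norm_triangle_ineq4[of x "E' y"] that by (simp add: norm)
      from mult_left_mono[OF this[OF orth[where j = 2] orth[where j = 1]], of "1 / real N"] show ?thesis
        by simp
    qed
    also have "\<dots> = 2 / sqrt (real N)"
      using that by (simp add: field_simps real_sqrt_divide flip: real_sqrt_mult)
    finally show ?thesis .
  qed
  moreover have "(\<lambda>N. 2 / sqrt (real N)) \<longlonglongrightarrow> 0"
    by (intro tendsto_divide_0[OF tendsto_const] filterlim_at_top_imp_at_infinity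
        filterlim_compose[OF sqrt_at_top] filterlim_real_sequentially)
  ultimately have "(\<lambda>N. C N - basis_vec 0) \<longlonglongrightarrow> 0"
    by (intro Lim_null_comparison[of "\<lambda>N. C N - basis_vec 0" "\<lambda>N. 2 / sqrt (real N)"]
        eventually_sequentiallyI[of 1]) auto
  then have "C \<longlonglongrightarrow> basis_vec 0"
    by (simp add: LIM_zero_iff)
  then have "basis_vec 0 \<in> closure ?R"
    unfolding closure_sequential using C_mem by blast
  then show ?thesis
    by (simp add: T_def)
qed

text \<open>Its symbol in the spectral representation will be the Jost function
  \<open>1 + c \<zeta>\<^sup>2\<close>; see \<open>F1_jost\<close>.\<close>

definition jost :: "real \<Rightarrow> ell2 \<Rightarrow> ell2" where
  "jost c x = x + c *\<^sub>R ashift (ashift x)"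

lemma jost_linear_simps [simp]:
  "jost c (x + y) = jost c x + jost c y" "jost c (x - y) = jost c x - jost c y"
  "jost c (r *\<^sub>R x) = r *\<^sub>R jost c x" "jost c (z *\<^sub>C x) = z *\<^sub>C jost c x"
  by (simp_all add: jost_def algebra_simps)

lemma jost_jacobi: "jost c (jacobi 1 x) = jacobi 1 (jost c x)"
  by (simp add: jost_def ashift_jacobi)

lemma ashift_add_inv:
  "ashift x + ashift_inv x = 2 *\<^sub>R jacobi 1 x" "ashift_inv x + ashift x = 2 *\<^sub>R jacobi 1 x"
  by (simp_all add: ashift_inv_def)

text \<open>For large c the factor \<open>c D\<^sup>2\<close> is split off: the remaining
  \<open>1 + c\<^sup>-\<^sup>1 D\<^sup>-\<^sup>2\<close> has a small coefficient, and D and its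
  inverse exchange roles.\<close>

lemma basis_vec_0_in_closure_range_jost: "basis_vec 0 \<in> closure (range (jost c))"
proof (cases "\<bar>c\<bar> \<le> 1")
  case True
  have "basis_vec 0 \<in> closure (range (\<lambda>x. x - (- c) *\<^sub>R ashift (ashift x)))"
    by (rule basis_vec_0_in_closure_range[where E' = ashift_inv,
          OF bounded_linear.linear[OF bounded_linear_ashift]
          bounded_linear.linear[OF bounded_linear_ashift_inv] norm_ashift_inv ashift_inverse(1)
          ashift_add_inv(1)]) (simp add: True)
  also have "(\<lambda>x. x - (- c) *\<^sub>R ashift (ashift x)) = jost c"
    by (simp add: jost_def fun_eq_iff)
  finally show ?thesis .
next
  case False
  have "basis_vec 0 \<in> closure (range (\<lambda>x. x - (- (1 / c)) *\<^sub>R ashift_inv (ashift_inv x)))"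
    by (rule basis_vec_0_in_closure_range[where E' = ashift,
          OF bounded_linear.linear[OF bounded_linear_ashift_inv]
          bounded_linear.linear[OF bounded_linear_ashift] norm_ashift ashift_inverse(2)
          ashift_add_inv(2)]) (use False in simp)
  moreover have "x - (- (1 / c)) *\<^sub>R ashift_inv (ashift_inv x) =
      jost c ((1 / c) *\<^sub>R ashift_inv (ashift_inv x))" for x
    using False by (auto simp: jost_def)
  then have "range (\<lambda>x. x - (- (1 / c)) *\<^sub>R ashift_inv (ashift_inv x)) \<subseteq> range (jost c)"
    by (intro image_subsetI) (metis rangeI)
  ultimately show ?thesis
    using closure_mono by blast
qed

text \<open>The closure of the range is a complex subspace invariant under H, because
  \<open>jost\<close> commutes with H; it contains the cyclic vector
  \<open>basis_vec 0\<close>.\<close>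

lemma jost_range_dense: "closure (range (jost c)) = UNIV"
proof -
  let ?R = "closure (range (jost c))"
  have mem: "x \<in> ?R" if "(\<lambda>n. jost c (f n)) \<longlonglongrightarrow> x" for f x
    unfolding closure_sequential using that by (intro exI[of _ "\<lambda>n. jost c (f n)"]) auto
  have ex: "\<exists>f. (\<lambda>n. jost c (f n)) \<longlonglongrightarrow> x" if x: "x \<in> ?R" for x
  proof -
    obtain s where s: "\<forall>n. s n \<in> range (jost c)" "s \<longlonglongrightarrow> x"
      using x unfolding closure_sequential by (elim exE conjE)
    from s(1) have "\<forall>n. \<exists>y. s n = jost c y"
      by blast
    then obtain f where "\<And>n. s n = jost c (f n)"
      by metis
    then have "s = (\<lambda>n. jost c (f n))"
      by (rule ext)
    with s(2) show ?thesis
      by (intro exI[of _ f]) (simp only:)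
  qed
  have map: "T x \<in> ?R" if x: "x \<in> ?R" and T: "bounded_linear T" "\<And>y. T (jost c y) = jost c (T y)" for T x
  proof -
    obtain f where "(\<lambda>n. jost c (f n)) \<longlonglongrightarrow> x"
      using ex[OF x] by (elim exE)
    from bounded_linear.tendsto[OF T(1) this] have "(\<lambda>n. jost c (T (f n))) \<longlonglongrightarrow> T x"
      by (simp only: T(2))
    then show ?thesis
      by (rule mem)
  qed
  have add: "x + y \<in> ?R" if x: "x \<in> ?R" and y: "y \<in> ?R" for x y
  proof -
    obtain f where f: "(\<lambda>n. jost c (f n)) \<longlonglongrightarrow> x"
      using ex[OF x] by (elim exE)
    obtain g where g: "(\<lambda>n. jost c (g n)) \<longlonglongrightarrow> y"
      using ex[OF y] by (elim exE)
    from tendsto_add[OF f g] have "(\<lambda>n. jost c (f n + g n)) \<longlonglongrightarrow> x + y"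
      by simp
    then show ?thesis
      by (rule mem)
  qed
  have scale: "z *\<^sub>C x \<in> ?R" if "x \<in> ?R" for z x
    using map[OF that bounded_linear_scaleC] by simp
  have jacobi: "jacobi 1 x \<in> ?R" if "x \<in> ?R" for x
    using map[OF that bounded_linear_jacobi] by (simp add: jost_jacobi)
  have "basis_vec n \<in> ?R \<and> basis_vec (Suc n) \<in> ?R" for n
  proof (induction n)
    case 0
    show ?case
      using scale[OF jacobi[OF basis_vec_0_in_closure_range_jost], of "complex_of_real 2"]
        basis_vec_0_in_closure_range_jost jacobi_basis_vec_0
      unfolding scaleC_of_real by simp
  next
    case (Suc n)
    then have "complex_of_real 2 *\<^sub>C jacobi 1 (basis_vec (Suc n)) + complex_of_real (- 1) *\<^sub>C basis_vec n \<in> ?R"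
      using add[OF scale[OF jacobi] scale] by blast
    also have "complex_of_real 2 *\<^sub>C jacobi 1 (basis_vec (Suc n)) + complex_of_real (- 1) *\<^sub>C basis_vec n
        = basis_vec (Suc (Suc n))"
      unfolding jacobi_basis_vec_Suc scaleC_of_real by simp
    finally show ?case
      using Suc by simp
  qed
  then have trunc_mem: "trunc N x \<in> ?R" for N x
    unfolding trunc_def
  proof (induction N)
    case 0
    show ?case
      using scale[OF basis_vec_0_in_closure_range_jost, of 0] by simp
  next
    case (Suc N)
    then show ?case
      by (simp add: add scale)
  qed
  have "x \<in> closure ?R" for x
    by (rule closure_sequential[THEN iffD2], rule exI[of _ "\<lambda>N. trunc N x"])
      (simp only: trunc_mem trunc_tendsto simp_thms)
  then show ?thesis
    by auto
qed

section \<open>The wave operators\<close>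

definition dress :: "real \<Rightarrow> ell2 \<Rightarrow> ell2" where
  "dress a x = x + (1 - a\<^sup>2) *\<^sub>R rshift (rshift x) + (a - 1) *\<^sub>R coord x 0 *\<^sub>C basis_vec 0"

lemma bounded_linear_dress: "bounded_linear (dress a)"
  unfolding dress_def[abs_def]
  by (intro bounded_linear_add bounded_linear_ident bounded_linear_compose[OF bounded_linear_scaleR_right]
      bounded_linear_compose[OF bounded_linear_rshift bounded_linear_rshift] bounded_linear_coord_scaleC)

lemma dress_scaleC: "dress a (c *\<^sub>C x) = c *\<^sub>C dress a x"
  by (rule ell2_eqI) (simp add: dress_def algebra_simps)

text \<open>The boundary affects only the first coordinates. Coordinate 1 fixes the constant: the
  coefficient of \<open>coord x 0\<close> requires \<open>a\<^sup>2 + c = 1\<close>.\<close>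

lemma dress_jacobi: "dress a (jacobi 1 x) = jacobi a (dress a x)"
proof (rule ell2_eqI)
  fix n
  consider "n = 0" | "n = 1" | "n = 2" | m where "n = Suc (Suc (Suc m))"
    by (metis One_nat_def numeral_2_eq_2 not0_implies_Suc)
  then show "coord (dress a (jacobi 1 x)) n = coord (jacobi a (dress a x)) n"
    by cases (simp_all add: dress_def jacobi.rep_eq field_simps numeral_2_eq_2 power2_eq_square)
qed

definition wave_at :: "real \<Rightarrow> real \<Rightarrow> ell2 \<Rightarrow> ell2" where
  "wave_at a t x = evol a t (evol 1 (- t) x)"

lemma wave_at_linear_simps [simp]:
  "wave_at a t (x + y) = wave_at a t x + wave_at a t y"
  "wave_at a t (x - y) = wave_at a t x - wave_at a t y"
  "wave_at a t (r *\<^sub>R x) = r *\<^sub>R wave_at a t x" "wave_at a t (c *\<^sub>C x) = c *\<^sub>C wave_at a t x"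
  "norm (wave_at a t x) = norm x"
  by (simp_all add: wave_at_def)

text \<open>By intertwining, \<open>dress a x\<close> equals \<open>evol a t\<close> applied to
  \<open>dress a (evol 1 (- t) x)\<close>. The error is therefore the difference of
  \<open>jost\<close> and \<open>dress\<close> along the free evolution: a multiple of
  \<open>D\<^sup>2 - S\<^sup>2\<close>, which tends to zero there, and a boundary term handled by
  \<open>evol_coord_0_tendsto\<close>.\<close>

lemma wave_at_jost_tendsto:
  "((\<lambda>t. wave_at a t (jost (1 - a\<^sup>2) x)) \<longlongrightarrow> dress a x) at_top"
proof -
  let ?c = "1 - a\<^sup>2"
  let ?u = "\<lambda>t. evol 1 (- t) x"
  have "norm (wave_at a t (jost ?c x) - dress a x) \<le>
      \<bar>?c\<bar> * norm (ashift (ashift x) - shift_at t (shift_at t x)) + \<bar>a - 1\<bar> * cmod (coord (?u t) 0)" for t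
  proof -
    have jost: "evol 1 (- t) (jost ?c x) = jost ?c (?u t)"
      by (simp add: jost_def evol_ashift)
    have "dress a (?u t) = evol a (- t) (dress a x)"
      by (rule evol_intertwine) (simp_all add: bounded_linear_dress dress_jacobi dress_scaleC)
    then have "dress a x = evol a t (dress a (?u t))"
      by simp
    then have "norm (wave_at a t (jost ?c x) - dress a x) = norm (jost ?c (?u t) - dress a (?u t))"
      by (simp add: wave_at_def jost flip: evol_linear_simps(2))
    also have "jost ?c (?u t) - dress a (?u t) = ?c *\<^sub>R (ashift (ashift (?u t)) - rshift (rshift (?u t)))
        - (a - 1) *\<^sub>R coord (?u t) 0 *\<^sub>C basis_vec 0"
      by (simp add: jost_def dress_def algebra_simps)
    also have "norm \<dots> \<le> \<bar>?c\<bar> * norm (ashift (ashift (?u t)) - rshift (rshift (?u t)))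
        + \<bar>a - 1\<bar> * cmod (coord (?u t) 0)"
      by (rule order_trans[OF norm_triangle_ineq4]) simp
    also have "norm (ashift (ashift (?u t)) - rshift (rshift (?u t))) =
        norm (evol 1 t (ashift (ashift (?u t)) - rshift (rshift (?u t))))"
      by (rule norm_evol[symmetric])
    also have "evol 1 t (ashift (ashift (?u t)) - rshift (rshift (?u t))) =
        ashift (ashift x) - shift_at t (shift_at t x)"
      by (simp add: evol_ashift shift_at_def)
    finally show ?thesis .
  qed
  note bound = this
  have "((\<lambda>t. \<bar>?c\<bar> * norm (ashift (ashift x) - shift_at t (shift_at t x))
      + \<bar>a - 1\<bar> * cmod (coord (?u t) 0)) \<longlongrightarrow>
      \<bar>?c\<bar> * norm (ashift (ashift x) - ashift (ashift x)) + \<bar>a - 1\<bar> * cmod 0) at_top"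
    by (intro tendsto_add tendsto_mult tendsto_const tendsto_norm tendsto_diff
        evol_coord_0_tendsto shift_at_tendsto_ashift[OF shift_at_tendsto])
  then have "((\<lambda>t. \<bar>?c\<bar> * norm (ashift (ashift x) - shift_at t (shift_at t x))
      + \<bar>a - 1\<bar> * cmod (coord (?u t) 0)) \<longlongrightarrow> 0) at_top"
    by simp
  from Lim_null_comparison[OF always_eventually[OF allI[OF bound]] this]
  have "((\<lambda>t. wave_at a t (jost ?c x) - dress a x) \<longlongrightarrow> 0) at_top" .
  then show ?thesis
    by (simp add: LIM_zero_iff)
qed

definition wave :: "real \<Rightarrow> ell2 \<Rightarrow> ell2" where
  "wave a x = Lim at_top (\<lambda>t. wave_at a t x)"

text \<open>Convergence is known on the dense range of \<open>jost\<close>, and the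
  \<open>wave_at a t\<close> are isometries, so it extends to every vector.\<close>

lemma wave_at_tendsto: "((\<lambda>t. wave_at a t x) \<longlongrightarrow> wave a x) at_top"
proof -
  have "\<exists>L. ((\<lambda>t. wave_at a t x) \<longlongrightarrow> L) at_top"
  proof (rule Cauchy_at_top_convergent)
    fix e :: real
    assume "e > 0"
    have "x \<in> closure (range (jost (1 - a\<^sup>2)))" "0 < e / 4"
      using \<open>e > 0\<close> by (simp_all add: jost_range_dense)
    then obtain g where g: "dist (jost (1 - a\<^sup>2) g) x < e / 4"
      unfolding closure_approachable by blast
    have "\<forall>\<^sub>F t in at_top. dist (wave_at a t (jost (1 - a\<^sup>2) g)) (dress a g) < e / 4"
      using wave_at_jost_tendsto \<open>e > 0\<close> by (intro tendstoD) auto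
    then obtain t0 where t0: "\<And>t. t \<ge> t0 \<Longrightarrow> dist (wave_at a t (jost (1 - a\<^sup>2) g)) (dress a g) < e / 4"
      by (auto simp: eventually_at_top_linorder)
    have near: "dist (wave_at a t x) (dress a g) < e / 2" if "t \<ge> t0" for t
    proof -
      have "dist (wave_at a t x) (wave_at a t (jost (1 - a\<^sup>2) g)) = dist x (jost (1 - a\<^sup>2) g)"
        by (simp only: dist_norm wave_at_linear_simps flip: wave_at_linear_simps(2))
      then show ?thesis
        using t0[OF that] g dist_triangle[of "wave_at a t x" "dress a g" "wave_at a t (jost (1 - a\<^sup>2) g)"]
        by (simp add: dist_commute)
    qed
    have "dist (wave_at a t x) (wave_at a t0 x) < e" if "t \<ge> t0" for t
      using near[OF that] near[of t0] dist_triangle2[of "wave_at a t x" "wave_at a t0 x" "dress a g"] by simp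
    then show "\<exists>t0. \<forall>t\<ge>t0. dist (wave_at a t x) (wave_at a t0 x) < e"
      by blast
  qed
  then show ?thesis
    unfolding wave_def using tendsto_Lim[OF trivial_limit_at_top_linorder] by blast
qed

lemma wave_unique: "((\<lambda>t. wave_at a t x) \<longlongrightarrow> y) at_top \<Longrightarrow> wave a x = y"
  by (rule tendsto_unique[OF trivial_limit_at_top_linorder wave_at_tendsto])

lemma norm_wave [simp]: "norm (wave a x) = norm x"
proof (rule tendsto_unique[OF trivial_limit_at_top_linorder])
  show "((\<lambda>t. norm (wave_at a t x)) \<longlongrightarrow> norm (wave a x)) at_top"
    by (rule tendsto_norm[OF wave_at_tendsto])
qed simp

lemma wave_linear_simps [simp]:
  "wave a (x + y) = wave a x + wave a y"
  "wave a (c *\<^sub>C x) = c *\<^sub>C wave a x" "wave a (r *\<^sub>R x) = r *\<^sub>R wave a x"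
  using wave_unique[of a "x + y" "wave a x + wave a y"]
    wave_unique[of a "c *\<^sub>C x" "c *\<^sub>C wave a x"] wave_unique[of a "r *\<^sub>R x" "r *\<^sub>R wave a x"]
    tendsto_add[OF wave_at_tendsto[of a x] wave_at_tendsto[of a y]]
    bounded_linear.tendsto[OF bounded_linear_scaleC wave_at_tendsto[of a x]]
    bounded_linear.tendsto[OF bounded_linear_scaleR_right wave_at_tendsto[of a x]]
  by simp_all

lemma bounded_linear_wave: "bounded_linear (wave a)"
  by (rule bounded_linear_intro[of _ 1]) simp_all

lemma wave_jost: "wave a (jost (1 - a\<^sup>2) x) = dress a x"
  by (rule wave_unique[OF wave_at_jost_tendsto])

lemma wave_evol: "wave a (evol 1 \<tau> x) = evol a \<tau> (wave a x)"
proof (rule wave_unique)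
  have "filterlim (\<lambda>t::real. - \<tau> + t) at_top at_top"
    by (rule filterlim_tendsto_add_at_top[OF tendsto_const filterlim_ident])
  then have "((\<lambda>t. wave_at a (- \<tau> + t) x) \<longlongrightarrow> wave a x) at_top"
    by (rule filterlim_compose[OF wave_at_tendsto])
  then have "((\<lambda>t. evol a \<tau> (wave_at a (- \<tau> + t) x)) \<longlongrightarrow> evol a \<tau> (wave a x)) at_top"
    by (rule bounded_linear.tendsto[OF bounded_linear_evol])
  moreover have "evol a \<tau> (wave_at a (- \<tau> + t) x) = wave_at a t (evol 1 \<tau> x)" for t
    unfolding wave_at_def by (simp flip: evol_add)
  ultimately show "((\<lambda>t. wave_at a t (evol 1 \<tau> x)) \<longlongrightarrow> evol a \<tau> (wave a x)) at_top"
    by simp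
qed

lemma wave_jacobi: "wave a (jacobi 1 x) = jacobi a (wave a x)"
  by (rule intertwine_generators) (simp_all add: bounded_linear_wave wave_evol)

lemma wave_operator_at_top: "wave_operator at_top (jacobi a) (jacobi 1) = wave a"
  by (rule ext) (simp only: wave_operator_def wave_def wave_at_def op_exp_evol op_exp_evol_minus)

section \<open>Complex conjugation as time reversal\<close>

lift_definition cconj :: "ell2 \<Rightarrow> ell2" is "\<lambda>x n. cnj (x n)"
  by (simp add: square_summable_def)

declare cconj.rep_eq [simp]

lemma cconj_linear_simps [simp]:
  "cconj (x + y) = cconj x + cconj y" "cconj (x - y) = cconj x - cconj y"
  "cconj (r *\<^sub>R x) = r *\<^sub>R cconj x" "cconj (c *\<^sub>C x) = cnj c *\<^sub>C cconj x" "cconj (cconj x) = x"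
  "cconj (basis_vec n) = basis_vec n" "cconj (- x) = - cconj x"
  by (rule ell2_eqI; simp)+

lemma norm_cconj [simp]: "norm (cconj x) = norm x"
proof -
  have "(norm (cconj x))\<^sup>2 = (norm x)\<^sup>2"
    using norm_ell2_sums[of x] norm_ell2_sums[of "cconj x"] by (simp add: sums_unique2)
  then show ?thesis
    by (simp add: power2_eq_iff_nonneg)
qed

lemma bounded_linear_cconj: "bounded_linear cconj"
  by (rule bounded_linear_intro[of _ 1]) simp_all

lemma cconj_jacobi: "cconj (jacobi a x) = jacobi a (cconj x)"
  by (rule ell2_eqI) (simp add: jacobi.rep_eq)

lemma cconj_rshift: "cconj (rshift x) = rshift (cconj x)"
  by (rule ell2_eqI, case_tac n) simp_all

lemma cconj_dress: "cconj (dress a x) = dress a (cconj x)"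
  by (simp add: dress_def cconj_rshift)

text \<open>The matrix of \<open>jacobi a\<close> is real, so conjugation commutes with it but
  changes the sign of \<open>\<i>\<close>.\<close>

lemma cconj_evol: "cconj (evol a t x) = evol a (- t) (cconj x)"
  unfolding evol_def
  by (rule blin_exp_intertwine[OF bounded_linear_cconj])
    (rule ell2_eqI, simp add: scaleR_endo.rep_eq uminus_endo.rep_eq blinfun.bilinear_simps cconj_jacobi[symmetric])

text \<open>Time reversal on both sides turns the limit at minus infinity into the one already
  established at plus infinity.\<close>

lemma wave_operator_at_bot: "wave_operator at_bot (jacobi a) (jacobi 1) x = cconj (wave a (cconj x))"
proof -
  have "((\<lambda>t. cconj (wave_at a t (cconj x))) \<longlongrightarrow> cconj (wave a (cconj x))) at_top"
    by (rule bounded_linear.tendsto[OF bounded_linear_cconj wave_at_tendsto])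
  then have "((\<lambda>t. wave_at a (- t) x) \<longlongrightarrow> cconj (wave a (cconj x))) at_top"
    by (simp add: wave_at_def cconj_evol)
  then have "((\<lambda>t. wave_at a t x) \<longlongrightarrow> cconj (wave a (cconj x))) at_bot"
    by (simp add: filterlim_at_bot_mirror)
  then show ?thesis
    unfolding wave_operator_def op_exp_evol op_exp_evol_minus wave_at_def
    by (rule tendsto_Lim[OF trivial_limit_at_bot_linorder])
qed

section \<open>The scattering operator\<close>

lemma cinner_linear_simps:
  "cinner (x + y) z = cinner x z + cinner y z" "cinner (c *\<^sub>C x) z = c * cinner x z" "cinner 0 z = 0"
proof -
  show "cinner (x + y) z = cinner x z + cinner y z"
    unfolding cinner_def by (simp add: suminf_add[OF summable_cinner summable_cinner] algebra_simps)
  show "cinner (c *\<^sub>C x) z = c * cinner x z"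
    unfolding cinner_def using suminf_mult[OF summable_cinner[of x z], of c] by (simp add: mult.assoc)
qed (simp add: cinner_def)

lemma cinner_sum_left: "cinner (sum f A) z = (\<Sum>i\<in>A. cinner (f i) z)"
  by (induction A rule: infinite_finite_induct) (simp_all add: cinner_linear_simps)

lemma cinner_commute: "cinner y x = cnj (cinner x y)"
proof -
  have "(\<lambda>n. cnj (coord x n * cnj (coord y n))) sums cnj (cinner x y)"
    unfolding cinner_def by (intro iffD2[OF sums_cnj] summable_sums[OF summable_cinner])
  then show ?thesis
    by (simp add: cinner_def sums_iff mult.commute)
qed

text \<open>The coordinates \<open>b\<close> of the representing vector are forced by the basis.
  Testing the functional on the truncation of \<open>b\<close> itself bounds its partial
  sums.\<close>

lemma inner_adjoint_exists:
  assumes A: "bounded_linear A" "\<And>c x. A (c *\<^sub>C x) = c *\<^sub>C A x"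
  shows "\<exists>z. \<forall>x. inner (A x) y = inner x z"
proof -
  define b where "b n = cnj (cinner (A (basis_vec n)) y)" for n
  obtain K where K: "K \<ge> 0" "\<And>x. norm (A x) \<le> norm x * K"
    using bounded_linear.nonneg_bounded[OF A(1)] by blast
  have A_sum: "cinner (A (\<Sum>n<N. \<alpha> n *\<^sub>C basis_vec n)) y = (\<Sum>n<N. \<alpha> n * cnj (b n))" for \<alpha> N
    by (simp add: linear_sum[OF bounded_linear.linear[OF A(1)]] A(2) cinner_sum_left
        cinner_linear_simps b_def)
  have "(\<Sum>n<N. (cmod (b n))\<^sup>2) \<le> (K * norm y)\<^sup>2" for N
  proof -
    let ?v = "\<Sum>n<N. b n *\<^sub>C basis_vec n"
    have "(norm ?v)\<^sup>2 = Re (\<Sum>n<N. b n * cnj (b n))"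
      unfolding norm_sum_basis_vec cmod_power2 by (simp add: power2_eq_square)
    also have "\<dots> = inner (A ?v) y"
      by (simp only: inner_ell2_def A_sum)
    also have "\<dots> \<le> (norm ?v * K) * norm y"
      by (rule order_trans[OF norm_cauchy_schwarz]) (intro mult_right_mono K norm_ge_zero)
    finally have "norm ?v * norm ?v \<le> norm ?v * (K * norm y)"
      by (simp add: power2_eq_square mult_ac)
    then have "norm ?v \<le> K * norm y"
      using K(1) by (cases "norm ?v = 0") (auto dest: mult_left_le_imp_le)
    then have "(norm ?v)\<^sup>2 \<le> (K * norm y)\<^sup>2"
      by (intro power_mono) auto
    then show ?thesis
      by (simp only: norm_sum_basis_vec)
  qed
  then have "(\<Sum>n\<le>N. (cmod (b n))\<^sup>2) \<le> (K * norm y)\<^sup>2" for N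
    unfolding lessThan_Suc_atMost[symmetric] .
  then have "square_summable b"
    unfolding square_summable_def by (intro bounded_imp_summable[of _ "(K * norm y)\<^sup>2"]) auto
  then obtain z where z: "coord z = b"
    using coord_cases by (metis mem_Collect_eq)
  have trunc_eq: "inner (A (trunc N x)) y = inner (trunc N x) z" for N x
    unfolding inner_ell2_def trunc_def A_sum
    by (simp add: cinner_sum_left cinner_linear_simps cinner_commute[of "basis_vec _"] z)
  have "inner (A x) y = inner x z" for x
  proof (rule LIMSEQ_unique)
    show "(\<lambda>N. inner (A (trunc N x)) y) \<longlonglongrightarrow> inner (A x) y"
      by (intro tendsto_intros bounded_linear.tendsto[OF A(1)] trunc_tendsto)
    show "(\<lambda>N. inner (A (trunc N x)) y) \<longlonglongrightarrow> inner x z"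
      unfolding trunc_eq by (intro tendsto_intros trunc_tendsto)
  qed
  then show ?thesis
    by blast
qed

text \<open>Justifies the definite description in \<open>cadjoint\<close>: an adjoint exists, and
  the real inner products already determine it.\<close>

lemma inner_cadjoint:
  assumes A: "bounded_linear A" "\<And>c x. A (c *\<^sub>C x) = c *\<^sub>C A x"
  shows "inner (A x) y = inner x (cadjoint A y)"
proof -
  obtain B where B: "\<And>x y. inner (A x) y = inner x (B y)"
    using inner_adjoint_exists[OF A] by metis
  have "cadjoint A = B"
    unfolding cadjoint_def
  proof (rule the_equality)
    have "inner (A x) (iscale y) = inner x (iscale (B y))" for x y
      by (metis A(2) B inner_iscale_swap minus_minus)
    then show "\<forall>x y. cinner (A x) y = cinner x (B y)"
      by (simp add: cinner_eq_inner B)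
    fix B'
    assume "\<forall>x y. cinner (A x) y = cinner x (B' y)"
    then have "inner x (B' y) = inner x (B y)" for x y
      by (metis B inner_ell2_def)
    then show "B' = B"
      using vector_eq_ldot by blast
  qed
  then show ?thesis
    by (simp add: B)
qed

lemma scattering_operator_eq:
  "scattering_operator a x = cadjoint (wave a) (cconj (wave a (cconj x)))"
  by (simp add: scattering_operator_def wave_operator_at_top wave_operator_at_bot)

lemmas inner_wave_adjoint = inner_cadjoint[OF bounded_linear_wave wave_linear_simps(2)]

lemma wave_adjoint_wave: "cadjoint (wave a) (wave a x) = x"
proof -
  have "inner z (cadjoint (wave a) (wave a x)) = inner z x" for z
    unfolding inner_wave_adjoint[symmetric]
    by (rule norm_eq_inner_eq) (simp_all add: bounded_linear.linear bounded_linear_wave)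
  then show ?thesis
    using vector_eq_ldot by blast
qed

text \<open>Both wave operators lead to the same vector: \<open>wave\<close> sends
  \<open>jost x\<close> to \<open>dress a x\<close>, its time reversal sends the conjugated
  \<open>jost\<close> vector there too since \<open>dress\<close> is real, and the adjoint undoes
  \<open>wave\<close>.\<close>

lemma scattering_operator_jost:
  "scattering_operator a (cconj (jost (1 - a\<^sup>2) (cconj x))) = jost (1 - a\<^sup>2) x"
  by (simp add: scattering_operator_eq wave_jost cconj_dress)
    (metis wave_adjoint_wave wave_jost)

lemma scattering_operator_jacobi:
  "scattering_operator a (jacobi 1 x) = jacobi 1 (scattering_operator a x)"
proof -
  have "cadjoint (wave a) (jacobi a y) = jacobi 1 (cadjoint (wave a) y)" for y
  proof -
    have "inner z (cadjoint (wave a) (jacobi a y)) = inner z (jacobi 1 (cadjoint (wave a) y))" for z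
      by (metis inner_jacobi inner_wave_adjoint wave_jacobi)
    then show ?thesis
      using vector_eq_ldot by blast
  qed
  then show ?thesis
    by (simp add: scattering_operator_eq cconj_jacobi wave_jacobi)
qed

lemma bounded_linear_scattering_operator: "bounded_linear (scattering_operator a)"
proof -
  let ?A = "cadjoint (wave a)"
  have "bounded_linear ?A"
  proof (rule bounded_linear_intro[of _ 1])
    show "?A (x + y) = ?A x + ?A y" for x y
      by (rule vector_eq_ldot[THEN iffD1], intro allI)
        (simp add: inner_wave_adjoint[symmetric] inner_add_right)
    show "?A (r *\<^sub>R x) = r *\<^sub>R ?A x" for r x
      by (rule vector_eq_ldot[THEN iffD1], intro allI)
        (simp add: inner_wave_adjoint[symmetric])
    show "norm (?A x) \<le> norm x * 1" for x
    proof -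
      have "norm (?A x) * norm (?A x) \<le> norm (?A x) * norm x"
        using norm_cauchy_schwarz[of "wave a (?A x)" x]
        by (simp add: inner_wave_adjoint flip: power2_norm_eq_inner power2_eq_square)
      then show ?thesis
        by (cases "norm (?A x) = 0") (auto dest: mult_left_le_imp_le)
    qed
  qed
  then show ?thesis
    unfolding scattering_operator_eq[abs_def]
    by (intro bounded_linear_compose[OF \<open>bounded_linear ?A\<close>] bounded_linear_compose[OF bounded_linear_cconj]
        bounded_linear_compose[OF bounded_linear_wave] bounded_linear_cconj)
qed

text \<open>The two conjugations cancel, so the composite is again complex-linear.\<close>

lemma scattering_operator_scaleC: "scattering_operator a (c *\<^sub>C x) = c *\<^sub>C scattering_operator a x"
proof -
  have "cadjoint (wave a) (c *\<^sub>C y) = c *\<^sub>C cadjoint (wave a) y" for y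
  proof -
    have *: "inner z (c *\<^sub>C w) = inner (cnj c *\<^sub>C z) w" for z w
      by (subst (1 2) scaleC_conv) (simp add: inner_add_left inner_diff_left inner_add_right inner_iscale_swap)
    have "inner z (cadjoint (wave a) (c *\<^sub>C y)) = inner z (c *\<^sub>C cadjoint (wave a) y)" for z
      unfolding inner_wave_adjoint[symmetric] * by (simp add: inner_wave_adjoint[symmetric])
    then show ?thesis
      using vector_eq_ldot by blast
  qed
  then show ?thesis
    by (simp add: scattering_operator_eq)
qed

section \<open>Square-integrable functions\<close>

text \<open>The squared \<open>L\<^sup>2\<close> norm as an extended nonnegative number, which
  postpones questions of integrability.\<close>

definition nn2 :: "'a measure \<Rightarrow> ('a \<Rightarrow> complex) \<Rightarrow> ennreal" where
  "nn2 M f = (\<integral>\<^sup>+ l. ennreal ((cmod (f l))\<^sup>2) \<partial>M)"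

text \<open>The weight e allows the constant in front of the main term to tend to 1, as an exact
  limit of norms demands.\<close>

lemma sq_norm_add_le:
  assumes "e > 0"
  shows "(cmod (x + y))\<^sup>2 \<le> (1 + e) * (cmod x)\<^sup>2 + (1 + 1 / e) * (cmod y)\<^sup>2"
proof -
  have "(cmod (x + y))\<^sup>2 \<le> (cmod x + cmod y)\<^sup>2"
    by (intro power_mono norm_triangle_ineq) auto
  also have "\<dots> = (1 + e) * (cmod x)\<^sup>2 + (1 + 1 / e) * (cmod y)\<^sup>2 - (e * cmod x - cmod y)\<^sup>2 / e"
    using assms by (simp add: field_simps power2_eq_square)
  finally show ?thesis
    using assms by (smt (verit) divide_nonneg_pos zero_le_power2)
qed

lemma nn2_add_le:
  assumes [measurable]: "f \<in> borel_measurable M" "g \<in> borel_measurable M" and e: "e > 0"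
  shows "nn2 M (\<lambda>l. f l + g l) \<le> ennreal (1 + e) * nn2 M f + ennreal (1 + 1 / e) * nn2 M g"
proof -
  have "nn2 M (\<lambda>l. f l + g l) \<le>
      (\<integral>\<^sup>+ l. ennreal (1 + e) * ennreal ((cmod (f l))\<^sup>2) + ennreal (1 + 1 / e) * ennreal ((cmod (g l))\<^sup>2) \<partial>M)"
    unfolding nn2_def
  proof (rule nn_integral_mono)
    fix l
    have "ennreal ((cmod (f l + g l))\<^sup>2) \<le>
        ennreal ((1 + e) * (cmod (f l))\<^sup>2 + (1 + 1 / e) * (cmod (g l))\<^sup>2)"
      by (rule ennreal_leI[OF sq_norm_add_le[OF e]])
    also have "\<dots> = ennreal (1 + e) * ennreal ((cmod (f l))\<^sup>2) + ennreal (1 + 1 / e) * ennreal ((cmod (g l))\<^sup>2)"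
      using e by (simp add: ennreal_plus ennreal_mult del: ennreal_plus[symmetric])
    finally show "ennreal ((cmod (f l + g l))\<^sup>2) \<le> \<dots>" .
  qed
  also have "\<dots> = ennreal (1 + e) * nn2 M f + ennreal (1 + 1 / e) * nn2 M g"
    unfolding nn2_def by (subst nn_integral_add) (simp_all add: nn_integral_cmult)
  finally show ?thesis .
qed

lemma nn2_minus_commute: "nn2 M (\<lambda>l. f l - g l) = nn2 M (\<lambda>l. g l - f l)"
  by (simp add: nn2_def norm_minus_commute)

lemma nn2_cong_AE: "AE l in M. cmod (f l) = cmod (g l) \<Longrightarrow> nn2 M f = nn2 M g"
  unfolding nn2_def by (rule nn_integral_cong_AE) auto

lemma nn2_eq_0_iff:
  assumes [measurable]: "f \<in> borel_measurable M"
  shows "nn2 M f = 0 \<longleftrightarrow> (AE l in M. f l = 0)"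
  unfolding nn2_def by (subst nn_integral_0_iff_AE) simp_all

lemma nn2_tendsto_0_add:
  assumes [measurable]: "\<And>n. f n \<in> borel_measurable M" "\<And>n. g n \<in> borel_measurable M"
    and f: "(\<lambda>n. nn2 M (f n)) \<longlonglongrightarrow> 0" and g: "(\<lambda>n. nn2 M (g n)) \<longlonglongrightarrow> 0"
  shows "(\<lambda>n. nn2 M (\<lambda>l. f n l + g n l)) \<longlonglongrightarrow> 0"
proof (rule tendsto_sandwich[OF _ _ tendsto_const])
  show "\<forall>\<^sub>F n in sequentially. nn2 M (\<lambda>l. f n l + g n l) \<le>
      ennreal (1 + 1) * nn2 M (f n) + ennreal (1 + 1 / 1) * nn2 M (g n)"
    by (intro always_eventually allI nn2_add_le) simp_all
  have "(\<lambda>n. ennreal (1 + 1) * nn2 M (f n) + ennreal (1 + 1 / 1) * nn2 M (g n)) \<longlonglongrightarrow>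
      ennreal (1 + 1) * 0 + ennreal (1 + 1 / 1) * 0"
    by (intro tendsto_add ennreal_tendsto_cmult f g) simp_all
  then show "(\<lambda>n. ennreal (1 + 1) * nn2 M (f n) + ennreal (1 + 1 / 1) * nn2 M (g n)) \<longlonglongrightarrow> 0"
    by simp
qed simp_all

lemma nn2_limit_AE_unique:
  assumes [measurable]: "\<And>n. s n \<in> borel_measurable M" "f \<in> borel_measurable M" "g \<in> borel_measurable M"
    and f: "(\<lambda>n. nn2 M (\<lambda>l. f l - s n l)) \<longlonglongrightarrow> 0" and g: "(\<lambda>n. nn2 M (\<lambda>l. g l - s n l)) \<longlonglongrightarrow> 0"
  shows "AE l in M. f l = g l"
proof -
  have "(\<lambda>n. nn2 M (\<lambda>l. (f l - s n l) + (s n l - g l))) \<longlonglongrightarrow> 0"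
    by (rule nn2_tendsto_0_add) (use f g in \<open>simp_all add: nn2_minus_commute[of M "s _" g]\<close>)
  then have "nn2 M (\<lambda>l. f l - g l) = 0"
    by (simp add: LIMSEQ_const_iff)
  then show ?thesis
    by (subst (asm) nn2_eq_0_iff) simp_all
qed

lemma ennreal_le_if_le_factors:
  assumes "\<And>e. e > 0 \<Longrightarrow> x \<le> ennreal (1 + e) * ennreal y" "y \<ge> 0"
  shows "x \<le> ennreal y"
proof (rule ennreal_le_epsilon)
  fix e :: real
  assume "e > 0"
  then have "x \<le> ennreal (1 + e / (1 + y)) * ennreal y"
    using assms by (intro assms) auto
  also have "\<dots> = ennreal ((1 + e / (1 + y)) * y)"
    using \<open>e > 0\<close> assms(2) by (simp add: ennreal_mult)
  also have "\<dots> \<le> ennreal (y + e)"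
    using \<open>e > 0\<close> assms(2) by (intro ennreal_leI) (simp add: field_simps)
  also have "\<dots> = ennreal y + ennreal e"
    using \<open>e > 0\<close> assms(2) by simp
  finally show "x \<le> ennreal y + ennreal e" .
qed

text \<open>For fixed e the error term vanishes as n grows, despite its constant
  \<open>1 + 1 / e\<close>; only afterwards does e tend to 0.\<close>

lemma nn2_limit:
  assumes [measurable]: "\<And>n. s n \<in> borel_measurable M" "f \<in> borel_measurable M"
    and f: "(\<lambda>n. nn2 M (\<lambda>l. f l - s n l)) \<longlonglongrightarrow> 0"
    and s: "(\<lambda>n. nn2 M (s n)) \<longlonglongrightarrow> ennreal y" and y: "y \<ge> 0"
  shows "nn2 M f = ennreal y"
proof (rule antisym)
  have lim: "(\<lambda>n. ennreal (1 + e) * u n + ennreal (1 + 1 / e) * nn2 M (\<lambda>l. f l - s n l)) \<longlonglongrightarrow>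
      ennreal (1 + e) * z + ennreal (1 + 1 / e) * 0" if "u \<longlonglongrightarrow> z" for u z and e :: real
    by (intro tendsto_add ennreal_tendsto_cmult that f) simp_all
  show le: "nn2 M f \<le> ennreal y"
  proof (rule ennreal_le_if_le_factors[OF _ y])
    fix e :: real
    assume "e > 0"
    then have "nn2 M f \<le> ennreal (1 + e) * nn2 M (s n) + ennreal (1 + 1 / e) * nn2 M (\<lambda>l. f l - s n l)" for n
      using nn2_add_le[of "s n" M "\<lambda>l. f l - s n l" e] by simp
    then show "nn2 M f \<le> ennreal (1 + e) * ennreal y"
      using LIMSEQ_le_const[OF lim[OF s, of e], of "nn2 M f"] by simp
  qed
  obtain z where z: "nn2 M f = ennreal z" "z \<ge> 0"
    using le by (cases "nn2 M f") (auto simp: top_unique)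
  show "ennreal y \<le> nn2 M f"
    unfolding z
  proof (rule ennreal_le_if_le_factors[OF _ z(2)])
    fix e :: real
    assume e: "e > 0"
    have "nn2 M (s n) \<le> ennreal (1 + e) * nn2 M f + ennreal (1 + 1 / e) * nn2 M (\<lambda>l. f l - s n l)" for n
      using nn2_add_le[of f M "\<lambda>l. s n l - f l" e] e by (simp add: nn2_minus_commute[of M "s n" f])
    then show "ennreal y \<le> ennreal (1 + e) * ennreal z"
      using LIMSEQ_le[OF s lim[OF tendsto_const, of e "nn2 M f"]] by (simp add: z)
  qed
qed

text \<open>Riesz-Fischer: a rapidly Cauchy subsequence converges almost everywhere, and Fatou's
  lemma bounds the distance to its limit.\<close>

lemma L2_complete:
  fixes s :: "nat \<Rightarrow> 'a \<Rightarrow> complex"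
  assumes meas [measurable]: "\<And>n. s n \<in> borel_measurable M"
    and Cauchy: "\<And>e. e > 0 \<Longrightarrow> \<exists>N. \<forall>m\<ge>N. \<forall>n\<ge>N. nn2 M (\<lambda>l. s m l - s n l) \<le> ennreal e"
  shows "\<exists>g. g \<in> borel_measurable M \<and> (\<lambda>n. nn2 M (\<lambda>l. g l - s n l)) \<longlonglongrightarrow> 0"
proof -
  obtain K where K: "\<And>k m n. m \<ge> K k \<Longrightarrow> n \<ge> K k \<Longrightarrow> nn2 M (\<lambda>l. s m l - s n l) \<le> ennreal ((1 / 4) ^ k)"
    using Cauchy[of "(1 / 4) ^ _"] by (metis zero_less_divide_1_iff zero_less_numeral zero_less_power)
  \<comment> \<open>Cumulative sums dominate all earlier thresholds at once.\<close>
  define N where "N k = (\<Sum>j\<le>k. K j)" for k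
  have N: "N k \<ge> K j" if "j \<le> k" for j k
    using that unfolding N_def by (intro member_le_sum) auto
  define \<Delta> where "\<Delta> k l = s (N (Suc k)) l - s (N k) l" for k l
  have [measurable]: "\<Delta> k \<in> borel_measurable M" for k
    unfolding \<Delta>_def by measurable
  \<comment> \<open>The squared increments integrate to at most \<open>(1/4)^k\<close>; the weight
    \<open>2^k\<close> keeps the series summable and still controls the unsquared increments
    pointwise.\<close>
  have "(\<integral>\<^sup>+ l. (\<Sum>k. ennreal (2 ^ k * (cmod (\<Delta> k l))\<^sup>2)) \<partial>M) = (\<Sum>k. \<integral>\<^sup>+ l. ennreal (2 ^ k * (cmod (\<Delta> k l))\<^sup>2) \<partial>M)"
    by (rule nn_integral_suminf) simp
  also have "\<dots> \<le> (\<Sum>k. ennreal ((1 / 2) ^ k))"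
  proof (intro suminf_le allI)
    fix k
    have "(\<integral>\<^sup>+ l. ennreal (2 ^ k * (cmod (\<Delta> k l))\<^sup>2) \<partial>M) = ennreal (2 ^ k) * nn2 M (\<Delta> k)"
      unfolding nn2_def by (simp add: ennreal_mult nn_integral_cmult)
    also have "\<dots> \<le> ennreal (2 ^ k) * ennreal ((1 / 4) ^ k)"
      unfolding \<Delta>_def by (intro mult_left_mono K N) auto
    also have "\<dots> = ennreal ((1 / 2) ^ k)"
      by (simp add: ennreal_mult[symmetric] power_mult_distrib[symmetric])
    finally show "(\<integral>\<^sup>+ l. ennreal (2 ^ k * (cmod (\<Delta> k l))\<^sup>2) \<partial>M) \<le> ennreal ((1 / 2) ^ k)" .
  qed auto
  also have "\<dots> = ennreal (\<Sum>k. (1 / 2) ^ k)"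
    by (rule suminf_ennreal_eq[OF _ summable_sums]) (auto intro: summable_geometric)
  also have "\<dots> < \<infinity>"
    by simp
  finally have "AE l in M. (\<Sum>k. ennreal (2 ^ k * (cmod (\<Delta> k l))\<^sup>2)) \<noteq> \<infinity>"
    by (intro nn_integral_PInf_AE) (auto simp: less_top)
  then have conv: "AE l in M. convergent (\<lambda>k. s (N k) l)"
  proof (rule AE_mp, intro AE_I2 impI)
    fix l
    assume "(\<Sum>k. ennreal (2 ^ k * (cmod (\<Delta> k l))\<^sup>2)) \<noteq> \<infinity>"
    then have "summable (\<lambda>k. 2 ^ k * (cmod (\<Delta> k l))\<^sup>2)"
      by (intro summable_suminf_not_top) (auto simp: top_ennreal_def)
    then have sum: "summable (\<lambda>k. (1 / 2) ^ k + 2 ^ k * (cmod (\<Delta> k l))\<^sup>2)"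
      by (intro summable_add summable_geometric) auto
    have "norm (\<Delta> k l) \<le> (1 / 2) ^ k + 2 ^ k * (cmod (\<Delta> k l))\<^sup>2" for k
    proof -
      \<comment> \<open>Completing the square bounds an increment by a geometric term plus its
        weighted square.\<close>
      have "0 \<le> (1 / 2) ^ k * (2 ^ k * cmod (\<Delta> k l) - 1 / 2)\<^sup>2 + 3 / 4 * (1 / 2) ^ k"
        by simp
      also have "\<dots> = (1 / 2) ^ k * 2 ^ k * (2 ^ k * (cmod (\<Delta> k l))\<^sup>2) - (1 / 2) ^ k * 2 ^ k * cmod (\<Delta> k l) + (1 / 2) ^ k"
        by (simp add: power2_eq_square algebra_simps)
      also have "(1 / 2 :: real) ^ k * 2 ^ k = 1"
        by (simp add: power_mult_distrib[symmetric])
      finally show ?thesis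
        by simp
    qed
    then have "summable (\<lambda>k. \<Delta> k l)"
      by (intro summable_comparison_test'[OF sum, of 0]) auto
    then have "convergent (\<lambda>n. \<Sum>k<n. \<Delta> k l)"
      by (simp add: summable_iff_convergent)
    then have "convergent (\<lambda>n. s (N n) l - s (N 0) l)"
      unfolding \<Delta>_def sum_lessThan_telescope[of "\<lambda>k. s (N k) l"] .
    then have "convergent (\<lambda>n. (s (N n) l - s (N 0) l) + s (N 0) l)"
      by (intro convergent_add convergent_const)
    then show "convergent (\<lambda>k. s (N k) l)"
      by simp
  qed
  define g where "g l = lim (\<lambda>k. s (N k) l)" for l
  have [measurable]: "g \<in> borel_measurable M"
    unfolding g_def by measurable
  have bound: "nn2 M (\<lambda>l. g l - s n l) \<le> ennreal ((1 / 4) ^ j)" if n: "n \<ge> K j" for n j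
  proof -
    have "nn2 M (\<lambda>l. g l - s n l) = (\<integral>\<^sup>+ l. liminf (\<lambda>k. ennreal ((cmod (s (N k) l - s n l))\<^sup>2)) \<partial>M)"
      unfolding nn2_def
    proof (rule nn_integral_cong_AE, rule AE_mp[OF conv], intro AE_I2 impI)
      fix l
      assume "convergent (\<lambda>k. s (N k) l)"
      then have "(\<lambda>k. s (N k) l) \<longlonglongrightarrow> g l"
        unfolding g_def by (simp add: convergent_LIMSEQ_iff)
      then have "(\<lambda>k. ennreal ((cmod (s (N k) l - s n l))\<^sup>2)) \<longlonglongrightarrow> ennreal ((cmod (g l - s n l))\<^sup>2)"
        by (intro tendsto_intros)
      then show "ennreal ((cmod (g l - s n l))\<^sup>2) = liminf (\<lambda>k. ennreal ((cmod (s (N k) l - s n l))\<^sup>2))"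
        by (intro lim_imp_Liminf[symmetric]) auto
    qed
    also have "\<dots> \<le> liminf (\<lambda>k. nn2 M (\<lambda>l. s (N k) l - s n l))"
      unfolding nn2_def by (rule nn_integral_liminf) simp
    also have "\<dots> \<le> liminf (\<lambda>k. ennreal ((1 / 4) ^ j))"
      using K[OF N n] by (intro Liminf_mono eventually_sequentiallyI[of j]) auto
    finally show ?thesis
      by (simp add: Liminf_const)
  qed
  have "(\<lambda>n. nn2 M (\<lambda>l. g l - s n l)) \<longlonglongrightarrow> 0"
  proof (rule order_tendstoI)
    fix a :: ennreal
    assume "0 < a"
    have "(\<lambda>j. ennreal ((1 / 4) ^ j)) \<longlonglongrightarrow> ennreal 0"
      by (intro tendsto_ennrealI LIMSEQ_power_zero) simp
    then have "\<forall>\<^sub>F j in sequentially. ennreal ((1 / 4) ^ j) < a"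
      using \<open>0 < a\<close> by (intro order_tendstoD) auto
    then obtain j where j: "ennreal ((1 / 4) ^ j) < a"
      by (auto simp: eventually_sequentially)
    then show "\<forall>\<^sub>F n in sequentially. nn2 M (\<lambda>l. g l - s n l) < a"
      using bound[of j] by (intro eventually_sequentiallyI[of "K j"]) (auto intro: le_less_trans)
  qed simp
  then show ?thesis
    by (intro exI[of _ g]) simp
qed

section \<open>Orthonormality of the Chebyshev functions\<close>

abbreviation Ivl :: "real measure" where
  "Ivl \<equiv> lebesgue_on {-1<..<1}"

lemma cheb_U_cos: "cheb_U n (cos \<theta>) * sin \<theta> = sin ((real n + 1) * \<theta>)"
proof (induction n rule: induct_nat_012)
  case 1
  show ?case by (simp add: sin_double)
next
  case (ge2 n)
  have "cheb_U (Suc (Suc n)) (cos \<theta>) * sin \<theta> =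
      2 * cos \<theta> * (cheb_U (Suc n) (cos \<theta>) * sin \<theta>) - cheb_U n (cos \<theta>) * sin \<theta>"
    by (simp add: left_diff_distrib)
  also have "\<dots> = 2 * cos \<theta> * sin ((real (Suc n) + 1) * \<theta>) - sin ((real n + 1) * \<theta>)"
    by (simp only: ge2)
  also have "\<dots> = sin ((real (Suc (Suc n)) + 1) * \<theta>)"
  proof -
    have "(real (Suc (Suc n)) + 1) * \<theta> = (real (Suc n) + 1) * \<theta> + \<theta>"
      "(real n + 1) * \<theta> = (real (Suc n) + 1) * \<theta> - \<theta>"
      by (simp_all add: distrib_right)
    then show ?thesis
      by (simp only: sin_add sin_diff) simp
  qed
  finally show ?case .
qed simp

lemma cheb_U_continuous: "continuous_on S (cheb_U n)"
proof (induction n rule: induct_nat_012)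
  case 0
  have "cheb_U 0 = (\<lambda>_. 1)" by auto
  then show ?case by simp
next
  case 1
  have "cheb_U (Suc 0) = (\<lambda>l. 2 * l)" by auto
  then show ?case by (simp add: continuous_intros)
next
  case (ge2 n)
  have "cheb_U (Suc (Suc n)) = (\<lambda>l. 2 * l * cheb_U (Suc n) l - cheb_U n l)" by auto
  then show ?case using ge2 by (auto intro!: continuous_intros)
qed

definition cheb_fun :: "nat \<Rightarrow> real \<Rightarrow> real" where
  "cheb_fun n l = sqrt (2 / pi) * root 4 (1 - l\<^sup>2) * cheb_U n l"

lemma F1_basis_cheb_fun: "F1_basis n l = complex_of_real (cheb_fun n l)"
  by (simp add: F1_basis_def cheb_fun_def)

lemma cheb_fun_continuous: "continuous_on S (cheb_fun n)"
  unfolding cheb_fun_def by (intro continuous_intros cheb_U_continuous)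

lemma cheb_fun_mult:
  assumes "l \<in> {-1..1}"
  shows "cheb_fun n l * cheb_fun m l = 2 / pi * (cheb_U n l * cheb_U m l * sqrt (1 - l\<^sup>2))"
proof -
  have "0 \<le> 1 - l\<^sup>2"
    using assms by (simp add: abs_square_le_1 abs_le_iff)
  moreover have "root 4 x = sqrt (sqrt x)" for x
    using real_root_mult_exp[of 2 2 x] by (simp add: sqrt_def)
  ultimately have [symmetric]: "root 4 (1 - l\<^sup>2) * root 4 (1 - l\<^sup>2) = sqrt (1 - l\<^sup>2)"
    by simp
  then have "cheb_fun n l * cheb_fun m l =
      (sqrt (2 / pi) * sqrt (2 / pi)) * (cheb_U n l * cheb_U m l * sqrt (1 - l\<^sup>2))"
    unfolding cheb_fun_def by (simp only: mult_ac)
  then show ?thesis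
    by simp
qed

text \<open>The substitution \<open>l = cos \<theta>\<close> turns the integrand into a product of
  sines, integrated by an explicit antiderivative.\<close>

lemma cheb_U_orthogonal:
  "((\<lambda>l. cheb_U n l * cheb_U m l * sqrt (1 - l\<^sup>2)) has_integral (if n = m then pi / 2 else 0)) {-1..1}"
proof -
  \<comment> \<open>\<open>F\<close> is an antiderivative of twice the product of
    \<open>sin ((n + 1) \<theta>)\<close> and \<open>sin ((m + 1) \<theta>)\<close>; on the diagonal
    the first cosine is 1 and contributes \<theta>.\<close>
  define F where "F \<theta> = (if n = m then \<theta> else sin ((real n - real m) * \<theta>) / (real n - real m))
    - sin ((real n + real m + 2) * \<theta>) / (real n + real m + 2)" for \<theta>
  have F': "(F has_real_derivative cos ((real n - real m) * \<theta>) - cos ((real n + real m + 2) * \<theta>)) (at \<theta>)" for \<theta>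
  proof -
    have sin: "((\<lambda>\<theta>. sin (c * \<theta>) / c) has_real_derivative cos (c * \<theta>)) (at \<theta>)" if "c \<noteq> 0" for c
      using that by (auto intro!: derivative_eq_intros)
    have "real n + real m + 2 \<noteq> 0"
      by linarith
    from sin[OF this] show ?thesis
      unfolding F_def by (cases "n = m") (auto intro!: DERIV_diff DERIV_ident sin)
  qed
  have "((\<lambda>l. cheb_U n l * cheb_U m l * sqrt (1 - l\<^sup>2)) has_integral
      (- F (arccos 1) / 2 - - F (arccos (-1)) / 2)) {-1..1}"
  \<comment> \<open>Differentiability is asked only inside the interval, as \<open>arccos\<close>
    has no finite derivative at its ends.\<close>
  proof (rule fundamental_theorem_of_calculus_interior)
    have "continuous_on UNIV F"
      by (rule continuous_at_imp_continuous_on) (auto intro: DERIV_isCont F')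
    then show "continuous_on {-1..1} (\<lambda>l. - F (arccos l) / 2)"
      by (intro continuous_intros continuous_on_compose2[OF _ continuous_on_arccos']) auto
    fix l :: real
    assume l: "l \<in> {-1<..<1}"
    define \<theta> where "\<theta> = arccos l"
    have cos: "cos \<theta> = l"
      using l by (simp add: \<theta>_def)
    have sin: "sin \<theta> = sqrt (1 - l\<^sup>2)"
      using l by (simp add: \<theta>_def sin_arccos)
    have "l\<^sup>2 < 1"
      using l by (simp add: abs_square_less_1 abs_less_iff)
    then have pos: "sin \<theta> > 0"
      by (simp add: sin)
    have "((\<lambda>l. - F (arccos l) / 2) has_real_derivative
        - ((cos ((real n - real m) * \<theta>) - cos ((real n + real m + 2) * \<theta>)) * inverse (- sqrt (1 - l\<^sup>2))) / 2) (at l)"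
      using l unfolding \<theta>_def
      by (intro DERIV_cdivide DERIV_minus DERIV_chain2[OF F'] DERIV_arccos) auto
    also have "- ((cos ((real n - real m) * \<theta>) - cos ((real n + real m + 2) * \<theta>)) * inverse (- sqrt (1 - l\<^sup>2))) / 2
        = (sin ((real n + 1) * \<theta>) * sin ((real m + 1) * \<theta>)) / sin \<theta>"
    proof -
      have "sin ((real n + 1) * \<theta>) * sin ((real m + 1) * \<theta>) =
          (cos ((real n + 1) * \<theta> - (real m + 1) * \<theta>) - cos ((real n + 1) * \<theta> + (real m + 1) * \<theta>)) / 2"
        by (rule sin_times_sin)
      also have "(real n + 1) * \<theta> - (real m + 1) * \<theta> = (real n - real m) * \<theta>"
        by (simp add: algebra_simps)
      also have "(real n + 1) * \<theta> + (real m + 1) * \<theta> = (real n + real m + 2) * \<theta>"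
        by (simp add: algebra_simps)
      finally have prod: "sin ((real n + 1) * \<theta>) * sin ((real m + 1) * \<theta>) =
          (cos ((real n - real m) * \<theta>) - cos ((real n + real m + 2) * \<theta>)) / 2" .
      have "- (x * inverse (- y)) / 2 = x / 2 / y" for x y :: real
        by (cases "y = 0") (simp_all add: field_simps)
      then show ?thesis
        unfolding prod sin .
    qed
    also have "\<dots> = cheb_U n l * cheb_U m l * sqrt (1 - l\<^sup>2)"
      unfolding cheb_U_cos[symmetric] cos sin[symmetric] using pos by simp
    finally show "((\<lambda>l. - F (arccos l) / 2) has_vector_derivative
        cheb_U n l * cheb_U m l * sqrt (1 - l\<^sup>2)) (at l)"
      by (simp add: has_real_derivative_iff_has_vector_derivative)
  qed simp
  moreover have "- F (arccos 1) / 2 - - F (arccos (-1)) / 2 = (if n = m then pi / 2 else 0)"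
  proof -
    have "sin ((real n + real m + 2) * pi) = 0"
      using sin_npi[of "n + m + 2"] by (simp add: algebra_simps)
    moreover have "sin ((real n - real m) * pi) = 0"
      using sin_npi_int[of "int n - int m"] by (simp add: mult.commute)
    ultimately show ?thesis
      by (simp add: F_def)
  qed
  ultimately show ?thesis
    by simp
qed

lemma continuous_integrable_Ivl:
  fixes f :: "real \<Rightarrow> real"
  assumes "continuous_on {-1..1} f"
  shows "integrable Ivl f"
proof -
  have "set_integrable lebesgue {-1..1} f"
    by (rule absolutely_integrable_continuous_real[OF assms])
  then have "set_integrable lebesgue {-1<..<1} f"
    by (rule set_integrable_subset) auto
  then show ?thesis
    by (simp add: set_integrable_def integrable_restrict_space)
qed

lemma cheb_fun_orthonormal:
  "has_bochner_integral Ivl (\<lambda>l. cheb_fun n l * cheb_fun m l) (if n = m then 1 else 0)"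
proof -
  have int: "integrable Ivl (\<lambda>l. cheb_fun n l * cheb_fun m l)"
    by (intro continuous_integrable_Ivl continuous_intros cheb_fun_continuous)
  have "((\<lambda>l. 2 / pi * (cheb_U n l * cheb_U m l * sqrt (1 - l\<^sup>2))) has_integral
      2 / pi * (if n = m then pi / 2 else 0)) {-1..1}"
    by (intro has_integral_mult_right cheb_U_orthogonal)
  then have "((\<lambda>l. cheb_fun n l * cheb_fun m l) has_integral (if n = m then 1 else 0)) {-1..1}"
    by (rule has_integral_eq_rhs[OF has_integral_eq[rotated]]) (auto simp: cheb_fun_mult)
  then have "integral {-1<..<1} (\<lambda>l. cheb_fun n l * cheb_fun m l) = (if n = m then 1 else 0)"
    by (simp add: has_integral_Icc_iff_Ioo integral_unique)
  then show ?thesis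
    using int by (simp add: has_bochner_integral_iff lebesgue_integral_eq_integral)
qed

lemma F1_basis_measurable [measurable]: "F1_basis n \<in> borel_measurable Ivl"
proof -
  have "cheb_fun n \<in> borel_measurable Ivl"
    by (rule borel_measurable_integrable[OF continuous_integrable_Ivl[OF cheb_fun_continuous]])
  then show ?thesis
    unfolding F1_basis_cheb_fun[abs_def] by measurable
qed

lemma nn2_sum_F1_basis:
  "nn2 Ivl (\<lambda>l. \<Sum>n<N. \<alpha> n * F1_basis n l) = ennreal (\<Sum>n<N. (cmod (\<alpha> n))\<^sup>2)"
proof -
  have eq: "(cmod (\<Sum>n<N. \<alpha> n * F1_basis n l))\<^sup>2 =
      (\<Sum>n<N. \<Sum>m<N. Re (\<alpha> n * cnj (\<alpha> m)) * (cheb_fun n l * cheb_fun m l))" for l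
  proof -
    have "(cmod (\<Sum>n<N. \<alpha> n * F1_basis n l))\<^sup>2 =
        Re ((\<Sum>n<N. \<alpha> n * F1_basis n l) * cnj (\<Sum>n<N. \<alpha> n * F1_basis n l))"
      unfolding complex_norm_square[symmetric] Re_complex_of_real ..
    also have "\<dots> = (\<Sum>n<N. \<Sum>m<N. Re ((\<alpha> n * F1_basis n l) * cnj (\<alpha> m * F1_basis m l)))"
      by (simp only: cnj_sum sum_product Re_sum)
    also have "\<dots> = (\<Sum>n<N. \<Sum>m<N. Re (\<alpha> n * cnj (\<alpha> m)) * (cheb_fun n l * cheb_fun m l))"
      by (intro sum.cong refl) (simp add: F1_basis_cheb_fun algebra_simps)
    finally show ?thesis .
  qed
  have "has_bochner_integral Ivl (\<lambda>l. (cmod (\<Sum>n<N. \<alpha> n * F1_basis n l))\<^sup>2)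
      (\<Sum>n<N. \<Sum>m<N. Re (\<alpha> n * cnj (\<alpha> m)) * (if n = m then 1 else 0))"
    unfolding eq by (intro has_bochner_integral_sum has_bochner_integral_mult_right cheb_fun_orthonormal)
  also have "(\<Sum>n<N. \<Sum>m<N. Re (\<alpha> n * cnj (\<alpha> m)) * (if n = m then 1 else 0)) = (\<Sum>n<N. (cmod (\<alpha> n))\<^sup>2)"
  proof (intro sum.cong refl)
    fix n
    assume "n \<in> {..<N}"
    then have "(\<Sum>m<N. Re (\<alpha> n * cnj (\<alpha> m)) * (if n = m then 1 else 0)) = Re (\<alpha> n * cnj (\<alpha> n))"
      by (subst sum.remove[of _ n]) (auto intro!: sum.neutral)
    then show "(\<Sum>m<N. Re (\<alpha> n * cnj (\<alpha> m)) * (if n = m then 1 else 0)) = (cmod (\<alpha> n))\<^sup>2"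
      unfolding complex_norm_square[symmetric] Re_complex_of_real .
  qed
  finally show ?thesis
    unfolding nn2_def by (auto simp: has_bochner_integral_iff nn_integral_eq_integral)
qed

section \<open>The spectral representation\<close>

definition F1_partial :: "ell2 \<Rightarrow> nat \<Rightarrow> real \<Rightarrow> complex" where
  "F1_partial f N l = (\<Sum>n<N. coord f n * F1_basis n l)"

lemma F1_partial_measurable [measurable]: "F1_partial f N \<in> borel_measurable Ivl"
  unfolding F1_partial_def[abs_def] by measurable

lemma nn2_F1_partial: "nn2 Ivl (F1_partial f N) = ennreal (\<Sum>n<N. (cmod (coord f n))\<^sup>2)"
  unfolding F1_partial_def[abs_def] by (rule nn2_sum_F1_basis)

text \<open>Makes the choice in \<open>F1\<close> meaningful: by orthonormality, tails of the
  expansion have the norms of tails of the coordinates.\<close>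

lemma F1_exists:
  "\<exists>g. g \<in> borel_measurable Ivl \<and> (\<lambda>N. nn2 Ivl (\<lambda>l. g l - F1_partial f N l)) \<longlonglongrightarrow> 0"
proof (rule L2_complete)
  fix e :: real
  assume "e > 0"
  let ?c = "\<lambda>n. (cmod (coord f n))\<^sup>2"
  have "summable ?c"
    using square_summable_coord[of f] by (simp add: square_summable_def)
  then obtain N where N: "\<And>m n. m \<ge> N \<Longrightarrow> norm (sum ?c {m..<n}) < e"
    using \<open>e > 0\<close> unfolding summable_Cauchy by blast
  have *: "nn2 Ivl (\<lambda>l. F1_partial f n l - F1_partial f m l) \<le> ennreal e" if "m \<ge> N" "m \<le> n" for m n
  proof -
    let ?\<alpha> = "\<lambda>k. if k < m then 0 else coord f k"
    have split: "{..<n} = {..<m} \<union> {m..<n}"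
      using that by auto
    have "F1_partial f n l - F1_partial f m l = (\<Sum>k<n. ?\<alpha> k * F1_basis k l)" for l
      unfolding F1_partial_def split by (subst (1 2) sum.union_disjoint) (auto intro!: sum.cong)
    then have "nn2 Ivl (\<lambda>l. F1_partial f n l - F1_partial f m l) = ennreal (\<Sum>k<n. (cmod (?\<alpha> k))\<^sup>2)"
      by (simp add: nn2_sum_F1_basis)
    also have "(\<Sum>k<n. (cmod (?\<alpha> k))\<^sup>2) = sum ?c {m..<n}"
      unfolding split by (subst sum.union_disjoint) (auto intro!: sum.cong)
    also have "ennreal \<dots> \<le> ennreal e"
      using N[OF \<open>m \<ge> N\<close>, of n] by (intro ennreal_leI) simp
    finally show ?thesis .
  qed
  have "nn2 Ivl (\<lambda>l. F1_partial f m l - F1_partial f n l) \<le> ennreal e" if "m \<ge> N" "n \<ge> N" for m n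
    using *[of m n] *[of n m] that nn2_minus_commute[of Ivl "F1_partial f m" "F1_partial f n"]
    by (cases "m \<le> n") simp_all
  then show "\<exists>N. \<forall>m\<ge>N. \<forall>n\<ge>N. nn2 Ivl (\<lambda>l. F1_partial f m l - F1_partial f n l) \<le> ennreal e"
    by blast
qed measurable

lemma F1_measurable [measurable]: "F1 f \<in> borel_measurable Ivl"
  and F1_tendsto: "(\<lambda>N. nn2 Ivl (\<lambda>l. F1 f l - F1_partial f N l)) \<longlonglongrightarrow> 0"
  using someI_ex[OF F1_exists[of f]] unfolding F1_def nn2_def F1_partial_def by auto

lemma F1_unique:
  assumes "g \<in> borel_measurable Ivl" "(\<lambda>N. nn2 Ivl (\<lambda>l. g l - F1_partial f N l)) \<longlonglongrightarrow> 0"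
  shows "AE l in Ivl. F1 f l = g l"
  by (rule nn2_limit_AE_unique[OF F1_partial_measurable F1_measurable assms(1) F1_tendsto assms(2)])

lemma nn2_F1: "nn2 Ivl (F1 f) = ennreal ((norm f)\<^sup>2)"
proof (rule nn2_limit[OF F1_partial_measurable F1_measurable F1_tendsto])
  show "(\<lambda>N. nn2 Ivl (F1_partial f N)) \<longlonglongrightarrow> ennreal ((norm f)\<^sup>2)"
    unfolding nn2_F1_partial using norm_ell2_sums[of f] by (intro tendsto_ennrealI) (simp add: sums_def)
qed simp

lemma F1_add: "AE l in Ivl. F1 (x + y) l = F1 x l + F1 y l"
proof (rule F1_unique)
  have "(\<lambda>N. nn2 Ivl (\<lambda>l. (F1 x l - F1_partial x N l) + (F1 y l - F1_partial y N l))) \<longlonglongrightarrow> 0"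
    by (intro nn2_tendsto_0_add F1_tendsto) measurable
  then show "(\<lambda>N. nn2 Ivl (\<lambda>l. F1 x l + F1 y l - F1_partial (x + y) N l)) \<longlonglongrightarrow> 0"
    by (simp add: F1_partial_def ring_distribs sum.distrib algebra_simps)
qed measurable

lemma F1_scaleC: "AE l in Ivl. F1 (c *\<^sub>C x) l = c * F1 x l"
proof (rule F1_unique)
  have "nn2 Ivl (\<lambda>l. c * F1 x l - F1_partial (c *\<^sub>C x) N l) =
      ennreal ((cmod c)\<^sup>2) * nn2 Ivl (\<lambda>l. F1 x l - F1_partial x N l)" for N
  proof -
    have "c * F1 x l - F1_partial (c *\<^sub>C x) N l = c * (F1 x l - F1_partial x N l)" for l
      by (simp add: F1_partial_def sum_distrib_left algebra_simps)
    then show ?thesis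
      unfolding nn2_def by (simp add: norm_mult power_mult_distrib ennreal_mult nn_integral_cmult)
  qed
  moreover have "(\<lambda>N. ennreal ((cmod c)\<^sup>2) * nn2 Ivl (\<lambda>l. F1 x l - F1_partial x N l)) \<longlonglongrightarrow>
      ennreal ((cmod c)\<^sup>2) * 0"
    by (intro ennreal_tendsto_cmult F1_tendsto) simp
  ultimately show "(\<lambda>N. nn2 Ivl (\<lambda>l. c * F1 x l - F1_partial (c *\<^sub>C x) N l)) \<longlonglongrightarrow> 0"
    by simp
qed measurable

lemma F1_scaleR: "AE l in Ivl. F1 (r *\<^sub>R x) l = complex_of_real r * F1 x l"
  using F1_scaleC[of "complex_of_real r" x] by simp

lemma F1_diff: "AE l in Ivl. F1 (x - y) l = F1 x l - F1 y l"
  using F1_add[of "x - y" y] by eventually_elim simp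

lemma F1_zero: "AE l in Ivl. F1 0 l = 0"
  using F1_scaleC[of 0 0] by simp

lemma F1_basis_vec: "AE l in Ivl. F1 (basis_vec n) l = F1_basis n l"
proof (rule F1_unique)
  have "F1_partial (basis_vec n) N l = F1_basis n l" if "N > n" for N l
  proof -
    have "F1_partial (basis_vec n) N l = (\<Sum>k\<in>{n}. of_bool (k = n) * F1_basis k l)"
      unfolding F1_partial_def basis_vec.rep_eq by (rule sum.mono_neutral_right) (use that in auto)
    then show ?thesis
      by simp
  qed
  then have "nn2 Ivl (\<lambda>l. F1_basis n l - F1_partial (basis_vec n) N l) = 0" if "N > n" for N
    using that by (simp add: nn2_def)
  then show "(\<lambda>N. nn2 Ivl (\<lambda>l. F1_basis n l - F1_partial (basis_vec n) N l)) \<longlonglongrightarrow> 0"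
    by (intro tendsto_eventually eventually_sequentiallyI[of "Suc n"]) auto
qed measurable

text \<open>The function \<open>b\<close> is not known to be bounded, so multiplication by it cannot
  be passed to the limit directly. Dividing the discrepancy by \<open>1 + cmod (b l)\<close> makes
  it controllable by norms of the truncation error alone.\<close>

lemma F1_multiplier:
  assumes B: "bounded_linear B" "\<And>c x. B (c *\<^sub>C x) = c *\<^sub>C B x"
    and b [measurable]: "b \<in> borel_measurable Ivl"
    and basis: "\<And>n. AE l in Ivl. F1 (B (basis_vec n)) l = b l * F1 (basis_vec n) l"
  shows "AE l in Ivl. F1 (B f) l = b l * F1 f l"
proof -
  have fin: "AE l in Ivl. F1 (B (trunc N f)) l = b l * F1 (trunc N f) l" for N
  proof (induction N)
    case 0
    have "trunc 0 f = 0"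
      by (simp add: trunc_def)
    then show ?case
      using F1_zero by (auto simp: linear_simps[OF B(1)] elim: AE_mp)
  next
    case (Suc N)
    have eq: "trunc (Suc N) f = trunc N f + coord f N *\<^sub>C basis_vec N"
      by (simp add: trunc_def)
    show ?case
      unfolding eq linear_simps(1)[OF B(1)] B(2)
      using F1_add[of "B (trunc N f)" "coord f N *\<^sub>C B (basis_vec N)"]
        F1_scaleC[of "coord f N" "B (basis_vec N)"] F1_add[of "trunc N f" "coord f N *\<^sub>C basis_vec N"]
        F1_scaleC[of "coord f N" "basis_vec N"] Suc basis[of N]
      by eventually_elim (simp add: algebra_simps)
  qed
  define h where "h l = (F1 (B f) l - b l * F1 f l) / complex_of_real (1 + cmod (b l))" for l
  have h [measurable]: "h \<in> borel_measurable Ivl"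
    unfolding h_def[abs_def] by measurable
  have bound: "nn2 Ivl h \<le> ennreal (2 * (norm (B (f - trunc N f)))\<^sup>2 + 2 * (norm (f - trunc N f))\<^sup>2)" for N
  proof -
    let ?r = "f - trunc N f"
    have "AE l in Ivl. (cmod (h l))\<^sup>2 \<le> 2 * (cmod (F1 (B ?r) l))\<^sup>2 + 2 * (cmod (F1 ?r l))\<^sup>2"
      using fin[of N] F1_add[of "B ?r" "B (trunc N f)"] F1_add[of ?r "trunc N f"]
    proof eventually_elim
      case (elim l)
      have "F1 (B f) l - b l * F1 f l = F1 (B ?r) l + - (b l * F1 ?r l)"
        using elim by (simp add: linear_simps[OF B(1)] algebra_simps)
      then have "cmod (F1 (B f) l - b l * F1 f l) \<le> cmod (F1 (B ?r) l) + cmod (b l) * cmod (F1 ?r l)"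
        using norm_triangle_ineq[of "F1 (B ?r) l" "- (b l * F1 ?r l)"] by (simp add: norm_mult)
      also have "\<dots> \<le> (1 + cmod (b l)) * (cmod (F1 (B ?r) l) + cmod (F1 ?r l))"
        by (simp add: algebra_simps)
      finally have "cmod (h l) \<le> cmod (F1 (B ?r) l) + cmod (F1 ?r l)"
        unfolding h_def norm_divide norm_of_real by (simp add: divide_le_eq add_pos_nonneg mult.commute)
      then have "(cmod (h l))\<^sup>2 \<le> (cmod (F1 (B ?r) l) + cmod (F1 ?r l))\<^sup>2"
        by (intro power_mono) auto
      also have "\<dots> \<le> 2 * (cmod (F1 (B ?r) l))\<^sup>2 + 2 * (cmod (F1 ?r l))\<^sup>2"
        using sum_squares_bound[of "cmod (F1 (B ?r) l)" "cmod (F1 ?r l)"] by (simp add: power2_sum)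
      finally show ?case .
    qed
    then have "nn2 Ivl h \<le> (\<integral>\<^sup>+ l. ennreal 2 * ennreal ((cmod (F1 (B ?r) l))\<^sup>2)
        + ennreal 2 * ennreal ((cmod (F1 ?r l))\<^sup>2) \<partial>Ivl)"
      unfolding nn2_def
    proof (intro nn_integral_mono_AE, eventually_elim)
      case (elim l)
      have "ennreal ((cmod (h l))\<^sup>2) \<le>
          ennreal (2 * (cmod (F1 (B ?r) l))\<^sup>2 + 2 * (cmod (F1 ?r l))\<^sup>2)"
        by (rule ennreal_leI) (rule elim)
      then show ?case
        by (simp add: ennreal_mult)
    qed
    also have "\<dots> = ennreal 2 * nn2 Ivl (F1 (B ?r)) + ennreal 2 * nn2 Ivl (F1 ?r)"
      unfolding nn2_def by (subst nn_integral_add) (simp_all add: nn_integral_cmult)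
    also have "\<dots> = ennreal (2 * (norm (B ?r))\<^sup>2 + 2 * (norm ?r)\<^sup>2)"
      unfolding nn2_F1 by (simp only: ennreal_mult[symmetric] ennreal_plus[symmetric] zero_le_power2
          zero_le_numeral mult_nonneg_nonneg)
    finally show ?thesis .
  qed
  have "(\<lambda>N. 2 * (norm (B (f - trunc N f)))\<^sup>2 + 2 * (norm (f - trunc N f))\<^sup>2) \<longlonglongrightarrow>
      2 * (norm (B (f - f)))\<^sup>2 + 2 * (norm (f - f))\<^sup>2"
    by (intro tendsto_intros bounded_linear.tendsto[OF B(1)] trunc_tendsto)
  then have "(\<lambda>N. ennreal (2 * (norm (B (f - trunc N f)))\<^sup>2 + 2 * (norm (f - trunc N f))\<^sup>2)) \<longlonglongrightarrow> ennreal 0"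
    by (intro tendsto_ennrealI) (simp add: linear_simps[OF B(1)])
  then have "nn2 Ivl h \<le> ennreal 0"
    by (rule LIMSEQ_le_const) (use bound in blast)
  then have "AE l in Ivl. h l = 0"
    using nn2_eq_0_iff[OF h] by simp
  then show ?thesis
  proof eventually_elim
    case (elim l)
    have "1 + cmod (b l) \<noteq> 0"
      using norm_ge_zero[of "b l"] by linarith
    then have "complex_of_real (1 + cmod (b l)) \<noteq> 0"
      by (simp only: of_real_eq_0_iff not_False_eq_True)
    with elim show ?case
      by (simp add: h_def)
  qed
qed

lemma F1_jacobi: "AE l in Ivl. F1 (jacobi 1 x) l = complex_of_real l * F1 x l"
proof (rule F1_multiplier[OF bounded_linear_jacobi jacobi_scaleC])
  fix n
  have l: "complex_of_real l * F1_basis 0 l = 1 / 2 * F1_basis 1 l" for l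
    by (simp add: F1_basis_def)
  have l': "complex_of_real l * F1_basis (Suc n) l = 1 / 2 * (F1_basis n l + F1_basis (Suc (Suc n)) l)" for l n
    by (simp add: F1_basis_def algebra_simps)
  show "AE l in Ivl. F1 (jacobi 1 (basis_vec n)) l = complex_of_real l * F1 (basis_vec n) l"
  proof (cases n)
    case 0
    have "jacobi 1 (basis_vec 0) = (1 / 2) *\<^sub>R basis_vec 1"
      by (simp add: jacobi_1_conv)
    then show ?thesis
      unfolding 0 using F1_basis_vec[of 0] F1_basis_vec[of 1] F1_scaleR[of "1 / 2" "basis_vec 1"]
      by (simp only:, elim AE_mp, intro AE_I2 impI, simp add: l)
  next
    case (Suc m)
    have eq: "jacobi 1 (basis_vec (Suc m)) = (1 / 2) *\<^sub>R (basis_vec m + basis_vec (Suc (Suc m)))"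
      by (simp add: jacobi_1_conv add.commute)
    show ?thesis
      unfolding Suc eq
      using F1_basis_vec[of m] F1_basis_vec[of "Suc m"] F1_basis_vec[of "Suc (Suc m)"]
        F1_scaleR[of "1 / 2" "basis_vec m + basis_vec (Suc (Suc m))"]
        F1_add[of "basis_vec m" "basis_vec (Suc (Suc m))"]
      by eventually_elim (simp add: l')
  qed
next
  have "(\<lambda>l. l) \<in> borel_measurable Ivl"
    by (intro borel_measurable_integrable continuous_integrable_Ivl continuous_intros)
  then show "complex_of_real \<in> borel_measurable Ivl"
    by measurable
qed

lemma F1_basis_0_nonzero: "-1 < l \<Longrightarrow> l < 1 \<Longrightarrow> F1_basis 0 l \<noteq> 0"
proof -
  assume "-1 < l" "l < 1"
  then have "l\<^sup>2 < 1"
    by (simp add: abs_square_less_1 abs_less_iff)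
  then show "F1_basis 0 l \<noteq> 0"
    by (simp add: F1_basis_def)
qed

text \<open>For an operator commuting with \<open>jacobi 1\<close>, the image of the cyclic vector
  determines the symbol; \<open>F1_basis 0\<close> has no zeros in the open interval.\<close>

definition multiplier :: "(ell2 \<Rightarrow> ell2) \<Rightarrow> real \<Rightarrow> complex" where
  "multiplier B l = F1 (B (basis_vec 0)) l / F1_basis 0 l"

lemma multiplier_measurable [measurable]: "multiplier B \<in> borel_measurable Ivl"
  unfolding multiplier_def[abs_def] by measurable

text \<open>The operator has simple spectrum with cyclic vector \<open>e\<^sub>0\<close>.\<close>

lemma F1_commutant:
  assumes B: "bounded_linear B" "\<And>c x. B (c *\<^sub>C x) = c *\<^sub>C B x"
    and comm: "\<And>x. B (jacobi 1 x) = jacobi 1 (B x)"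
  shows "AE l in Ivl. F1 (B f) l = multiplier B l * F1 f l"
proof (rule F1_multiplier[OF B multiplier_measurable])
  let ?P = "\<lambda>n. AE l in Ivl. F1 (B (basis_vec n)) l = multiplier B l * F1 (basis_vec n) l"
  have double: "AE l in Ivl. F1 (2 *\<^sub>R jacobi 1 x) l = 2 * complex_of_real l * F1 x l" for x
    using F1_scaleR[of 2 "jacobi 1 x"] F1_jacobi[of x] by eventually_elim simp
  have zero: "?P 0"
    using F1_basis_vec[of 0] AE_space
    by eventually_elim (simp add: multiplier_def F1_basis_0_nonzero)
  have one: "?P 1"
    unfolding jacobi_basis_vec_0 linear_simps(5)[OF B(1)] comm
    using double[of "B (basis_vec 0)"] double[of "basis_vec 0"] zero by eventually_elim simp
  have "?P n \<and> ?P (Suc n)" for n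
  proof (induction n)
    case (Suc n)
    then have n: "?P n" and Suc_n: "?P (Suc n)"
      by blast+
    have "?P (Suc (Suc n))"
      unfolding jacobi_basis_vec_Suc linear_simps[OF B(1)] comm
      using F1_diff[of "2 *\<^sub>R jacobi 1 (B (basis_vec (Suc n)))" "B (basis_vec n)"]
        F1_diff[of "2 *\<^sub>R jacobi 1 (basis_vec (Suc n))" "basis_vec n"]
        double[of "B (basis_vec (Suc n))"] double[of "basis_vec (Suc n)"] n Suc_n
    proof eventually_elim
      case (elim l)
      show ?case
        unfolding elim by (simp add: algebra_simps)
    qed
    with Suc_n show ?case
      by blast
  qed (use zero one in simp)
  then show "?P n" for n
    by blast
qed

lemma F1_range_polynomial:
  assumes "real_polynomial_function q"
  shows "\<exists>v. AE l in Ivl. F1 v l = complex_of_real (q l) * F1_basis 0 l"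
proof -
  have mono: "\<exists>v. AE l in Ivl. F1 v l = complex_of_real (l ^ i) * F1_basis 0 l" for i
  proof (induction i)
    case 0
    show ?case
      using F1_basis_vec[of 0] by auto
  next
    case (Suc i)
    then obtain v where "AE l in Ivl. F1 v l = complex_of_real (l ^ i) * F1_basis 0 l" ..
    with F1_jacobi[of v] have "AE l in Ivl. F1 (jacobi 1 v) l = complex_of_real (l ^ Suc i) * F1_basis 0 l"
      by eventually_elim simp
    then show ?case ..
  qed
  have "\<exists>v. AE l in Ivl. F1 v l = complex_of_real (\<Sum>i\<le>n. a i * l ^ i) * F1_basis 0 l" for a n
  proof (induction n)
    case 0
    show ?case
      using F1_scaleR[of "a 0" "basis_vec 0"] F1_basis_vec[of 0]
      by (intro exI[of _ "a 0 *\<^sub>R basis_vec 0"], eventually_elim) simp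
  next
    case (Suc n)
    then obtain v where v: "AE l in Ivl. F1 v l = complex_of_real (\<Sum>i\<le>n. a i * l ^ i) * F1_basis 0 l" ..
    obtain w where w: "AE l in Ivl. F1 w l = complex_of_real (l ^ Suc n) * F1_basis 0 l"
      using mono by blast
    have "AE l in Ivl. F1 (v + a (Suc n) *\<^sub>R w) l = complex_of_real (\<Sum>i\<le>Suc n. a i * l ^ i) * F1_basis 0 l"
      using v w F1_add[of v "a (Suc n) *\<^sub>R w"] F1_scaleR[of "a (Suc n)" w]
      by eventually_elim (simp add: algebra_simps)
    then show ?case ..
  qed
  then show ?thesis
    using assms unfolding real_polynomial_function_iff_sum by auto
qed

text \<open>Supplies the vector with symbol \<open>2 sqrt (1 - \<lambda>\<^sup>2)\<close> for
  \<open>symb_eq\<close>. Polynomials in H applied to \<open>basis_vec 0\<close> approximate it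
  uniformly, and \<open>F1\<close> is isometric.\<close>

lemma F1_range_continuous:
  assumes q: "continuous_on {-1..1} q"
  shows "\<exists>v. AE l in Ivl. F1 v l = complex_of_real (q l) * F1_basis 0 l"
proof -
  have "\<exists>p. real_polynomial_function p \<and> (\<forall>l\<in>{-1..1}. \<bar>q l - p l\<bar> < 1 / Suc k)" for k
    using Stone_Weierstrass_real_polynomial_function[OF compact_Icc q, of "1 / Suc k"]
    by (metis of_nat_0_less_iff zero_less_Suc zero_less_divide_1_iff)
  then obtain p where p: "\<And>k. real_polynomial_function (p k)" "\<And>k l. l \<in> {-1..1} \<Longrightarrow> \<bar>q l - p k l\<bar> < 1 / Suc k"
    by metis
  obtain v where v: "\<And>k. AE l in Ivl. F1 (v k) l = complex_of_real (p k l) * F1_basis 0 l"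
    using F1_range_polynomial[OF p(1)] by metis
  let ?g = "\<lambda>l. complex_of_real (q l) * F1_basis 0 l"
  have [measurable]: "?g \<in> borel_measurable Ivl"
    using borel_measurable_integrable[OF continuous_integrable_Ivl[OF q]] by measurable
  have bound: "nn2 Ivl h \<le> ennreal (c\<^sup>2)"
    if "AE l in Ivl. cmod (h l) \<le> c * cmod (F1_basis 0 l)" "c \<ge> 0" for h c
  proof -
    have "nn2 Ivl h \<le> (\<integral>\<^sup>+ l. ennreal (c\<^sup>2) * ennreal ((cmod (F1_basis 0 l))\<^sup>2) \<partial>Ivl)"
      unfolding nn2_def
    proof (rule nn_integral_mono_AE, rule AE_mp[OF that(1)], intro AE_I2 impI)
      fix l
      assume "cmod (h l) \<le> c * cmod (F1_basis 0 l)"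
      then have "(cmod (h l))\<^sup>2 \<le> (c * cmod (F1_basis 0 l))\<^sup>2"
        by (intro power_mono) auto
      then show "ennreal ((cmod (h l))\<^sup>2) \<le> ennreal (c\<^sup>2) * ennreal ((cmod (F1_basis 0 l))\<^sup>2)"
        by (simp add: power_mult_distrib flip: ennreal_mult)
    qed
    also have "\<dots> = ennreal (c\<^sup>2) * nn2 Ivl (F1_basis 0)"
      unfolding nn2_def by (rule nn_integral_cmult) measurable
    also have "nn2 Ivl (F1_basis 0) = 1"
      using nn2_sum_F1_basis[of "\<lambda>_. 1" 1] by simp
    finally show ?thesis
      by simp
  qed
  have Cauchy_bound: "norm (v j - v k) \<le> 1 / Suc j + 1 / Suc k" for j k
  proof -
    have "AE l in Ivl. cmod (F1 (v j - v k) l) \<le> (1 / Suc j + 1 / Suc k) * cmod (F1_basis 0 l)"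
      using v[of j] v[of k] F1_diff[of "v j" "v k"] AE_space
    proof eventually_elim
      case (elim l)
      then have "F1 (v j - v k) l = complex_of_real (p j l - p k l) * F1_basis 0 l"
        by (simp add: algebra_simps)
      moreover have "\<bar>p j l - p k l\<bar> \<le> 1 / Suc j + 1 / Suc k"
        using p(2)[of l j] p(2)[of l k] elim(4) by auto
      ultimately show ?case
        by (simp only: norm_mult norm_of_real) (intro mult_right_mono, auto)
    qed
    then have "ennreal ((norm (v j - v k))\<^sup>2) \<le> ennreal ((1 / Suc j + 1 / Suc k)\<^sup>2)"
      unfolding nn2_F1[symmetric] by (rule bound) simp
    then have "(norm (v j - v k))\<^sup>2 \<le> (1 / Suc j + 1 / Suc k)\<^sup>2"
      by simp
    then show ?thesis
      by (rule power2_le_imp_le) simp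
  qed
  have "Cauchy v"
  proof (rule metric_CauchyI)
    fix e :: real
    assume "e > 0"
    then obtain N where N: "inverse (real (Suc N)) < e / 2"
      using reals_Archimedean[of "e / 2"] by auto
    have "dist (v j) (v k) < e" if "j \<ge> N" "k \<ge> N" for j k
    proof -
      have "1 / real (Suc j) \<le> inverse (real (Suc N))" "1 / real (Suc k) \<le> inverse (real (Suc N))"
        using that by (simp_all add: field_simps)
      then show ?thesis
        using Cauchy_bound[of j k] N by (simp add: dist_norm)
    qed
    then show "\<exists>M. \<forall>m\<ge>M. \<forall>n\<ge>M. dist (v m) (v n) < e"
      by blast
  qed
  then obtain w where w: "v \<longlonglongrightarrow> w"
    by (auto simp: Cauchy_convergent_iff convergent_def)
  have "AE l in Ivl. F1 w l = ?g l"
  proof (rule nn2_limit_AE_unique[of "\<lambda>k. F1 (v k)"])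
    have "nn2 Ivl (\<lambda>l. F1 w l - F1 (v k) l) = ennreal ((norm (w - v k))\<^sup>2)" for k
      unfolding nn2_F1[symmetric]
      by (rule nn2_cong_AE) (use F1_diff[of w "v k"] in eventually_elim, simp)
    moreover have "(\<lambda>k. ennreal ((norm (w - v k))\<^sup>2)) \<longlonglongrightarrow> ennreal ((norm (w - w))\<^sup>2)"
      by (intro tendsto_ennrealI tendsto_intros w)
    ultimately show "(\<lambda>k. nn2 Ivl (\<lambda>l. F1 w l - F1 (v k) l)) \<longlonglongrightarrow> 0"
      by simp
    show "(\<lambda>k. nn2 Ivl (\<lambda>l. ?g l - F1 (v k) l)) \<longlonglongrightarrow> 0"
    proof (rule tendsto_sandwich[OF _ _ tendsto_const])
      have "nn2 Ivl (\<lambda>l. ?g l - F1 (v k) l) \<le> ennreal ((1 / Suc k)\<^sup>2)" for k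
      proof (rule bound)
        show "AE l in Ivl. cmod (?g l - F1 (v k) l) \<le> (1 / Suc k) * cmod (F1_basis 0 l)"
          using v[of k] AE_space
        proof eventually_elim
          case (elim l)
          then have "?g l - F1 (v k) l = complex_of_real (q l - p k l) * F1_basis 0 l"
            by (simp add: algebra_simps)
          moreover have "\<bar>q l - p k l\<bar> \<le> 1 / Suc k"
            using p(2)[of l k] elim(2) by auto
          ultimately show ?case
            by (simp only: norm_mult norm_of_real) (intro mult_right_mono, auto)
        qed
      qed simp
      then show "\<forall>\<^sub>F k in sequentially. nn2 Ivl (\<lambda>l. ?g l - F1 (v k) l) \<le> ennreal ((1 / Suc k)\<^sup>2)"
        by simp
      have "(\<lambda>k. ennreal ((1 / Suc k)\<^sup>2)) \<longlonglongrightarrow> ennreal (0\<^sup>2)"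
        using LIMSEQ_inverse_real_of_nat by (intro tendsto_ennrealI tendsto_power) (simp add: inverse_eq_divide)
      then show "(\<lambda>k. ennreal ((1 / Suc k)\<^sup>2)) \<longlonglongrightarrow> 0"
        by simp
    qed simp
  qed measurable
  then show ?thesis ..
qed

section \<open>The symbol of the asymptotic shift\<close>

lemma F1_cconj: "AE l in Ivl. F1 (cconj f) l = cnj (F1 f l)"
proof (rule F1_unique)
  have "cnj \<in> borel_measurable borel"
    by (intro borel_measurable_continuous_onI continuous_intros)
  then show "(\<lambda>l. cnj (F1 f l)) \<in> borel_measurable Ivl"
    by measurable
  have "cnj (F1 f l) - F1_partial (cconj f) N l = cnj (F1 f l - F1_partial f N l)" for N l
    by (simp add: F1_partial_def F1_basis_def)
  then have "nn2 Ivl (\<lambda>l. cnj (F1 f l) - F1_partial (cconj f) N l) = nn2 Ivl (\<lambda>l. F1 f l - F1_partial f N l)" for N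
    unfolding nn2_def by (simp only: complex_mod_cnj)
  then show "(\<lambda>N. nn2 Ivl (\<lambda>l. cnj (F1 f l) - F1_partial (cconj f) N l)) \<longlonglongrightarrow> 0"
    using F1_tendsto[of f] by simp
qed

definition symb :: "real \<Rightarrow> complex" where
  "symb = multiplier ashift"

lemma symb_measurable [measurable]: "symb \<in> borel_measurable Ivl"
  by (simp add: symb_def)

lemma F1_ashift: "AE l in Ivl. F1 (ashift f) l = symb l * F1 f l"
  unfolding symb_def
  by (rule F1_commutant) (simp_all add: bounded_linear_ashift ashift_jacobi)

definition zeta :: "real \<Rightarrow> complex" where
  "zeta l = Complex l (sqrt (1 - l\<^sup>2))"

lemma zeta_props:
  assumes "-1 < l" "l < 1"
  shows "zeta l * cnj (zeta l) = 1" "zeta l + cnj (zeta l) = 2 * complex_of_real l" "sqrt (1 - l\<^sup>2) > 0"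
proof -
  have "l\<^sup>2 < 1"
    using assms by (simp add: abs_square_less_1 abs_less_iff)
  then show "sqrt (1 - l\<^sup>2) > 0" "zeta l * cnj (zeta l) = 1" "zeta l + cnj (zeta l) = 2 * complex_of_real l"
    by (simp_all add: zeta_def complex_eq_iff power2_eq_square[symmetric])
qed

text \<open>The quadratic equation of \<open>ashift\<close>, read at \<open>basis_vec 0\<close>, has
  exactly these two roots at each point.\<close>

lemma symb_cases: "AE l in Ivl. symb l = zeta l \<or> symb l = cnj (zeta l)"
  using F1_ashift[of "basis_vec 0"] F1_ashift[of "ashift (basis_vec 0)"] F1_basis_vec[of 0]
    F1_jacobi[of "ashift (basis_vec 0)"] F1_scaleR[of 2 "jacobi 1 (ashift (basis_vec 0))"]
    F1_diff[of "2 *\<^sub>R jacobi 1 (ashift (basis_vec 0))" "basis_vec 0"] AE_space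
proof eventually_elim
  case (elim l)
  then have l: "-1 < l" "l < 1"
    by simp_all
  let ?w = "F1_basis 0 l"
  have "symb l * (symb l * ?w) = 2 * complex_of_real l * (symb l * ?w) - ?w"
    using elim by (simp add: ashift_quadratic mult.assoc)
  then have "?w * (symb l * symb l - 2 * complex_of_real l * symb l + 1) = 0"
    by (simp add: algebra_simps)
  then have "symb l * symb l - 2 * complex_of_real l * symb l + 1 = 0"
    using F1_basis_0_nonzero[OF l] by simp
  moreover have "symb l * symb l - 2 * complex_of_real l * symb l + 1 = (symb l - zeta l) * (symb l - cnj (zeta l))"
    unfolding zeta_props(1,2)[OF l, symmetric] by (simp add: algebra_simps)
  ultimately show ?case
    by simp
qed

lemma inner_cconj: "inner (cconj x) (cconj y) = inner x y"
  by (rule norm_eq_inner_eq) (simp_all add: bounded_linear.linear bounded_linear_cconj)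

lemma shift_at_cconj: "shift_at t (cconj x) = cconj (shift_at (- t) x)"
  by (simp add: shift_at_def cconj_evol cconj_rshift)

lemma phase_cconj: "phase (cconj x) t = - phase x (- t)"
proof -
  have "iscale (cconj x) = cconj (- iscale x)"
    by (rule ell2_eqI) simp
  then have "phase (cconj x) t = inner (cconj (shift_at (- t) x)) (cconj (- iscale x))"
    by (simp only: phase_shift_at shift_at_cconj)
  then show ?thesis
    by (simp only: inner_cconj inner_minus_right phase_shift_at)
qed

lemma phase_tendsto: "(phase x \<longlongrightarrow> inner (ashift x) (iscale x)) at_top"
  unfolding phase_shift_at[abs_def] by (intro tendsto_intros shift_at_tendsto)

text \<open>The quantity is the limit of \<open>phase x t - phase x (- t)\<close>, since conjugation
  reverses time and the sign of the phase; monotonicity makes it nonnegative.\<close>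

lemma ashift_positive:
  "inner (ashift x - cconj (ashift (cconj x))) (iscale x) \<ge> 0"
proof -
  have "inner (cconj (ashift (cconj x))) (iscale x) = inner (ashift (cconj x)) (cconj (iscale x))"
    using inner_cconj[of "ashift (cconj x)" "cconj (iscale x)"] by simp
  also have "cconj (iscale x) = - iscale (cconj x)"
    by (rule ell2_eqI) simp
  finally have eq: "inner (cconj (ashift (cconj x))) (iscale x) = - inner (ashift (cconj x)) (iscale (cconj x))"
    by simp
  have "0 \<le> inner (ashift x) (iscale x) + inner (ashift (cconj x)) (iscale (cconj x))"
  proof (rule tendsto_lowerbound[OF tendsto_add[OF phase_tendsto phase_tendsto]])
    show "\<forall>\<^sub>F t in at_top. 0 \<le> phase x t + phase (cconj x) t"
      using phase_mono[of "- _" _ x] by (auto simp: phase_cconj eventually_at_top_linorder intro!: exI[of _ 0])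
  qed simp
  then show ?thesis
    by (simp add: inner_diff_left eq)
qed

text \<open>
  \<open>G\<close> is a square root of \<open>4 (1 - H\<^sup>2)\<close>, and positivity forces its symbol to be the positive
  root: on the vector with symbol \<open>G - 2 sqrt (1 - H\<^sup>2)\<close>, the quadratic form of \<open>G\<close> could only be
  nonpositive.
\<close>

lemma symb_eq: "AE l in Ivl. symb l = zeta l"
proof -
  \<comment> \<open>Conjugating \<open>ashift\<close> by \<open>cconj\<close> conjugates its symbol,
    so \<open>G\<close> has the real symbol \<open>2 Im symb\<close>.\<close>
  define G where "G x = (- \<i>) *\<^sub>C (ashift x - cconj (ashift (cconj x)))" for x
  have F1_G: "AE l in Ivl. F1 (G x) l = complex_of_real (2 * Im (symb l)) * F1 x l" for x
    unfolding G_def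
    using F1_scaleC[of "- \<i>" "ashift x - cconj (ashift (cconj x))"] F1_diff[of "ashift x" "cconj (ashift (cconj x))"]
      F1_ashift[of x] F1_cconj[of "ashift (cconj x)"] F1_ashift[of "cconj x"] F1_cconj[of x]
  proof eventually_elim
    case (elim l)
    have "- \<i> * (symb l - cnj (symb l)) = complex_of_real (2 * Im (symb l))"
      by (simp add: complex_eq_iff)
    then show ?case
      unfolding elim complex_cnj_mult complex_cnj_cnj
      by (metis (no_types, lifting) left_diff_distrib mult.assoc)
  qed
  have "continuous_on {-1..1} (\<lambda>l. 2 * sqrt (1 - l\<^sup>2))"
    by (intro continuous_intros)
  from F1_range_continuous[OF this] obtain v where
    v: "AE l in Ivl. F1 v l = complex_of_real (2 * sqrt (1 - l\<^sup>2)) * F1_basis 0 l" ..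
  define f where "f = G (basis_vec 0) - v"
  have F1_f: "AE l in Ivl. F1 f l = complex_of_real (2 * Im (symb l) - 2 * sqrt (1 - l\<^sup>2)) * F1_basis 0 l"
    unfolding f_def using F1_diff[of "G (basis_vec 0)" v] F1_G[of "basis_vec 0"] F1_basis_vec[of 0] v
    by eventually_elim (simp add: algebra_simps)
  let ?p = "F1 (G f + f)" and ?m = "F1 (G f - f)"
  have "0 \<le> inner (G f) f"
    using ashift_positive[of f] inner_iscale_swap[of "ashift f - cconj (ashift (cconj f))" f]
    unfolding G_def by (simp add: scaleC_conv[of "- \<i>"] inner_diff_left)
  \<comment> \<open>The two squares differ by four times \<open>inner (G f) f\<close>. Only norms
    remain, and these are integrals through the isometry \<open>F1\<close>.\<close>
  then have "(norm (G f - f))\<^sup>2 \<le> (norm (G f + f))\<^sup>2"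
    by (simp add: power2_norm_eq_inner inner_add inner_diff inner_commute)
  then have le: "nn2 Ivl ?m \<le> nn2 Ivl ?p"
    unfolding nn2_F1 by (rule ennreal_leI)
  have pm: "AE l in Ivl. ?p l = complex_of_real (2 * Im (symb l) + 1) * F1 f l \<and>
      ?m l = complex_of_real (2 * Im (symb l) - 1) * F1 f l"
    using F1_add[of "G f" f] F1_diff[of "G f" f] F1_G[of f] by eventually_elim (simp add: algebra_simps)
  have cases: "AE l in Ivl. Im (symb l) = sqrt (1 - l\<^sup>2) \<or> Im (symb l) = - sqrt (1 - l\<^sup>2)"
    using symb_cases by eventually_elim (auto simp: zeta_def)
  \<comment> \<open>Where the sign is right, \<open>F1 f\<close> vanishes; where it is wrong,
    \<open>2 Im symb + 1\<close> is the smaller factor in absolute value. This opposes the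
    integrated inequality \<open>le\<close>.\<close>
  have ge: "AE l in Ivl. ennreal ((cmod (?p l))\<^sup>2) \<le> ennreal ((cmod (?m l))\<^sup>2)"
    using pm cases F1_f AE_space
  proof eventually_elim
    case (elim l)
    show ?case
    proof (cases "Im (symb l) = sqrt (1 - l\<^sup>2)")
      case True
      then show ?thesis
        using elim by simp
    next
      case False
      then have y: "Im (symb l) = - sqrt (1 - l\<^sup>2)"
        using elim(2) by blast
      have "0 < sqrt (1 - l\<^sup>2)"
        using elim(4) by (intro zeta_props) simp_all
      then have "\<bar>2 * Im (symb l) + 1\<bar> \<le> \<bar>2 * Im (symb l) - 1\<bar>"
        unfolding y by arith
      then have "cmod (?p l) \<le> cmod (?m l)"
        using elim by (simp only: norm_mult norm_of_real) (intro mult_right_mono, auto)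
      then show ?thesis
        by (intro ennreal_leI power_mono) auto
    qed
  qed
  \<comment> \<open>The pointwise and the integrated inequality point in opposite directions, so the
    two integrands agree almost everywhere.\<close>
  have "(\<integral>\<^sup>+ l. ennreal ((cmod (?m l))\<^sup>2) - ennreal ((cmod (?p l))\<^sup>2) \<partial>Ivl) = nn2 Ivl ?m - nn2 Ivl ?p"
    unfolding nn2_def
  proof (rule nn_integral_diff[OF _ _ _ ge])
    show "(\<integral>\<^sup>+ l. ennreal ((cmod (?p l))\<^sup>2) \<partial>Ivl) \<noteq> \<infinity>"
      using nn2_F1[of "G f + f"] by (simp add: nn2_def)
  qed measurable
  also have "\<dots> = 0"
    by (rule diff_eq_0_ennreal[OF _ le]) (simp add: nn2_F1)
  finally have "AE l in Ivl. ennreal ((cmod (?m l))\<^sup>2) - ennreal ((cmod (?p l))\<^sup>2) = 0"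
    by (subst (asm) nn_integral_0_iff_AE) simp_all
  then show ?thesis
    using pm cases F1_f AE_space symb_cases
  proof eventually_elim
    case (elim l)
    then have l: "-1 < l" "l < 1"
      by simp_all
    let ?y = "Im (symb l)"
    have pos: "sqrt (1 - l\<^sup>2) > 0"
      by (rule zeta_props(3)[OF l])
    have "?y = sqrt (1 - l\<^sup>2)"
    proof (rule ccontr)
      assume "?y \<noteq> sqrt (1 - l\<^sup>2)"
      then have y: "?y = - sqrt (1 - l\<^sup>2)"
        using elim by blast
      \<comment> \<open>At the wrong sign the factor in \<open>F1_f\<close> is
        \<open>- 4 sqrt (1 - l\<^sup>2)\<close>, so the pointwise inequality becomes strict.\<close>
      then have "F1 f l \<noteq> 0"
        using elim pos F1_basis_0_nonzero[OF l] by simp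
      moreover have "\<bar>2 * ?y + 1\<bar> < \<bar>2 * ?y - 1\<bar>"
        unfolding y using pos by arith
      ultimately have "cmod (?p l) < cmod (?m l)"
        using elim by (simp only: norm_mult norm_of_real) (intro mult_strict_right_mono, auto)
      then have "(cmod (?p l))\<^sup>2 < (cmod (?m l))\<^sup>2"
        by (intro power_strict_mono) auto
      then have "ennreal ((cmod (?p l))\<^sup>2) < ennreal ((cmod (?m l))\<^sup>2)"
        by (intro ennreal_lessI) (auto intro: le_less_trans[OF zero_le_power2])
      then have "ennreal ((cmod (?m l))\<^sup>2) - ennreal ((cmod (?p l))\<^sup>2) > 0"
        by (simp add: diff_gr0_ennreal)
      then show False
        using elim by simp
    qed
    then show ?case
      using elim pos by (auto simp: zeta_def complex_eq_iff)
  qed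
qed

section \<open>The scattering matrix\<close>

lemma F1_jost: "AE l in Ivl. F1 (jost c x) l = (1 + complex_of_real c * (zeta l)\<^sup>2) * F1 x l"
  unfolding jost_def
  using F1_add[of x "c *\<^sub>R ashift (ashift x)"] F1_scaleR[of c "ashift (ashift x)"]
    F1_ashift[of "ashift x"] F1_ashift[of x] symb_eq
  by eventually_elim (simp add: algebra_simps power2_eq_square)

definition scat_symbol :: "real \<Rightarrow> real \<Rightarrow> complex" where
  "scat_symbol a l = (1 + (1 - complex_of_real a ^ 2) *
               (2 * complex_of_real l ^ 2 - 1
                  + 2 * \<i> * complex_of_real l * complex_of_real (sqrt (1 - l ^ 2)))) /
            (1 + (1 - complex_of_real a ^ 2) *
               (2 * complex_of_real l ^ 2 - 1
                  - 2 * \<i> * complex_of_real l * complex_of_real (sqrt (1 - l ^ 2))))"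

lemma zeta_power2:
  assumes "-1 \<le> l" "l \<le> 1"
  shows "(zeta l)\<^sup>2 = 2 * complex_of_real l ^ 2 - 1
      + 2 * \<i> * complex_of_real l * complex_of_real (sqrt (1 - l ^ 2))"
    and "(cnj (zeta l))\<^sup>2 = 2 * complex_of_real l ^ 2 - 1
      - 2 * \<i> * complex_of_real l * complex_of_real (sqrt (1 - l ^ 2))"
proof -
  have "l\<^sup>2 \<le> 1"
    using assms by (simp add: abs_square_le_1 abs_le_iff)
  then have "sqrt (1 - l\<^sup>2) * sqrt (1 - l\<^sup>2) = 1 - l * l"
    by (simp add: power2_eq_square)
  then show "(zeta l)\<^sup>2 = 2 * complex_of_real l ^ 2 - 1
      + 2 * \<i> * complex_of_real l * complex_of_real (sqrt (1 - l ^ 2))"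
    "(cnj (zeta l))\<^sup>2 = 2 * complex_of_real l ^ 2 - 1
      - 2 * \<i> * complex_of_real l * complex_of_real (sqrt (1 - l ^ 2))"
    by (simp_all add: zeta_def complex_eq_iff power2_eq_square)
qed

lemma scat_symbol_zeta:
  assumes "-1 \<le> l" "l \<le> 1"
  shows "scat_symbol a l = (1 + complex_of_real (1 - a\<^sup>2) * (zeta l)\<^sup>2) /
    (1 + complex_of_real (1 - a\<^sup>2) * (cnj (zeta l))\<^sup>2)"
  unfolding scat_symbol_def zeta_power2[OF assms] by simp

text \<open>A vanishing imaginary part forces \<open>a\<^sup>2 = 1\<close> or \<open>l = 0\<close>;
  the real part is then 1 or \<open>a\<^sup>2\<close>.\<close>

lemma scat_symbol_denom:
  assumes "a > 0" "-1 < l" "l < 1"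
  shows "1 + complex_of_real (1 - a\<^sup>2) * (cnj (zeta l))\<^sup>2 \<noteq> 0"
proof
  assume eq: "1 + complex_of_real (1 - a\<^sup>2) * (cnj (zeta l))\<^sup>2 = 0"
  have s: "sqrt (1 - l\<^sup>2) > 0"
    using assms by (intro zeta_props)
  have l: "-1 \<le> l" "l \<le> 1"
    using assms by auto
  have im: "(1 - a\<^sup>2) * (2 * l * sqrt (1 - l\<^sup>2)) = 0" and re: "1 + (1 - a\<^sup>2) * (2 * l\<^sup>2 - 1) = 0"
    using eq unfolding zeta_power2[OF l] by (simp_all add: complex_eq_iff power2_eq_square)
  have "1 - a\<^sup>2 = 0 \<or> l = 0"
    using im s by auto
  then show False
    using re assms by auto
qed

text \<open>The symbol is read off from one vector, the conjugated \<open>jost\<close> image of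
  \<open>basis_vec 0\<close>: the scattering operator is known on it and its transform has no
  zeros.\<close>

lemma scattering_operator_F1:
  assumes "a > 0"
  shows "AE l in Ivl. F1 (scattering_operator a f) l = scat_symbol a l * F1 f l"
proof -
  let ?B = "scattering_operator a" and ?c = "1 - a\<^sup>2"
  let ?x = "cconj (jost ?c (cconj (basis_vec 0)))"
  note F1_B = F1_commutant[OF bounded_linear_scattering_operator scattering_operator_scaleC
      scattering_operator_jacobi, of a]
  have "AE l in Ivl. multiplier ?B l = scat_symbol a l"
    using F1_B[of ?x] F1_jost[of ?c "basis_vec 0"] F1_cconj[of "jost ?c (cconj (basis_vec 0))"]
      F1_basis_vec[of 0] AE_space
  proof eventually_elim
    case (elim l)
    then have l: "-1 < l" "l < 1"
      by simp_all
    let ?w = "F1_basis 0 l"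
    have w: "?w \<noteq> 0" "cnj ?w = ?w"
      using F1_basis_0_nonzero[OF l] by (simp_all add: F1_basis_def)
    have "F1 ?x l = (1 + complex_of_real ?c * (cnj (zeta l))\<^sup>2) * ?w"
      using elim(2,3,4) w(2) by simp
    moreover have "F1 (jost ?c (basis_vec 0)) l = multiplier ?B l * F1 ?x l"
      using elim(1) unfolding scattering_operator_jost .
    ultimately have "?w * (1 + complex_of_real ?c * (zeta l)\<^sup>2) =
        ?w * (multiplier ?B l * (1 + complex_of_real ?c * (cnj (zeta l))\<^sup>2))"
      unfolding elim(2,4) by (simp only: mult_ac)
    then have "1 + complex_of_real ?c * (zeta l)\<^sup>2 =
        multiplier ?B l * (1 + complex_of_real ?c * (cnj (zeta l))\<^sup>2)"
      using w(1) by (simp only: mult_cancel_left) simp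
    then show ?case
      using scat_symbol_denom[OF assms l] l by (simp add: scat_symbol_zeta eq_divide_eq)
  qed
  with F1_B[of f] show ?thesis
    by eventually_elim simp
qed

lemma scat_symbol_continuous:
  assumes "a > 0"
  shows "continuous_on {-1<..<1} (scat_symbol a)"
  unfolding scat_symbol_def[abs_def]
proof (intro continuous_intros ballI)
  fix l :: real
  assume "l \<in> {-1<..<1}"
  then show "1 + (1 - complex_of_real a ^ 2) * (2 * complex_of_real l ^ 2 - 1
                  - 2 * \<i> * complex_of_real l * complex_of_real (sqrt (1 - l ^ 2))) \<noteq> 0"
    using scat_symbol_denom[OF assms, of l] zeta_power2(2)[of l] by simp
qed

text \<open>The set of disagreement is open, and a nonempty open set is not negligible.\<close>

lemma continuous_AE_eq:
  fixes S T :: "real \<Rightarrow> complex"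
  assumes "continuous_on {-1<..<1} S" "continuous_on {-1<..<1} T" "AE l in Ivl. S l = T l"
    and "l \<in> {-1<..<1}"
  shows "S l = T l"
proof (rule ccontr)
  assume neq: "S l \<noteq> T l"
  let ?N = "{-1<..<1} \<inter> (\<lambda>l. S l - T l) -` (- {0})"
  have "open ?N"
    by (rule continuous_open_preimage) (use assms in \<open>auto intro!: continuous_intros\<close>)
  moreover have "?N \<noteq> {}"
    using assms(4) neq by auto
  ultimately have pos: "\<not> negligible ?N"
    by (rule open_not_negligible)
  have "AE l in lebesgue. l \<in> {-1<..<1} \<longrightarrow> S l = T l"
    using assms(3) by (simp add: AE_restrict_space_iff)
  then have "AE l in lebesgue. l \<notin> ?N"
    by eventually_elim auto
  moreover have "?N \<in> sets lebesgue"
    using \<open>open ?N\<close> by simp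
  ultimately have "negligible ?N"
    unfolding negligible_iff_null_sets by (subst AE_iff_null_sets)
  with pos show False
    by simp
qed

text \<open>Uniqueness in the definite description comes from testing on \<open>basis_vec 0\<close>,
  whose transform has no zeros, and then from continuity.\<close>

lemma scattering_matrix_eq:
  assumes "a > 0"
  shows "scattering_matrix a = restrict (scat_symbol a) {-1<..<1}"
  unfolding scattering_matrix_def
proof (rule the_equality, intro conjI allI)
  let ?S = "restrict (scat_symbol a) {-1<..<1}"
  show cont: "continuous_on {-1<..<1} ?S"
    using scat_symbol_continuous[OF assms] by (subst continuous_on_cong[OF refl]) auto
  show F1: "AE l in Ivl. F1 (scattering_operator a f) l = ?S l * F1 f l" for f
    using scattering_operator_F1[OF assms, of f] AE_space by eventually_elim auto
  fix T
  assume T: "T \<in> extensional {-1<..<1} \<and> continuous_on {-1<..<1} T \<and>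
     (\<forall>f. AE l in Ivl. F1 (scattering_operator a f) l = T l * F1 f l)"
  then have "AE l in Ivl. F1 (scattering_operator a (basis_vec 0)) l = T l * F1 (basis_vec 0) l"
    by blast
  then have AE: "AE l in Ivl. T l = ?S l"
    using F1[of "basis_vec 0"] F1_basis_vec[of 0] AE_space
    by eventually_elim (auto simp: F1_basis_0_nonzero)
  show "T = ?S"
  proof (rule extensionalityI)
    show "T \<in> extensional {-1<..<1}"
      using T by blast
    show "T l = ?S l" if "l \<in> {-1<..<1}" for l
      using continuous_AE_eq[OF _ cont AE that] T by blast
  qed simp
qed simp

text \<open>At both endpoints numerator and denominator of the explicit formula equal
  \<open>2 - a\<^sup>2\<close>, so for this to be nonzero \<open>a\<close> must differ from
  \<open>sqrt 2\<close>.\<close>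

lemma scat_symbol_tendsto_1:
  assumes "a \<noteq> sqrt 2" "a > 0" "\<bar>e\<bar> = 1"
  shows "(scat_symbol a \<longlongrightarrow> 1) (at e within S)"
proof -
  have e: "e\<^sup>2 = 1"
    using assms(3) by (simp add: abs_square_eq_1)
  have "a\<^sup>2 \<noteq> 2"
    using assms(1,2) real_sqrt_unique by force
  then have "complex_of_real (2 - a\<^sup>2) \<noteq> 0"
    by (subst of_real_eq_0_iff) simp
  then have nz: "2 - (complex_of_real a)\<^sup>2 \<noteq> 0"
    by simp
  have e': "complex_of_real e ^ 2 = 1"
    using e by (metis of_real_1 of_real_power)
  have "(scat_symbol a \<longlongrightarrow> scat_symbol a e) (at e within S)"
    unfolding scat_symbol_def[abs_def]
    by (intro tendsto_intros) (use e e' nz in simp)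
  moreover have "scat_symbol a e = 1"
    unfolding scat_symbol_def using e e' nz by simp
  ultimately show ?thesis
    by simp
qed

theorem theorem4p1:
  fixes a :: real
  assumes "a > 0"
  shows "(\<forall>l\<in>{-1<..<1::real}. scattering_matrix a l =
            (1 + (1 - complex_of_real a ^ 2) *
               (2 * complex_of_real l ^ 2 - 1
                  + 2 * \<i> * complex_of_real l * complex_of_real (sqrt (1 - l ^ 2)))) /
            (1 + (1 - complex_of_real a ^ 2) *
               (2 * complex_of_real l ^ 2 - 1
                  - 2 * \<i> * complex_of_real l * complex_of_real (sqrt (1 - l ^ 2))))) \<and>
         (\<forall>l\<in>{-1<..<1::real}. scattering_matrix a (- l) = cnj (scattering_matrix a l)) \<and>
         scattering_matrix a 0 = 1 \<and>
         (a \<noteq> sqrt 2 \<longrightarrow>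
            (scattering_matrix a \<longlongrightarrow> 1) (at_left 1) \<and>
            (scattering_matrix a \<longlongrightarrow> 1) (at_right (- 1)))"
  unfolding scat_symbol_def[symmetric]
proof (intro conjI ballI impI)
  note eq = scattering_matrix_eq[OF assms]
  show formula: "scattering_matrix a l = scat_symbol a l" if "l \<in> {-1<..<1}" for l
    using that by (simp add: eq)
  show "scattering_matrix a (- l) = cnj (scattering_matrix a l)" if l: "l \<in> {-1<..<1}" for l
  proof -
    have "scat_symbol a (- l) = cnj (scat_symbol a l)"
      by (simp add: scat_symbol_def)
    then show ?thesis
      using l formula[of l] formula[of "- l"] by simp
  qed
  have "scat_symbol a 0 = 1"
    using assms by (simp add: scat_symbol_def)
  then show "scattering_matrix a 0 = 1"
    using formula[of 0] by simp
  assume a: "a \<noteq> sqrt 2"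
  \<comment> \<open>The matrix follows its formula only inside the interval, which is all that a
    one-sided limit sees.\<close>
  have "\<forall>\<^sub>F l in at_left 1. scattering_matrix a l = scat_symbol a l"
    using eventually_at_left_real[of "-1" "1::real"] formula by (auto elim: eventually_mono)
  then show "(scattering_matrix a \<longlongrightarrow> 1) (at_left 1)"
    using scat_symbol_tendsto_1[OF a assms, of 1] by (subst tendsto_cong) auto
  have "\<forall>\<^sub>F l in at_right (-1). scattering_matrix a l = scat_symbol a l"
    using eventually_at_right_real[of "-1" "1::real"] formula by (auto elim: eventually_mono)
  then show "(scattering_matrix a \<longlongrightarrow> 1) (at_right (- 1))"
    using scat_symbol_tendsto_1[OF a assms, of "-1"] by (subst tendsto_cong) auto
qed

end
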